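(* Let $\xi=(\xi_t)_{0\le t\le T}$ be progressively measurable with $\xi_0\in L^2(\mathbb P)$ and $\mathbb E\int_0^T\xi_t^2\,dt<\infty$, let $x\in\mathbb R$, and let $\Xi_T\in L^2(\mathcal F_T)$ satisfy $\int_0^T\frac{d\,\mathbb E[\Xi_t^2]}{T-t}<\infty$, where $\Xi_t=\mathbb E[\Xi_T\mid\mathcal F_t]$. Assume there exist constants $L_1,L_2\ge0$ and exponents $\alpha,\beta>0$ such that $$\omega_\xi(h)\le L_1h^\alpha,\quad h>0,\qquad\text{and}\qquad\Theta(a)\le L_2a^\beta,\quad0<a\le T/2.$$ Then for every $\kappa\in(0,T^2/4]$, $$v^c(\kappa)\le6\sqrt\kappa\,\mathbb E[(x-\xi_0)^2]+12L_1\,\Gamma(\alpha+1)\,\kappa^{\alpha/2}+6L_2\,\kappa^{\beta/2}+6\kappa\,\Lambda(\sqrt\kappa).$$ Consequently, $v^c(\kappa)=O\bigl(\kappa^{(1\wedge\alpha\wedge\beta)/2}\bigr)$ as $\kappa\downarrow0$, and in particular $v^c(\kappa)=O(\sqrt\kappa)$ if $\alpha,\beta\ge1$. If, in addition, $x=\xi_0$ almost surely, then the sharper estimate $$v^c(\kappa)\le6L_1\,\Gamma(\alpha+1)\,\kappa^{\alpha/2}+6L_2\,\kappa^{\beta/2}+6\kappa\,\Lambda(\sqrt\kappa)$$ holds (for $\kappa\in(0,T^2/4]$). In particular, $v^c(\kappa)=O\bigl(\kappa^{(\alpha\wedge\beta\wedge2)/2}\bigr)$ as $\kappa\downarrow0$,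 and $v^c(\kappa)=o(\sqrt\kappa)$ if $\alpha,\beta>1$.
   Context: Fix $T>0$, a filtered probability space $(\Omega,\mathcal F,(\mathcal F_t)_{0\le t\le T},\mathbb P)$ satisfying the usual conditions, and $x\in\mathbb R$. Let $\mathcal U$ be the set of progressively measurable processes $u$ on $[0,T]$ with $\mathbb E\int_0^T u_t^2\,dt<\infty$; for $u\in\mathcal U$ let $X^u_t=x+\int_0^tu_s\,ds$ and, for $\kappa\ge0$, $$J_\kappa(u)=\mathbb E\Big[\tfrac12\int_0^T(X^u_t-\xi_t)^2\,dt+\tfrac\kappa2\int_0^Tu_t^2\,dt\Big].$$ $(\Xi_t)_{0\le t\le T}$ is the càdlàg version of $\mathbb E[\Xi_T\mid\mathcal F_t]$. The constrained value is $v^c(\kappa)=\inf_{u\in\mathcal U^c}J_\kappa(u)$, where $\mathcal U^c=\{u\in\mathcal U: X^u_T=\Xi_T\ \mathbb P\text{-a.s.}\}$. For $h>0$, $\omega_\xi(h)=\mathbb E\int_0^T|\xi_t-\xi_{(t-h)^+}|^2\,dt$ with $(t-h)^+=\max\{t-h,0\}$. For $0<a\le T/2$, $$\Theta(a)=\mathbb E\int_{T-2a}^T|\xi_t-\Xi_t|^2\,dt,\qquad \Lambda(a)=\int_{T-2a}^T\frac{d\,\mathbb E[\Xi_t^2]}{T-t}.$$ Integrals with respect to $d\,\mathbb E[\Xi_t^2]$ are Stieltjes integrals with respect to the nondecreasing function $t\mapsto\mathbb E[\Xi_t^2]$ on $[0,T]$, with the convention that an atom at $T$ contributes $+\infty$.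 $\Gamma$ is the Gamma function, $\wedge$ denotes minimum. *)

theory Defs
  imports "HOL-Probability.Probability" "HOL-Library.Landau_Symbols"
begin

text \<open>
  Filtrations and processes are indexed by all reals, but only their values at times in
  \<open>{0..T}\<close> matter. Expectations of nonnegative quantities that may a priori be infinite are
  \<open>ennreal\<close>-valued.
\<close>

locale usual_filtered_prob_space = prob_space M + complete_measure M
  for M :: "'a measure" and F :: "real \<Rightarrow> 'a measure" and T :: real +
  assumes F_subalgebra: "\<And>t. t \<in> {0..T} \<Longrightarrow> subalgebra M (F t)"
    and F_mono: "\<And>s t. 0 \<le> s \<Longrightarrow> s \<le> t \<Longrightarrow> t \<le> T \<Longrightarrow> sets (F s) \<subseteq> sets (F t)"
    and F_null_sets: "null_sets M \<subseteq> sets (F 0)"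
    and F_right_continuous: "\<And>t. t \<in> {0..<T} \<Longrightarrow> sets (F t) = (\<Inter>s\<in>{t<..T}. sets (F s))"

definition progressively_measurable ::
    "(real \<Rightarrow> 'a measure) \<Rightarrow> real \<Rightarrow> (real \<Rightarrow> 'a \<Rightarrow> real) \<Rightarrow> bool" where
  "progressively_measurable F T u \<longleftrightarrow>
     (\<forall>t\<in>{0..T}. (\<lambda>(s, \<omega>). u s \<omega>) \<in> borel_measurable (restrict_space borel {0..t} \<Otimes>\<^sub>M F t))"

definition energy :: "'a measure \<Rightarrow> real \<Rightarrow> real \<Rightarrow> (real \<Rightarrow> 'a \<Rightarrow> real) \<Rightarrow> ennreal" where
  "energy M a b u = (\<integral>\<^sup>+\<omega>. (\<integral>\<^sup>+t\<in>{a..b}. ennreal ((u t \<omega>)\<^sup>2) \<partial>lborel) \<partial>M)"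

definition controls ::
    "'a measure \<Rightarrow> (real \<Rightarrow> 'a measure) \<Rightarrow> real \<Rightarrow> (real \<Rightarrow> 'a \<Rightarrow> real) set" where
  "controls M F T = {u. progressively_measurable F T u \<and> energy M 0 T u < \<infinity>}"

text \<open>
  For a control, almost every path is integrable on \<open>{0..T}\<close>; on the remaining null set the
  Lebesgue integral below has the default value 0.
\<close>

definition state :: "real \<Rightarrow> (real \<Rightarrow> 'a \<Rightarrow> real) \<Rightarrow> real \<Rightarrow> 'a \<Rightarrow> real" where
  "state x u t \<omega> = x + (LINT s:{0..t}|lborel. u s \<omega>)"

definition cost ::
    "'a measure \<Rightarrow> real \<Rightarrow> real \<Rightarrow> (real \<Rightarrow> 'a \<Rightarrow> real) \<Rightarrow> real \<Rightarrow> (real \<Rightarrow> 'a \<Rightarrow> real) \<Rightarrow> ennreal" where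
  "cost M T x \<xi> \<kappa> u =
     (\<integral>\<^sup>+\<omega>. (ennreal (1/2) * (\<integral>\<^sup>+t\<in>{0..T}. ennreal ((state x u t \<omega> - \<xi> t \<omega>)\<^sup>2) \<partial>lborel)
           + ennreal (\<kappa>/2) * (\<integral>\<^sup>+t\<in>{0..T}. ennreal ((u t \<omega>)\<^sup>2) \<partial>lborel)) \<partial>M)"

definition constrained_controls ::
    "'a measure \<Rightarrow> (real \<Rightarrow> 'a measure) \<Rightarrow> real \<Rightarrow> real \<Rightarrow> ('a \<Rightarrow> real) \<Rightarrow> (real \<Rightarrow> 'a \<Rightarrow> real) set" where
  "constrained_controls M F T x \<eta> = {u \<in> controls M F T. AE \<omega> in M. state x u T \<omega> = \<eta> \<omega>}"

definition constrained_value ::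
    "'a measure \<Rightarrow> (real \<Rightarrow> 'a measure) \<Rightarrow> real \<Rightarrow> real \<Rightarrow> (real \<Rightarrow> 'a \<Rightarrow> real) \<Rightarrow> ('a \<Rightarrow> real) \<Rightarrow> real \<Rightarrow> ennreal" where
  "constrained_value M F T x \<xi> \<eta> \<kappa> = (INF u\<in>constrained_controls M F T x \<eta>. cost M T x \<xi> \<kappa> u)"

definition cadlag_on :: "real \<Rightarrow> (real \<Rightarrow> real) \<Rightarrow> bool" where
  "cadlag_on T f \<longleftrightarrow>
     (\<forall>t\<in>{0..<T}. (f \<longlongrightarrow> f t) (at_right t)) \<and> (\<forall>t\<in>{0<..T}. \<exists>l. (f \<longlongrightarrow> l) (at_left t))"

definition cadlag_cond_exp_version ::
    "'a measure \<Rightarrow> (real \<Rightarrow> 'a measure) \<Rightarrow> real \<Rightarrow> ('a \<Rightarrow> real) \<Rightarrow> (real \<Rightarrow> 'a \<Rightarrow> real) \<Rightarrow> bool" where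
  "cadlag_cond_exp_version M F T \<eta> \<Xi> \<longleftrightarrow>
     (\<forall>t\<in>{0..T}. \<Xi> t \<in> borel_measurable (F t) \<and> (AE \<omega> in M. \<Xi> t \<omega> = real_cond_exp M (F t) \<eta> \<omega>)) \<and>
     (AE \<omega> in M. cadlag_on T (\<lambda>t. \<Xi> t \<omega>))"

definition omega_mod :: "'a measure \<Rightarrow> real \<Rightarrow> (real \<Rightarrow> 'a \<Rightarrow> real) \<Rightarrow> real \<Rightarrow> ennreal" where
  "omega_mod M T \<xi> h = energy M 0 T (\<lambda>t \<omega>. \<xi> t \<omega> - \<xi> (max (t - h) 0) \<omega>)"

definition Theta ::
    "'a measure \<Rightarrow> real \<Rightarrow> (real \<Rightarrow> 'a \<Rightarrow> real) \<Rightarrow> (real \<Rightarrow> 'a \<Rightarrow> real) \<Rightarrow> real \<Rightarrow> ennreal" where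
  "Theta M T \<xi> \<Xi> a = energy M (T - 2 * a) T (\<lambda>t \<omega>. \<xi> t \<omega> - \<Xi> t \<omega>)"

text \<open>
  The Stieltjes integral of \<open>1 / (T - t)\<close> from \<open>s\<close> to \<open>T\<close> with respect to the nondecreasing function
  \<open>t \<mapsto> E[(\<Xi> t)\<^sup>2]\<close> on \<open>{0..T}\<close>, extended constantly outside. The function is right-continuous when
  \<open>\<Xi>\<close> is a cadlag square-integrable martingale, as \<open>interval_measure\<close> requires; accordingly the
  domain of integration is \<open>{s<..T}\<close>, so a jump at \<open>s\<close> is not counted (and there is no atom at 0).
  In \<open>ennreal\<close>, \<open>1 / 0 = \<infinity>\<close> and \<open>\<infinity> * 0 = 0\<close>, so an atom at \<open>T\<close> contributes \<open>\<infinity>\<close> and the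
  endpoint \<open>T\<close> contributes nothing if there is no atom.
\<close>

definition stieltjes_tail ::
    "'a measure \<Rightarrow> real \<Rightarrow> (real \<Rightarrow> 'a \<Rightarrow> real) \<Rightarrow> real \<Rightarrow> ennreal" where
  "stieltjes_tail M T \<Xi> s =
     (\<integral>\<^sup>+t\<in>{s<..T}. 1 / ennreal (T - t)
        \<partial>interval_measure (\<lambda>t. LINT \<omega>|M. (\<Xi> (max 0 (min T t)) \<omega>)\<^sup>2))"

definition Lambda :: "'a measure \<Rightarrow> real \<Rightarrow> (real \<Rightarrow> 'a \<Rightarrow> real) \<Rightarrow> real \<Rightarrow> ennreal" where
  "Lambda M T \<Xi> a = stieltjes_tail M T \<Xi> (T - 2 * a)"

end

theory Submission
  imports Defs
begin

text \<open>
  The bound comes from one explicit control, with \<open>a = sqrt \<kappa>\<close>. Up to a time \<open>r\<close> in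
  \<open>{T - 2 * a..T - a}\<close> the state is the moving average of \<open>\<xi>\<close> over a window of length \<open>a\<close>, plus
  the initial error \<open>x - \<xi> 0\<close> decaying linearly on \<open>{0..a}\<close>; both its distance to \<open>\<xi>\<close> and \<open>a\<close>
  times its speed are controlled by the modulus \<open>omega_mod\<close>. (An exponential window would yield the
  factor \<open>\<Gamma>(\<alpha> + 1)\<close> exactly; the flat window yields \<open>1 / (\<alpha> + 1) \<le> \<Gamma>(\<alpha> + 1)\<close>.) The remaining
  time is cut into dyadic pieces shrinking towards \<open>T\<close>. On each of them the state moves linearly to
  the value of \<open>\<Xi>\<close> at the beginning of the piece, which is already known there. Since \<open>\<Xi>\<close> has
  orthogonal increments, all errors are increments of \<open>E[(\<Xi> t)\<^sup>2]\<close>, and \<open>T - t\<close> is comparable to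
  the length of the piece, so energy and tracking cost sum up to multiples of the Stieltjes integral.
\<close>

section \<open>The target martingale\<close>

text \<open>Holding a gap \<open>g\<close> for a time \<open>a\<close> costs of order
  \<open>a * g\<^sup>2\<close> in tracking, closing it within that time costs of order
  \<open>\<kappa> * g\<^sup>2 / a\<close> in energy. The choice \<open>a = sqrt \<kappa>\<close>
  makes the two prices equal. The obstacle is the exact terminal condition. An adapted state can
  only aim at values of \<open>\<Xi>\<close> already revealed, so after finitely many such moves it
  is in general still off target at \<open>T\<close>. Hence infinitely many shrinking moves are
  made, and their energy is a sum of increments of \<open>E[(\<Xi> t)\<^sup>2]\<close> divided by
  lengths comparable to \<open>T - t\<close>. This is where the weight of the Stieltjes integral
  comes from. Halving keeps consecutive lengths comparable, so being one piece late costs only a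
  constant factor. The constants have room. The construction gives 5 in place of 6 for the terms
  with \<open>Theta\<close> and \<open>Lambda\<close>, and 11/4 in place of 3 (before a factor 1 or
  2) for the initial error.\<close>

context usual_filtered_prob_space
begin

lemma space_F: "t \<in> {0..T} \<Longrightarrow> space (F t) = space M"
  using F_subalgebra by (auto simp: subalgebra_def)

lemma F_measurable_mono:
  assumes "0 \<le> s" "s \<le> t" "t \<le> T" "G \<in> measurable (F s) N"
  shows "G \<in> measurable (F t) N"
proof -
  have "subalgebra (F t) (F s)"
    using F_mono[OF assms(1-3)] space_F[of s] space_F[of t] assms(1-3)
    by (auto simp: subalgebra_def)
  then show ?thesis using assms(4) measurable_from_subalg by blast
qed

lemma F_measurable_M:
  assumes "t \<in> {0..T}" "G \<in> measurable (F t) N"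
  shows "G \<in> measurable M N"
  using F_subalgebra[OF assms(1)] assms(2) measurable_from_subalg by blast

end

locale square_integrable_target = usual_filtered_prob_space M F T
  for M :: "'a measure" and F :: "real \<Rightarrow> 'a measure" and T :: real +
  fixes \<eta> :: "'a \<Rightarrow> real" and \<Xi> :: "real \<Rightarrow> 'a \<Rightarrow> real"
  assumes T_pos: "0 < T"
    and target_measurable: "\<eta> \<in> borel_measurable (F T)"
    and target_sq: "integrable M (\<lambda>\<omega>. (\<eta> \<omega>)\<^sup>2)"
    and version: "cadlag_cond_exp_version M F T \<eta> \<Xi>"
begin

definition msq :: "real \<Rightarrow> real" where
  "msq t = (LINT \<omega>|M. (\<Xi> t \<omega>)\<^sup>2)"

lemma target_measurable_M [measurable]: "\<eta> \<in> borel_measurable M"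
  using target_measurable F_measurable_M[of T] T_pos by auto

lemma Xi_adapted: "t \<in> {0..T} \<Longrightarrow> \<Xi> t \<in> borel_measurable (F t)"
  using version by (auto simp: cadlag_cond_exp_version_def)

lemma Xi_measurable: "t \<in> {0..T} \<Longrightarrow> \<Xi> t \<in> borel_measurable M"
  using Xi_adapted F_measurable_M by blast

lemma Xi_AE: "t \<in> {0..T} \<Longrightarrow> AE \<omega> in M. \<Xi> t \<omega> = real_cond_exp M (F t) \<eta> \<omega>"
  using version by (auto simp: cadlag_cond_exp_version_def)

lemma subalg_F: "t \<in> {0..T} \<Longrightarrow> sigma_finite_subalgebra M (F t)"
  by (intro finite_measure_subalgebra_is_sigma_finite finite_measure_subalgebra.intro
      finite_measure_subalgebra_axioms.intro F_subalgebra finite_measure_axioms)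

lemma target_integrable: "integrable M \<eta>"
  using square_integrable_imp_integrable[OF target_measurable_M target_sq] .

lemma Xi_sq_integrable:
  assumes "t \<in> {0..T}"
  shows "integrable M (\<lambda>\<omega>. (\<Xi> t \<omega>)\<^sup>2)"
proof -
  interpret sub: sigma_finite_subalgebra M "F t" using subalg_F[OF assms] .
  have "integrable M (\<lambda>\<omega>. (real_cond_exp M (F t) \<eta> \<omega>)\<^sup>2)"
    by (rule sub.integrable_convex_cond_exp[where I = UNIV])
       (use target_integrable target_sq convex_power2 in auto)
  then show ?thesis
    by (rule integrable_cong_AE_imp)
       (use Xi_measurable[OF assms] Xi_AE[OF assms] in auto)
qed

lemma Xi_terminal: "AE \<omega> in M. \<Xi> T \<omega> = \<eta> \<omega>"
proof -
  have T: "T \<in> {0..T}" using T_pos by auto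
  interpret sub: sigma_finite_subalgebra M "F T" using subalg_F[OF T] .
  show ?thesis
    using Xi_AE[OF T] sub.real_cond_exp_F_meas[OF target_integrable target_measurable] by auto
qed

lemma product_integrable:
  assumes "f \<in> borel_measurable M" "g \<in> borel_measurable M"
    "integrable M (\<lambda>\<omega>. (f \<omega>)\<^sup>2)" "integrable M (\<lambda>\<omega>. (g \<omega>)\<^sup>2)"
  shows "integrable M (\<lambda>\<omega>. f \<omega> * g \<omega> :: real)"
proof (rule Bochner_Integration.integrable_bound)
  show "integrable M (\<lambda>\<omega>. (f \<omega>)\<^sup>2 + (g \<omega>)\<^sup>2)" using assms by auto
  have "\<bar>a * b\<bar> \<le> a\<^sup>2 + b\<^sup>2" for a b :: real
  proof -
    have "2 * (\<bar>a\<bar> * \<bar>b\<bar>) \<le> \<bar>a\<bar>\<^sup>2 + \<bar>b\<bar>\<^sup>2"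
      using sum_squares_bound[of "\<bar>a\<bar>" "\<bar>b\<bar>"] by (simp add: mult.assoc)
    moreover have "0 \<le> \<bar>a\<bar> * \<bar>b\<bar>" by simp
    ultimately show ?thesis unfolding abs_mult power2_abs by linarith
  qed
  then show "AE x in M. norm (f x * g x) \<le> norm ((f x)\<^sup>2 + (g x)\<^sup>2)" by simp
qed (use assms in auto)

lemma diff_sq_integrable:
  assumes "f \<in> borel_measurable M" "g \<in> borel_measurable M"
    "integrable M (\<lambda>\<omega>. (f \<omega>)\<^sup>2)" "integrable M (\<lambda>\<omega>. (g \<omega>)\<^sup>2)"
  shows "integrable M (\<lambda>\<omega>. (f \<omega> - g \<omega> :: real)\<^sup>2)"
  using assms product_integrable[OF assms] by (simp add: power2_diff mult.assoc)

text \<open>\<open>G\<close> is known at time \<open>t\<close>, so it may be moved inside the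
  conditional expectation. The right-hand side no longer mentions \<open>t\<close>, which is what
  \<open>Xi_pythagoras\<close> exploits.\<close>

lemma Xi_inner:
  assumes "t \<in> {0..T}" "G \<in> borel_measurable (F t)" "integrable M (\<lambda>\<omega>. (G \<omega>)\<^sup>2)"
  shows "(LINT \<omega>|M. \<Xi> t \<omega> * G \<omega>) = (LINT \<omega>|M. \<eta> \<omega> * G \<omega>)"
proof -
  interpret sub: sigma_finite_subalgebra M "F t" using subalg_F[OF assms(1)] .
  have G [measurable]: "G \<in> borel_measurable M" using F_measurable_M[OF assms(1,2)] .
  note [measurable] = Xi_measurable[OF assms(1)]
  have "integrable M (\<lambda>\<omega>. G \<omega> * \<eta> \<omega>)"
    by (rule product_integrable) (use assms target_sq in auto)
  from sub.real_cond_exp_intg(2)[OF this assms(2)]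
  have "(LINT \<omega>|M. G \<omega> * real_cond_exp M (F t) \<eta> \<omega>) = (LINT \<omega>|M. G \<omega> * \<eta> \<omega>)" by simp
  moreover have "(LINT \<omega>|M. G \<omega> * real_cond_exp M (F t) \<eta> \<omega>) = (LINT \<omega>|M. G \<omega> * \<Xi> t \<omega>)"
    by (rule integral_cong_AE) (use Xi_AE[OF assms(1)] in auto)
  ultimately show ?thesis by (simp add: mult.commute)
qed

text \<open>The increment of \<open>\<Xi>\<close> from \<open>s\<close> to \<open>t\<close> is
  orthogonal to everything known at time \<open>s\<close>. In the expanded squares both mixed terms
  equal the inner product of \<open>\<eta>\<close> and \<open>G\<close> by \<open>Xi_inner\<close>,
  so only \<open>msq\<close> changes with time.\<close>

lemma Xi_pythagoras:
  assumes "0 \<le> s" "s \<le> t" "t \<le> T" "G \<in> borel_measurable (F s)" "integrable M (\<lambda>\<omega>. (G \<omega>)\<^sup>2)"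
  shows "(LINT \<omega>|M. (\<Xi> t \<omega> - G \<omega>)\<^sup>2) = msq t - msq s + (LINT \<omega>|M. (\<Xi> s \<omega> - G \<omega>)\<^sup>2)"
proof -
  have G [measurable]: "G \<in> borel_measurable M"
    using F_measurable_M[OF _ assms(4)] assms by auto
  have expand: "(LINT \<omega>|M. (\<Xi> r \<omega> - G \<omega>)\<^sup>2)
      = msq r + (LINT \<omega>|M. (G \<omega>)\<^sup>2) - 2 * (LINT \<omega>|M. \<Xi> r \<omega> * G \<omega>)" if "r \<in> {0..T}" for r
  proof -
    note [measurable] = Xi_measurable[OF that]
    have "integrable M (\<lambda>\<omega>. \<Xi> r \<omega> * G \<omega>)"
      by (rule product_integrable) (use assms Xi_sq_integrable[OF that] in auto)
    then show ?thesis
      using assms Xi_sq_integrable[OF that] by (simp add: power2_diff mult.assoc msq_def)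
  qed
  have "(LINT \<omega>|M. \<Xi> t \<omega> * G \<omega>) = (LINT \<omega>|M. \<Xi> s \<omega> * G \<omega>)"
    using Xi_inner[of s G] Xi_inner[of t G] F_measurable_mono[OF assms(1-4)] assms by auto
  then show ?thesis using expand[of s] expand[of t] assms by auto
qed

lemma Xi_increment:
  assumes "0 \<le> s" "s \<le> t" "t \<le> T"
  shows "(LINT \<omega>|M. (\<Xi> t \<omega> - \<Xi> s \<omega>)\<^sup>2) = msq t - msq s"
  using Xi_pythagoras[OF assms Xi_adapted Xi_sq_integrable] assms by auto

lemma msq_mono: "0 \<le> s \<Longrightarrow> s \<le> t \<Longrightarrow> t \<le> T \<Longrightarrow> msq s \<le> msq t"
  using Xi_increment[of s t] integral_nonneg_AE[of "\<lambda>\<omega>. (\<Xi> t \<omega> - \<Xi> s \<omega>)\<^sup>2" M] by auto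

lemma nn_increment:
  assumes "0 \<le> s" "s \<le> t" "t \<le> T"
  shows "(\<integral>\<^sup>+\<omega>. ennreal ((\<Xi> t \<omega> - \<Xi> s \<omega>)\<^sup>2) \<partial>M) = ennreal (msq t - msq s)"
  using nn_integral_eq_integral[OF diff_sq_integrable[of "\<Xi> t" "\<Xi> s"]] Xi_increment[OF assms]
    assms Xi_measurable Xi_sq_integrable by auto

text \<open>Monotonicity leaves only \<open>msq (t+) \<le> msq t\<close>, which is Fatou's lemma applied to
  \<open>\<Xi> T - \<Xi> s\<close> as \<open>s\<close> decreases to \<open>t\<close>.\<close>

lemma msq_right_continuous:
  assumes "0 \<le> t" "t < T"
  shows "(msq \<longlongrightarrow> msq t) (at_right t)"
proof -
  have "\<exists>y\<in>{t<..T}. msq y < b" if b: "msq t < b" for b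
  proof (rule ccontr)
    assume "\<not> ?thesis"
    then have lower: "b \<le> msq y" if "y \<in> {t<..T}" for y using that by (auto simp: not_less)
    define s where "s n = t + (T - t) / real (Suc n)" for n
    have s_gt: "t < s n" for n using assms by (simp add: s_def)
    have s_le: "s n \<le> T" for n
    proof -
      have "(T - t) / real (Suc n) \<le> (T - t) / 1" using assms by (intro divide_left_mono) auto
      then show ?thesis by (simp add: s_def)
    qed
    have "s \<longlonglongrightarrow> t + 0" unfolding s_def
      by (intro tendsto_add tendsto_const LIMSEQ_Suc[OF lim_const_over_n])
    then have s_lim: "filterlim s (at_right t) sequentially"
      using s_gt[THEN less_imp_neq, THEN not_sym] s_gt by (auto simp: filterlim_at)
    have "AE \<omega> in M. cadlag_on T (\<lambda>t. \<Xi> t \<omega>)"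
      using version by (auto simp: cadlag_cond_exp_version_def)
    then have lim: "AE \<omega> in M. (\<lambda>n. \<Xi> (s n) \<omega>) \<longlonglongrightarrow> \<Xi> t \<omega>"
    proof eventually_elim
      case (elim \<omega>)
      then have "((\<lambda>t. \<Xi> t \<omega>) \<longlongrightarrow> \<Xi> t \<omega>) (at_right t)"
        using assms by (auto simp: cadlag_on_def)
      from filterlim_compose[OF this s_lim] show ?case .
    qed
    have [measurable]: "\<Xi> T \<in> borel_measurable M" "\<Xi> (s n) \<in> borel_measurable M" for n
      using assms s_gt[of n] s_le[of n] by (auto intro!: Xi_measurable)
    \<comment> \<open>Fatou applied to \<open>\<Xi> (s n)\<close> itself would only bound
      \<open>msq t\<close> by the liminf of \<open>msq (s n)\<close>, which monotonicity gives
      anyway. Applied to the remaining increment up to \<open>T\<close> it gives the reverse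
      inequality.\<close>
    have "ennreal (msq T - msq t) = (\<integral>\<^sup>+\<omega>. ennreal ((\<Xi> T \<omega> - \<Xi> t \<omega>)\<^sup>2) \<partial>M)"
      using nn_increment[of t T] assms by simp
    also have "\<dots> = (\<integral>\<^sup>+\<omega>. liminf (\<lambda>n. ennreal ((\<Xi> T \<omega> - \<Xi> (s n) \<omega>)\<^sup>2)) \<partial>M)"
    proof (rule nn_integral_cong_AE)
      show "AE \<omega> in M. ennreal ((\<Xi> T \<omega> - \<Xi> t \<omega>)\<^sup>2)
          = liminf (\<lambda>n. ennreal ((\<Xi> T \<omega> - \<Xi> (s n) \<omega>)\<^sup>2))"
        using lim
      proof eventually_elim
        case (elim \<omega>)
        have "(\<lambda>n. ennreal ((\<Xi> T \<omega> - \<Xi> (s n) \<omega>)\<^sup>2)) \<longlonglongrightarrow> ennreal ((\<Xi> T \<omega> - \<Xi> t \<omega>)\<^sup>2)"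
          by (intro tendsto_intros elim)
        from lim_imp_Liminf[OF _ this] show ?case by simp
      qed
    qed
    also have "\<dots> \<le> liminf (\<lambda>n. \<integral>\<^sup>+\<omega>. ennreal ((\<Xi> T \<omega> - \<Xi> (s n) \<omega>)\<^sup>2) \<partial>M)"
      by (rule nn_integral_liminf) auto
    also have "\<dots> = liminf (\<lambda>n. ennreal (msq T - msq (s n)))"
      using nn_increment[of "s n" T for n] s_gt s_le assms by (simp add: less_imp_le order_trans[OF _ less_imp_le])
    also have "\<dots> \<le> liminf (\<lambda>n. ennreal (msq T - b))"
      by (intro Liminf_mono always_eventually allI ennreal_leI) (use lower s_gt s_le in auto)
    also have "\<dots> = ennreal (msq T - b)" by (simp add: Liminf_const)
    finally have "ennreal (msq T - msq t) \<le> ennreal (msq T - b)" .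
    moreover have "msq T - b \<ge> 0" using lower[of T] assms by auto
    ultimately show False using b by (simp add: ennreal_le_iff)
  qed
  note right = this
  show ?thesis
  proof (rule order_tendstoI)
    fix a assume a: "a < msq t"
    have "eventually (\<lambda>y. y \<in> {t<..<T}) (at_right t)"
      by (rule eventually_at_right_real) (use assms in auto)
    then show "\<forall>\<^sub>F y in at_right t. a < msq y"
      by (rule eventually_mono) (use a msq_mono[OF assms(1)] in \<open>simp add: less_le_trans\<close>)
  next
    fix b assume "msq t < b"
    then obtain y where y: "y \<in> {t<..T}" "msq y < b" using right by blast
    have "eventually (\<lambda>z. z \<in> {t<..<y}) (at_right t)"
      by (rule eventually_at_right_real) (use y in auto)
    then show "\<forall>\<^sub>F z in at_right t. msq z < b"
    proof (rule eventually_mono)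
      fix z assume "z \<in> {t<..<y}"
      then have "msq z \<le> msq y" using msq_mono[of z y] assms y by auto
      then show "msq z < b" using y by simp
    qed
  qed
qed

section \<open>The Stieltjes measure of the second moment\<close>

definition mu :: "real measure" where
  "mu = interval_measure (\<lambda>t. LINT \<omega>|M. (\<Xi> (max 0 (min T t)) \<omega>)\<^sup>2)"

lemma emeasure_mu:
  assumes "0 \<le> s" "s \<le> t" "t \<le> T"
  shows "emeasure mu {s<..t} = ennreal (msq t - msq s)"
proof -
  define f where "f t = msq (max 0 (min T t))" for t
  have cont: "continuous (at_right a) f" for a
  proof -
    consider "a < 0" | "0 \<le> a" "a < T" | "T \<le> a" by linarith
    then show ?thesis
    proof cases
      case 1
      have "eventually (\<lambda>y. y \<in> {a<..<0}) (at_right a)"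
        by (rule eventually_at_right_real) (use 1 in auto)
      then have "eventually (\<lambda>y. f y = msq 0) (at_right a)"
        by (rule eventually_mono) (use T_pos in \<open>auto simp: f_def min_def max_def\<close>)
      then show ?thesis
        using 1 T_pos by (auto simp: continuous_within f_def tendsto_eventually)
    next
      case 2
      have "eventually (\<lambda>y. y \<in> {a<..<T}) (at_right a)"
        by (rule eventually_at_right_real) (use 2 in auto)
      then have "eventually (\<lambda>y. f y = msq y) (at_right a)"
        by (rule eventually_mono) (use 2 in \<open>auto simp: f_def\<close>)
      moreover have "f a = msq a" using 2 by (simp add: f_def)
      ultimately show ?thesis
        using msq_right_continuous[OF 2] by (simp add: continuous_within tendsto_cong)
    next
      case 3
      have "eventually (\<lambda>y. f y = msq T) (at_right a)"
        using 3 T_pos by (auto simp: f_def eventually_at_right_less eventually_at_filter)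
      then show ?thesis
        using 3 T_pos by (auto simp: continuous_within f_def tendsto_eventually)
    qed
  qed
  have mono: "f p \<le> f q" if "p \<le> q" for p q
    unfolding f_def by (rule msq_mono) (use that T_pos in auto)
  have "mu = interval_measure f" unfolding mu_def f_def msq_def ..
  then have "emeasure mu {s<..t} = ennreal (f t - f s)"
    using emeasure_interval_measure_Ioc[OF assms(2), of f] mono cont by auto
  then show ?thesis using assms by (simp add: f_def)
qed

text \<open>On \<open>{s<..t}\<close> the weight is at least 1 / (T - s), so \<open>T - s\<close>
  times the weighted integral dominates the mass. Every later comparison of increments of
  \<open>msq\<close> with the Stieltjes integral passes through this estimate.\<close>

lemma msq_diff_le:
  assumes "0 \<le> s" "s \<le> t" "t \<le> T"
  shows "ennreal (msq t - msq s) \<le> ennreal (T - s) * (\<integral>\<^sup>+r\<in>{s<..t}. 1 / ennreal (T - r) \<partial>mu)"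
proof -
  have [measurable_cong]: "sets mu = sets borel" by (simp add: mu_def)
  have "1 \<le> ennreal (T - s) * (1 / ennreal (T - r))" if "r \<in> {s<..t}" for r
  proof (cases "r < T")
    case True
    then have "1 / ennreal (T - r) = ennreal (1 / (T - r))"
      by (subst divide_ennreal[symmetric]) auto
    also have "ennreal (T - s) * ennreal (1 / (T - r)) = ennreal ((T - s) * (1 / (T - r)))"
      using that assms by (subst ennreal_mult) (auto simp: True less_imp_le)
    also have "\<dots> \<ge> ennreal 1" using that True by (intro ennreal_leI) (simp add: field_simps)
    finally show ?thesis by simp
  next
    \<comment> \<open>At \<open>r = T\<close> the weight is infinite and still beats 1, because
      \<open>r\<close> lies strictly to the right of \<open>s\<close> and so \<open>T - s\<close> is
      positive.\<close>
    case False
    then have "r = T" "s < T" using that assms by auto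
    then show ?thesis by (simp add: ennreal_mult_top)
  qed
  then have "(\<integral>\<^sup>+r. indicator {s<..t} r \<partial>mu)
      \<le> (\<integral>\<^sup>+r. ennreal (T - s) * (1 / ennreal (T - r) * indicator {s<..t} r) \<partial>mu)"
    by (intro nn_integral_mono) (auto simp: indicator_def)
  also have "\<dots> = ennreal (T - s) * (\<integral>\<^sup>+r\<in>{s<..t}. 1 / ennreal (T - r) \<partial>mu)"
    by (rule nn_integral_cmult) auto
  finally show ?thesis using emeasure_mu[OF assms] by simp
qed

lemma stieltjes_tail_eq: "stieltjes_tail M T \<Xi> s = (\<integral>\<^sup>+t\<in>{s<..T}. 1 / ennreal (T - t) \<partial>mu)"
  by (simp add: stieltjes_tail_def mu_def)

end

section \<open>Moving averages\<close>

text \<open>Cauchy-Schwarz against the constant 1 on a window of length \<open>a\<close>; the factor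
  \<open>a\<close> it produces cancels one of the two in the squared average.\<close>

lemma jensen_average:
  fixes \<phi> :: "real \<Rightarrow> real"
  assumes [measurable]: "\<phi> \<in> borel_measurable borel" and "0 < a"
  shows "ennreal (((LINT h:{0..a}|lborel. \<phi> h) / a)\<^sup>2)
    \<le> ennreal (1 / a) * (\<integral>\<^sup>+h\<in>{0..a}. ennreal ((\<phi> h)\<^sup>2) \<partial>lborel)"
proof -
  have "ennreal \<bar>LINT h:{0..a}|lborel. \<phi> h\<bar> \<le> (\<integral>\<^sup>+h\<in>{0..a}. ennreal \<bar>\<phi> h\<bar> \<partial>lborel)"
  proof (cases "set_integrable lborel {0..a} \<phi>")
    case True
    have "ennreal (norm (LINT h|lborel. indicator {0..a} h *\<^sub>R \<phi> h))
        \<le> (\<integral>\<^sup>+h. ennreal (norm (indicator {0..a} h *\<^sub>R \<phi> h)) \<partial>lborel)"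
      by (rule integral_norm_bound_ennreal) (use True in \<open>simp add: set_integrable_def\<close>)
    also have "\<dots> = (\<integral>\<^sup>+h\<in>{0..a}. ennreal \<bar>\<phi> h\<bar> \<partial>lborel)"
      by (intro nn_integral_cong) (auto simp: indicator_def)
    finally show ?thesis by (simp add: set_lebesgue_integral_def)
  next
    \<comment> \<open>The Bochner integral of a non-integrable function has the default value 0, so
      the bound is trivial here.\<close>
    case False
    then show ?thesis
      by (simp add: set_lebesgue_integral_def set_integrable_def not_integrable_integral_eq)
  qed
  then have "(ennreal \<bar>LINT h:{0..a}|lborel. \<phi> h\<bar>)\<^sup>2 \<le> (\<integral>\<^sup>+h\<in>{0..a}. ennreal \<bar>\<phi> h\<bar> \<partial>lborel)\<^sup>2"
    by (rule power_mono) simp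
  also have "\<dots> = (\<integral>\<^sup>+h. (ennreal \<bar>\<phi> h\<bar> * indicator {0..a} h) * indicator {0..a} h \<partial>lborel)\<^sup>2"
    by (intro arg_cong[where f = "\<lambda>x. x\<^sup>2"] nn_integral_cong) (auto simp: indicator_def)
  also have "\<dots> \<le> (\<integral>\<^sup>+h. (ennreal \<bar>\<phi> h\<bar> * indicator {0..a} h)\<^sup>2 \<partial>lborel)
      * (\<integral>\<^sup>+h. (indicator {0..a} h)\<^sup>2 \<partial>lborel)"
    by (rule Cauchy_Schwarz_nn_integral) auto
  also have "(\<integral>\<^sup>+h. (indicator {0..a} h)\<^sup>2 \<partial>lborel) = (\<integral>\<^sup>+h. indicator {0..a} h \<partial>(lborel :: real measure))"
    by (intro nn_integral_cong) (auto simp: indicator_def)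
  also have "\<dots> = ennreal a" using assms by simp
  also have "(\<integral>\<^sup>+h. (ennreal \<bar>\<phi> h\<bar> * indicator {0..a} h)\<^sup>2 \<partial>lborel) = (\<integral>\<^sup>+h\<in>{0..a}. ennreal ((\<phi> h)\<^sup>2) \<partial>lborel)"
    by (intro nn_integral_cong) (auto simp: indicator_def ennreal_power)
  finally have *: "ennreal ((LINT h:{0..a}|lborel. \<phi> h)\<^sup>2)
      \<le> (\<integral>\<^sup>+h\<in>{0..a}. ennreal ((\<phi> h)\<^sup>2) \<partial>lborel) * ennreal a"
    by (simp add: ennreal_power)
  have "ennreal (((LINT h:{0..a}|lborel. \<phi> h) / a)\<^sup>2)
      = ennreal (1 / a\<^sup>2) * ennreal ((LINT h:{0..a}|lborel. \<phi> h)\<^sup>2)"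
    by (subst ennreal_mult[symmetric]) (auto simp: power_divide)
  also have "\<dots> \<le> ennreal (1 / a\<^sup>2) * ((\<integral>\<^sup>+h\<in>{0..a}. ennreal ((\<phi> h)\<^sup>2) \<partial>lborel) * ennreal a)"
    by (intro mult_left_mono *) simp
  also have "\<dots> = (ennreal (1 / a\<^sup>2) * ennreal a) * (\<integral>\<^sup>+h\<in>{0..a}. ennreal ((\<phi> h)\<^sup>2) \<partial>lborel)"
    by (simp add: mult_ac)
  also have "ennreal (1 / a\<^sup>2) * ennreal a = ennreal (1 / a)"
    using assms by (subst ennreal_mult[symmetric]) (auto simp: power2_eq_square)
  finally show ?thesis .
qed

text \<open>The rate that makes the state at time \<open>t\<close> the average of the path over \<open>{t - a..t}\<close>, plus a
  multiple of \<open>d\<close> decaying linearly to zero at time \<open>a\<close>.\<close>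

definition averaging_rate :: "real \<Rightarrow> real \<Rightarrow> (real \<Rightarrow> real) \<Rightarrow> real \<Rightarrow> real" where
  "averaging_rate a d f s = (f s - f (max (s - a) 0) - (if s \<le> a then d else 0)) / a"

text \<open>Extending the path by its value \<open>f 0\<close> on \<open>{-a..<0}\<close> turns the
  truncated lag \<open>max (s - a) 0\<close> into a plain shift of \<open>g\<close>. The integral of
  \<open>g\<close> minus its shift then telescopes to the integral over the last window minus the
  one over \<open>{-a..0}\<close>, and the latter is \<open>a * f 0\<close>. The offset contributes
  \<open>d\<close> times the elapsed fraction of \<open>{0..a}\<close>.\<close>

lemma averaging_rate_integral:
  fixes f :: "real \<Rightarrow> real"
  assumes a: "0 < a" and f: "set_integrable lborel {0..T} f"
    and t: "0 \<le> t" "t \<le> T"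
  shows "(LINT s:{0..t}|lborel. averaging_rate a d f s)
      = (LINT h:{0..a}|lborel. f (max (t - h) 0)) / a - f 0 - d * min 1 (t / a)"
proof -
  define g where "g s = indicator {-a..<0} s * f 0 + indicator {0..T} s * f s" for s
  have g_int: "integrable lborel g"
    unfolding g_def
    by (intro Bochner_Integration.integrable_add integrable_mult_left)
       (use a f in \<open>auto simp: set_integrable_def integrable_indicator_iff\<close>)
  have shift_int: "integrable lborel (\<lambda>s. g (-a + 1 * s))"
    by (rule lborel_integrable_real_affine[OF g_int]) simp
  have g_eq: "g s = f s" if "0 \<le> s" "s \<le> T" for s using that by (simp add: g_def)
  have g_shift: "g (-a + 1 * s) = f (max (s - a) 0)" if "0 \<le> s" "s \<le> T" for s
    using that a by (auto simp: g_def indicator_def max_def)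
  have on: "averaging_rate a d f s = (g s - g (-a + 1 * s) - indicator {0..a} s * d) / a"
    if "0 \<le> s" "s \<le> T" for s
    using that g_eq[OF that] g_shift[OF that] by (simp add: averaging_rate_def indicator_def)
  have pieces: "set_integrable lborel {0..t} g" "set_integrable lborel {0..t} (\<lambda>s. g (-a + 1 * s))" for t
    using integrable_mult_indicator[OF _ g_int] integrable_mult_indicator[OF _ shift_int]
    by (auto simp: set_integrable_def)
  have offset: "set_integrable lborel {0..t} (\<lambda>s. indicator {0..a} s * d)" for t
  proof -
    have "integrable lborel (indicator {0..a} :: real \<Rightarrow> real)"
      using a by (simp add: integrable_indicator_iff)
    then have "integrable lborel (\<lambda>s. indicator {0..a} s * d)" by (rule integrable_mult_left)
    from integrable_mult_indicator[OF _ this, of "{0..t}"] show ?thesis by (simp add: set_integrable_def)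
  qed
  have min_scaled: "min t a = a * min 1 (t / a)" using a by (auto simp: min_def)
  have "(LINT s:{0..t}|lborel. averaging_rate a d f s)
      = (LINT s:{0..t}|lborel. (g s - g (-a + 1 * s) - indicator {0..a} s * d) / a)"
    by (rule set_lebesgue_integral_cong) (use on t in auto)
  also have "\<dots> = ((LINT s:{0..t}|lborel. g s) - (LINT s:{0..t}|lborel. g (-a + 1 * s))
      - (LINT s:{0..t}|lborel. indicator {0..a} s * d)) / a"
    using pieces[of t] offset[of t] by simp
  also have "(LINT s:{0..t}|lborel. indicator {0..a} s * d) = d * min t a"
  proof -
    have "(LINT s:{0..t}|lborel. indicator {0..a} s * d) = (LINT s|lborel. indicator {0..min t a} s * d)"
      unfolding set_lebesgue_integral_def
      by (rule Bochner_Integration.integral_cong) (auto simp: indicator_def)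
    then show ?thesis using t a by simp
  qed
  also have "(LINT s:{0..t}|lborel. g (-a + 1 * s)) = (LINT s|lborel. indicator {-a..t - a} s * g s)"
    unfolding set_lebesgue_integral_def
    by (subst lborel_integral_real_affine[of 1 _ "-a"])
       (auto intro!: Bochner_Integration.integral_cong simp: indicator_def)
  also have "(LINT s:{0..t}|lborel. g s) - (LINT s|lborel. indicator {-a..t - a} s * g s)
      = (LINT s|lborel. indicator {0..t} s * g s - indicator {-a..t - a} s * g s)"
    unfolding set_lebesgue_integral_def
    by (subst Bochner_Integration.integral_diff)
       (use integrable_mult_indicator[OF _ g_int] in auto)
  \<comment> \<open>The two differences of indicators agree off the points 0 and
    \<open>t - a\<close>, whether or not the windows \<open>{0..t}\<close> and
    \<open>{-a..t - a}\<close> overlap, so \<open>t < a\<close> and \<open>a \<le> t\<close> are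
    treated alike.\<close>
  also have "\<dots> = (LINT s|lborel. indicator {t - a..t} s * g s - indicator {-a..0} s * g s)"
  proof (rule integral_cong_AE)
    have "AE s in lborel. s \<noteq> 0" "AE s in lborel. s \<noteq> t - a" by (rule AE_lborel_singleton)+
    then show "AE s in lborel. indicator {0..t} s * g s - indicator {-a..t - a} s * g s
        = indicator {t - a..t} s * g s - indicator {-a..0} s * g s"
      by eventually_elim (use t a in \<open>auto simp: indicator_def\<close>)
  qed (use borel_measurable_integrable[OF g_int] in measurable)
  also have "\<dots> = (LINT s|lborel. indicator {t - a..t} s * g s) - (LINT s|lborel. indicator {-a..0} s * g s)"
    by (rule Bochner_Integration.integral_diff)
       (use integrable_mult_indicator[OF _ g_int] in auto)
  also have "(LINT s|lborel. indicator {t - a..t} s * g s) = (LINT h:{0..a}|lborel. f (max (t - h) 0))"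
    unfolding set_lebesgue_integral_def
    by (subst lborel_integral_real_affine[of "-1" _ t])
       (use t a in \<open>auto intro!: Bochner_Integration.integral_cong simp: indicator_def g_def max_def\<close>)
  also have "(LINT s|lborel. indicator {-a..0} s * g s) = (LINT s|lborel. indicator {-a..0} s * f 0)"
  proof (rule integral_cong_AE)
    have "AE s in lborel. s \<noteq> (0::real)" by (rule AE_lborel_singleton)
    then show "AE s in lborel. indicator {-a..0} s * g s = indicator {-a..0} s * f 0"
      by eventually_elim (use t a in \<open>auto simp: indicator_def g_def\<close>)
  qed (use borel_measurable_integrable[OF g_int] in measurable)
  also have "\<dots> = a * f 0" using a by simp
  finally show "(LINT s:{0..t}|lborel. averaging_rate a d f s)
      = (LINT h:{0..a}|lborel. f (max (t - h) 0)) / a - f 0 - d * min 1 (t / a)"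
    using a by (simp add: min_scaled diff_divide_distrib)
qed

section \<open>Measurability of controls and states, and interchange of integrals\<close>

context usual_filtered_prob_space
begin

text \<open>Progressive measurability lives on a restricted time space, which is awkward to compose
  with. Clamping moves it to the whole line without changing values on \<open>{0..t}\<close> and
  without leaving \<open>F t\<close>.\<close>

lemma progressively_measurable_clamp:
  assumes "progressively_measurable F T u" "t \<in> {0..T}"
  shows "(\<lambda>(s, \<omega>). u (max 0 (min t s)) \<omega>) \<in> borel_measurable (borel \<Otimes>\<^sub>M F t)"
proof -
  have "(\<lambda>(s, \<omega>). u s \<omega>) \<in> borel_measurable (restrict_space borel {0..t} \<Otimes>\<^sub>M F t)"
    using assms by (auto simp: progressively_measurable_def)
  moreover have "(\<lambda>(s, \<omega>). (max 0 (min t s), \<omega>)) \<in> measurable (borel \<Otimes>\<^sub>M F t) (restrict_space borel {0..t} \<Otimes>\<^sub>M F t)"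
    using assms(2) by (auto intro!: measurable_Pair measurable_restrict_space2 simp: split_beta')
  ultimately have "(\<lambda>(s, \<omega>). u s \<omega>) \<circ> (\<lambda>(s, \<omega>). (max 0 (min t s), \<omega>)) \<in> borel_measurable (borel \<Otimes>\<^sub>M F t)"
    by (rule measurable_comp[rotated])
  then show ?thesis by (simp add: comp_def split_beta')
qed

lemma progressively_measurable_clamp_M:
  assumes "progressively_measurable F T u" "0 \<le> T"
  shows "(\<lambda>(s, \<omega>). u (max 0 (min T s)) \<omega>) \<in> borel_measurable (borel \<Otimes>\<^sub>M M)"
proof -
  have T: "T \<in> {0..T}" using assms by auto
  have id: "(\<lambda>\<omega>. \<omega>) \<in> measurable M (F T)"
    by (rule F_measurable_M[OF T]) simp
  have "(\<lambda>(s, \<omega>). (s, \<omega>)) \<in> measurable (borel \<Otimes>\<^sub>M M) (borel \<Otimes>\<^sub>M F T)"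
    using measurable_Pair[OF measurable_fst measurable_compose[OF measurable_snd id]]
    by (simp add: split_beta')
  from measurable_compose[OF this progressively_measurable_clamp[OF assms(1) T]]
  show ?thesis by (simp add: split_beta')
qed

text \<open>The witness may depend on the horizon: where the formula for \<open>u\<close> mentions
  data revealed after \<open>t\<close>, \<open>g t\<close> can drop it, since agreement is asked
  only for times up to \<open>t\<close>. Non-anticipation is thus checked in the choice of
  \<open>g t\<close>.\<close>

lemma progressively_measurableI:
  assumes "\<And>t. t \<in> {0..T} \<Longrightarrow> (\<lambda>(s, \<omega>). g t s \<omega>) \<in> borel_measurable (borel \<Otimes>\<^sub>M F t)"
    and "\<And>t s \<omega>. t \<in> {0..T} \<Longrightarrow> s \<in> {0..t} \<Longrightarrow> u s \<omega> = g t s \<omega>"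
  shows "progressively_measurable F T u"
  unfolding progressively_measurable_def
proof (intro ballI)
  fix t assume t: "t \<in> {0..T}"
  have "(\<lambda>s. s) \<in> measurable (restrict_space borel {0..t}) borel"
    by (rule measurable_restrict_space1) simp
  from measurable_Pair[OF measurable_compose[OF measurable_fst this] measurable_snd]
  have "(\<lambda>(s, \<omega>). (s, \<omega>)) \<in> measurable (restrict_space borel {0..t} \<Otimes>\<^sub>M F t) (borel \<Otimes>\<^sub>M F t)"
    by (simp add: split_beta')
  from measurable_compose[OF this assms(1)[OF t]]
  have "(\<lambda>(s, \<omega>). g t s \<omega>) \<in> borel_measurable (restrict_space borel {0..t} \<Otimes>\<^sub>M F t)"
    by (simp add: split_beta')
  then show "(\<lambda>(s, \<omega>). u s \<omega>) \<in> borel_measurable (restrict_space borel {0..t} \<Otimes>\<^sub>M F t)"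
    by (rule measurable_cong[THEN iffD1, rotated])
       (auto simp: space_pair_measure space_restrict_space assms(2)[OF t])
qed

lemma progressively_measurable_at_0:
  assumes "progressively_measurable F T u" "t \<in> {0..T}"
  shows "u 0 \<in> borel_measurable (F t)"
proof -
  have "(\<lambda>\<omega>. (0, \<omega>)) \<in> measurable (F t) (borel \<Otimes>\<^sub>M F t)" by simp
  from measurable_compose[OF this progressively_measurable_clamp[OF assms]]
  show ?thesis using assms(2) by simp
qed

text \<open>Moves the upper limit into the integrand, so that measurability of the state follows
  from that of the clamped control by integrating out \<open>s\<close>.\<close>

lemma state_clamp:
  assumes "t \<in> {0..r}"
  shows "state x u t \<omega> = x + (LINT s|lborel. (if 0 \<le> s \<and> s \<le> t then u (max 0 (min r s)) \<omega> else 0))"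
  unfolding state_def set_lebesgue_integral_def using assms
  by (intro arg_cong2[where f = "(+)"] refl Bochner_Integration.integral_cong) (auto simp: indicator_def)

lemma state_measurable:
  assumes "progressively_measurable F T u" "t \<in> {0..T}"
  shows "state x u t \<in> borel_measurable (F t)"
proof -
  have [measurable]: "(\<lambda>p. u (max 0 (min t (snd p))) (fst p)) \<in> borel_measurable (F t \<Otimes>\<^sub>M lborel)"
  proof -
    have "(\<lambda>p. (snd p, fst p)) \<in> measurable (F t \<Otimes>\<^sub>M lborel) (borel \<Otimes>\<^sub>M F t)"
      by (auto intro!: measurable_Pair)
    from measurable_compose[OF this progressively_measurable_clamp[OF assms]] show ?thesis by simp
  qed
  have "(\<lambda>\<omega>. x + (LINT s|lborel. (if 0 \<le> s \<and> s \<le> t then u (max 0 (min t s)) \<omega> else 0))) \<in> borel_measurable (F t)"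
    by (intro borel_measurable_add borel_measurable_const lborel.borel_measurable_lebesgue_integral)
       (auto simp: split_beta')
  then show ?thesis
    using state_clamp[of t t x u] assms(2) by (auto cong: measurable_cong)
qed

lemma state_measurable_pair:
  assumes "progressively_measurable F T u" "0 \<le> T"
  shows "(\<lambda>(t, \<omega>). state x u (max 0 (min T t)) \<omega>) \<in> borel_measurable (borel \<Otimes>\<^sub>M M)"
proof -
  have [measurable]: "(\<lambda>p. u (max 0 (min T (snd p))) (snd (fst p))) \<in> borel_measurable ((borel \<Otimes>\<^sub>M M) \<Otimes>\<^sub>M lborel)"
  proof -
    have "(\<lambda>p. (snd p, snd (fst p))) \<in> measurable ((borel \<Otimes>\<^sub>M M) \<Otimes>\<^sub>M lborel) (borel \<Otimes>\<^sub>M M)"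
      by (auto intro!: measurable_Pair)
    from measurable_compose[OF this progressively_measurable_clamp_M[OF assms]] show ?thesis by simp
  qed
  have [measurable]: "(\<lambda>p. fst (fst p)) \<in> borel_measurable ((borel \<Otimes>\<^sub>M M) \<Otimes>\<^sub>M (lborel :: real measure))"
    by measurable
  have "(\<lambda>p. x + (LINT s|lborel. (if 0 \<le> s \<and> s \<le> max 0 (min T (fst p)) then u (max 0 (min T s)) (snd p) else 0)))
      \<in> borel_measurable (borel \<Otimes>\<^sub>M M)"
    by (intro borel_measurable_add borel_measurable_const lborel.borel_measurable_lebesgue_integral)
       (auto simp: split_beta')
  moreover have "(\<lambda>(t, \<omega>). state x u (max 0 (min T t)) \<omega>)
      = (\<lambda>p. x + (LINT s|lborel. (if 0 \<le> s \<and> s \<le> max 0 (min T (fst p)) then u (max 0 (min T s)) (snd p) else 0)))"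
    using assms(2) by (auto simp: fun_eq_iff state_clamp[of _ T] cong: if_cong)
  ultimately show ?thesis by simp
qed

lemma swap_integrals:
  fixes f :: "real \<Rightarrow> 'a \<Rightarrow> ennreal"
  assumes "(\<lambda>(t, \<omega>). f t \<omega>) \<in> borel_measurable (borel \<Otimes>\<^sub>M M)" "A \<in> sets borel"
  shows "(\<integral>\<^sup>+\<omega>. (\<integral>\<^sup>+t\<in>A. f t \<omega> \<partial>lborel) \<partial>M) = (\<integral>\<^sup>+t\<in>A. (\<integral>\<^sup>+\<omega>. f t \<omega> \<partial>M) \<partial>lborel)"
proof -
  interpret pair_sigma_finite lborel M ..
  have [measurable]: "(\<lambda>p. f (fst p) (snd p)) \<in> borel_measurable (lborel \<Otimes>\<^sub>M M)"
    using assms(1) by (simp add: split_beta' cong: measurable_cong_sets)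
  have [measurable]: "A \<in> sets lborel" using assms(2) by simp
  have "(\<integral>\<^sup>+\<omega>. (\<integral>\<^sup>+t\<in>A. f t \<omega> \<partial>lborel) \<partial>M) = (\<integral>\<^sup>+t. (\<integral>\<^sup>+\<omega>. f t \<omega> * indicator A t \<partial>M) \<partial>lborel)"
    by (rule Fubini') (simp add: split_beta')
  also have "\<dots> = (\<integral>\<^sup>+t\<in>A. (\<integral>\<^sup>+\<omega>. f t \<omega> \<partial>M) \<partial>lborel)"
  proof (rule nn_integral_cong)
    fix t :: real
    have "(\<lambda>\<omega>. f t \<omega>) \<in> borel_measurable M"
      using measurable_compose[OF measurable_Pair1' assms(1), of t] by simp
    then show "(\<integral>\<^sup>+\<omega>. f t \<omega> * indicator A t \<partial>M) = (\<integral>\<^sup>+\<omega>. f t \<omega> \<partial>M) * indicator A t"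
      by (rule nn_integral_multc)
  qed
  finally show ?thesis .
qed

end

lemma set_integrable_if_square_finite:
  fixes f :: "real \<Rightarrow> real"
  assumes f: "set_borel_measurable lborel {p..q} f"
    and fin: "(\<integral>\<^sup>+t\<in>{p..q}. ennreal ((f t)\<^sup>2) \<partial>lborel) < \<infinity>"
  shows "set_integrable lborel {p..q} f"
  unfolding set_integrable_def
proof (rule integrableI_bounded)
  have "\<bar>y\<bar> \<le> 1 + y\<^sup>2" for y :: real
  proof (cases "\<bar>y\<bar> \<le> 1")
    case False
    then have "\<bar>y\<bar> * 1 \<le> \<bar>y\<bar> * \<bar>y\<bar>" by (intro mult_left_mono) auto
    then show ?thesis by (simp add: power2_eq_square)
  qed (use zero_le_power2[of y] in linarith)
  then have "(\<integral>\<^sup>+t. ennreal (norm (indicator {p..q} t *\<^sub>R f t)) \<partial>lborel)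
      \<le> (\<integral>\<^sup>+t. indicator {p..q} t + ennreal ((indicator {p..q} t *\<^sub>R f t)\<^sup>2) \<partial>lborel)"
    by (intro nn_integral_mono) (auto simp: indicator_def ennreal_plus[symmetric] ennreal_1[symmetric]
        simp del: ennreal_plus ennreal_1 intro!: ennreal_leI)
  also have "\<dots> = emeasure lborel {p..q} + (\<integral>\<^sup>+t. ennreal ((indicator {p..q} t *\<^sub>R f t)\<^sup>2) \<partial>lborel)"
    using f by (subst nn_integral_add) (auto simp: set_borel_measurable_def)
  also have "(\<integral>\<^sup>+t. ennreal ((indicator {p..q} t *\<^sub>R f t)\<^sup>2) \<partial>lborel) = (\<integral>\<^sup>+t\<in>{p..q}. ennreal ((f t)\<^sup>2) \<partial>lborel)"
    by (intro nn_integral_cong) (auto simp: indicator_def)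
  also have "emeasure lborel {p..q} + \<dots> < \<infinity>"
    using fin by (simp add: emeasure_lborel_Icc_eq)
  finally show "(\<integral>\<^sup>+t. ennreal (norm (indicator {p..q} t *\<^sub>R f t)) \<partial>lborel) < \<infinity>" .
qed (use f in \<open>simp add: set_borel_measurable_def\<close>)

text \<open>On \<open>{0..a}\<close> the number 1 - t / a lies between 0 and 1, so its square is at
  most itself, and a triangle of area \<open>a / 2\<close> remains.\<close>

lemma linear_decay_square_integral:
  fixes a b :: real
  assumes "0 < a"
  shows "(\<integral>\<^sup>+t\<in>{0..b}. ennreal ((1 - min 1 (t / a))\<^sup>2) \<partial>lborel) \<le> ennreal (a / 2)"
proof -
  have "(\<integral>\<^sup>+t\<in>{0..b}. ennreal ((1 - min 1 (t / a))\<^sup>2) \<partial>lborel)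
      \<le> (\<integral>\<^sup>+t. ennreal (1 - t / a) * indicator {0..a} t \<partial>lborel)"
  proof (rule nn_integral_mono)
    fix t :: real
    have "(1 - t / a)\<^sup>2 \<le> 1 - t / a" if "0 \<le> t" "t \<le> a"
    proof -
      have "(1 - t / a) * (1 - t / a) \<le> 1 * (1 - t / a)"
        using that assms by (intro mult_right_mono) auto
      then show ?thesis by (simp add: power2_eq_square)
    qed
    then show "ennreal ((1 - min 1 (t / a))\<^sup>2) * indicator {0..b} t
        \<le> ennreal (1 - t / a) * indicator {0..a} t"
      using assms by (auto simp: indicator_def min_def field_simps intro!: ennreal_leI)
  qed
  also have "\<dots> = ennreal ((a - a\<^sup>2 / (2 * a)) - (0 - 0\<^sup>2 / (2 * a)))"
    by (rule nn_integral_FTC_Icc)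
       (use assms in \<open>auto intro!: derivative_eq_intros simp: field_simps\<close>)
  also have "(a - a\<^sup>2 / (2 * a)) - (0 - 0\<^sup>2 / (2 * a)) = a / 2"
    using assms by (simp add: power2_eq_square)
  finally show ?thesis .
qed

section \<open>Energies as time integrals of second moments\<close>

context usual_filtered_prob_space
begin

text \<open>What Fubini needs, without adaptedness, so that it also covers a process changed on a
  null set. Clamping makes it a condition on times in \<open>{0..T}\<close> only.\<close>

definition jointly_measurable :: "(real \<Rightarrow> 'a \<Rightarrow> real) \<Rightarrow> bool" where
  "jointly_measurable u \<longleftrightarrow>
     (\<lambda>(t, \<omega>). u (max 0 (min T t)) \<omega>) \<in> borel_measurable (borel \<Otimes>\<^sub>M M)"

lemma jointly_measurable_diff:
  "\<lbrakk>jointly_measurable u; jointly_measurable v\<rbrakk> \<Longrightarrow> jointly_measurable (\<lambda>t \<omega>. u t \<omega> - v t \<omega>)"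
  unfolding jointly_measurable_def split_beta' by (rule borel_measurable_diff)

lemma jointly_measurable_compose:
  assumes "jointly_measurable u" "f \<in> borel_measurable N" "g \<in> measurable N M"
  shows "(\<lambda>z. u (max 0 (min T (f z))) (g z)) \<in> borel_measurable N"
  using measurable_compose[OF measurable_Pair[OF assms(2,3)] assms(1)[unfolded jointly_measurable_def]]
  by simp

lemma energy_swap:
  assumes "jointly_measurable u" "0 \<le> p" "q \<le> T"
  shows "energy M p q u = (\<integral>\<^sup>+t\<in>{p..q}. (\<integral>\<^sup>+\<omega>. ennreal ((u t \<omega>)\<^sup>2) \<partial>M) \<partial>lborel)"
proof -
  have "energy M p q u = (\<integral>\<^sup>+\<omega>. (\<integral>\<^sup>+t\<in>{p..q}. ennreal ((u (max 0 (min T t)) \<omega>)\<^sup>2) \<partial>lborel) \<partial>M)"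
    unfolding energy_def using assms(2,3)
    by (intro nn_integral_cong) (auto simp: indicator_def)
  also have "\<dots> = (\<integral>\<^sup>+t\<in>{p..q}. (\<integral>\<^sup>+\<omega>. ennreal ((u (max 0 (min T t)) \<omega>)\<^sup>2) \<partial>M) \<partial>lborel)"
    by (rule swap_integrals) (use assms(1) in \<open>auto simp: jointly_measurable_def split_beta'\<close>)
  also have "\<dots> = (\<integral>\<^sup>+t\<in>{p..q}. (\<integral>\<^sup>+\<omega>. ennreal ((u t \<omega>)\<^sup>2) \<partial>M) \<partial>lborel)"
    using assms(2,3) by (intro nn_integral_cong) (auto simp: indicator_def)
  finally show ?thesis .
qed

lemma path_integral_measurable:
  assumes "jointly_measurable u" "0 \<le> p" "q \<le> T"
  shows "(\<lambda>\<omega>. \<integral>\<^sup>+t\<in>{p..q}. ennreal ((u t \<omega>)\<^sup>2) \<partial>lborel) \<in> borel_measurable M"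
proof -
  have "(\<lambda>\<omega>. \<integral>\<^sup>+t. ennreal ((u (max 0 (min T t)) \<omega>)\<^sup>2) * indicator {p..q} t \<partial>lborel) \<in> borel_measurable M"
    by (rule lborel.borel_measurable_nn_integral)
       (use jointly_measurable_compose[OF assms(1), of snd "M \<Otimes>\<^sub>M lborel" fst] in \<open>simp add: split_beta'\<close>)
  moreover have "(\<integral>\<^sup>+t. ennreal ((u (max 0 (min T t)) \<omega>)\<^sup>2) * indicator {p..q} t \<partial>lborel)
      = (\<integral>\<^sup>+t\<in>{p..q}. ennreal ((u t \<omega>)\<^sup>2) \<partial>lborel)" for \<omega>
    using assms(2,3) by (intro nn_integral_cong) (auto simp: indicator_def)
  ultimately show ?thesis by simp
qed

lemma finite_energy_paths:
  assumes "jointly_measurable u" "energy M 0 T u < \<infinity>"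
  shows "AE \<omega> in M. (\<integral>\<^sup>+t\<in>{0..T}. ennreal ((u t \<omega>)\<^sup>2) \<partial>lborel) < \<infinity> \<and> set_integrable lborel {0..T} (\<lambda>s. u s \<omega>)"
proof -
  have "AE \<omega> in M. (\<integral>\<^sup>+t\<in>{0..T}. ennreal ((u t \<omega>)\<^sup>2) \<partial>lborel) \<noteq> \<infinity>"
    by (rule nn_integral_noteq_infinite)
       (use path_integral_measurable[OF assms(1), of 0 T] assms(2) in \<open>auto simp: energy_def\<close>)
  then show ?thesis
    using AE_space
  proof eventually_elim
    case (elim \<omega>)
    have "(\<lambda>s. indicator {0..T} s *\<^sub>R u (max 0 (min T s)) \<omega>) \<in> borel_measurable lborel"
      using jointly_measurable_compose[OF assms(1), of "\<lambda>s. s" lborel "\<lambda>_. \<omega>"] elim by simp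
    also have "(\<lambda>s. indicator {0..T} s *\<^sub>R u (max 0 (min T s)) \<omega>) = (\<lambda>s. indicator {0..T} s *\<^sub>R u s \<omega>)"
      by (auto simp: indicator_def fun_eq_iff)
    finally have "set_borel_measurable lborel {0..T} (\<lambda>s. u s \<omega>)"
      by (simp add: set_borel_measurable_def)
    then show ?case using set_integrable_if_square_finite elim by (auto simp: top.not_eq_extremum)
  qed
qed

lemma progressive_jointly: "\<lbrakk>progressively_measurable F T u; 0 \<le> T\<rbrakk> \<Longrightarrow> jointly_measurable u"
  using progressively_measurable_clamp_M by (simp add: jointly_measurable_def)

lemma state_jointly: "\<lbrakk>progressively_measurable F T u; 0 \<le> T\<rbrakk> \<Longrightarrow> jointly_measurable (state x u)"
  using state_measurable_pair by (simp add: jointly_measurable_def)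

section \<open>The moving-average control: its energy and its tracking error\<close>

definition averaging_control :: "real \<Rightarrow> real \<Rightarrow> (real \<Rightarrow> 'a \<Rightarrow> real) \<Rightarrow> real \<Rightarrow> 'a \<Rightarrow> real" where
  "averaging_control x a \<xi> s \<omega> = averaging_rate a (x - \<xi> 0 \<omega>) (\<lambda>t. \<xi> t \<omega>) s"

lemma averaging_control_progressive:
  assumes \<xi>: "progressively_measurable F T \<xi>" and a: "0 < a"
  shows "progressively_measurable F T (averaging_control x a \<xi>)"
proof (rule progressively_measurableI)
  fix t assume t: "t \<in> {0..T}"
  note clamp = progressively_measurable_clamp[OF \<xi> t]
  have [measurable]: "(\<lambda>p. \<xi> 0 (snd p)) \<in> borel_measurable (borel \<Otimes>\<^sub>M F t)"
    by (rule measurable_compose[OF measurable_snd progressively_measurable_at_0[OF \<xi> t]])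
  have [measurable]: "(\<lambda>p. \<xi> (max 0 (min t (fst p))) (snd p)) \<in> borel_measurable (borel \<Otimes>\<^sub>M F t)"
    using clamp by (simp add: split_beta')
  have "(\<lambda>p. (fst p - a, snd p)) \<in> measurable (borel \<Otimes>\<^sub>M F t) (borel \<Otimes>\<^sub>M F t)" by measurable
  from measurable_compose[OF this clamp]
  have [measurable]: "(\<lambda>p. \<xi> (max 0 (min t (fst p - a))) (snd p)) \<in> borel_measurable (borel \<Otimes>\<^sub>M F t)"
    by simp
  show "(\<lambda>(s, \<omega>). (\<xi> (max 0 (min t s)) \<omega> - \<xi> (max 0 (min t (s - a))) \<omega> - (if s \<le> a then x - \<xi> 0 \<omega> else 0)) / a)
      \<in> borel_measurable (borel \<Otimes>\<^sub>M F t)"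
    unfolding split_beta' by measurable
  fix s \<omega> assume s: "s \<in> {0..t}"
  then have "max 0 (min t (s - a)) = max (s - a) 0" using a by (auto simp: max_def min_def)
  then show "averaging_control x a \<xi> s \<omega>
      = (\<xi> (max 0 (min t s)) \<omega> - \<xi> (max 0 (min t (s - a))) \<omega> - (if s \<le> a then x - \<xi> 0 \<omega> else 0)) / a"
    using s by (simp add: averaging_control_def averaging_rate_def)
qed

lemma averaging_control_state:
  assumes "0 < a" "set_integrable lborel {0..T} (\<lambda>s. \<xi> s \<omega>)" "0 \<le> t" "t \<le> T"
  shows "state x (averaging_control x a \<xi>) t \<omega>
    = (LINT h:{0..a}|lborel. \<xi> (max (t - h) 0) \<omega>) / a + (1 - min 1 (t / a)) * (x - \<xi> 0 \<omega>)"
  unfolding state_def averaging_control_def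
  using averaging_rate_integral[OF assms, of "x - \<xi> 0 \<omega>"]
  by (simp add: algebra_simps)

text \<open>The constant \<open>c\<close> is 2 in general, but 1 suffices if the initial error \<open>x - \<xi> 0\<close> vanishes.\<close>

lemma averaging_control_energy:
  assumes \<xi>: "progressively_measurable F T \<xi>" and T: "0 \<le> T" and a: "0 < a" and c: "0 \<le> c"
    and split: "AE \<omega> in M. \<forall>p w. (p + w * (x - \<xi> 0 \<omega>))\<^sup>2 \<le> c * p\<^sup>2 + c * (w * (x - \<xi> 0 \<omega>))\<^sup>2"
  shows "ennreal (a\<^sup>2) * energy M 0 T (averaging_control x a \<xi>)
    \<le> ennreal c * omega_mod M T \<xi> a + ennreal (c * a) * (\<integral>\<^sup>+\<omega>. ennreal ((x - \<xi> 0 \<omega>)\<^sup>2) \<partial>M)"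
proof -
  note joint = progressive_jointly[OF \<xi> T]
  let ?d = "\<lambda>\<omega>. x - \<xi> 0 \<omega>"
  let ?\<psi> = "\<lambda>t \<omega>. \<xi> t \<omega> - \<xi> (max (t - a) 0) \<omega>"
  have joint_\<psi>: "jointly_measurable ?\<psi>"
  proof -
    have [measurable]: "(\<lambda>p. \<xi> (max 0 (min T (fst p))) (snd p)) \<in> borel_measurable (borel \<Otimes>\<^sub>M M)"
      using jointly_measurable_compose[OF joint, of fst "borel \<Otimes>\<^sub>M M" snd] by simp
    have [measurable]: "(\<lambda>p. \<xi> (max 0 (min T (max 0 (min T (fst p)) - a))) (snd p)) \<in> borel_measurable (borel \<Otimes>\<^sub>M M)"
      by (rule jointly_measurable_compose[OF joint]) measurable
    have "max 0 (min T (max 0 (min T s) - a)) = max (max 0 (min T s) - a) 0" for s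
      using a T by (auto simp: max_def min_def)
    then have eq: "(\<lambda>(s, \<omega>). ?\<psi> (max 0 (min T s)) \<omega>)
       = (\<lambda>p. \<xi> (max 0 (min T (fst p))) (snd p) - \<xi> (max 0 (min T (max 0 (min T (fst p)) - a))) (snd p))"
      by (auto simp: fun_eq_iff)
    show ?thesis unfolding jointly_measurable_def eq by measurable
  qed
  have \<xi>0 [measurable]: "\<xi> 0 \<in> borel_measurable M"
    using progressively_measurable_at_0[OF \<xi>, of T] F_measurable_M[of T] T by auto
  have path: "AE \<omega> in M. ennreal (a\<^sup>2) * (\<integral>\<^sup>+t\<in>{0..T}. ennreal ((averaging_control x a \<xi> t \<omega>)\<^sup>2) \<partial>lborel)
      \<le> ennreal c * (\<integral>\<^sup>+t\<in>{0..T}. ennreal ((?\<psi> t \<omega>)\<^sup>2) \<partial>lborel) + ennreal (c * a) * ennreal ((?d \<omega>)\<^sup>2)"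
    using split AE_space
  proof eventually_elim
    case (elim \<omega>)
    have [measurable]: "(\<lambda>t. ?\<psi> (max 0 (min T t)) \<omega>) \<in> borel_measurable borel"
      using jointly_measurable_compose[OF joint_\<psi>, of "\<lambda>t. t" borel "\<lambda>_. \<omega>"] elim by simp
    have [measurable]: "(\<lambda>t. averaging_control x a \<xi> (max 0 (min T t)) \<omega>) \<in> borel_measurable borel"
      using jointly_measurable_compose[OF progressive_jointly[OF averaging_control_progressive[OF \<xi> a] T],
          of "\<lambda>t. t" borel "\<lambda>_. \<omega>"] elim by simp
    have "ennreal (a\<^sup>2) * (\<integral>\<^sup>+t\<in>{0..T}. ennreal ((averaging_control x a \<xi> t \<omega>)\<^sup>2) \<partial>lborel)
       = ennreal (a\<^sup>2) * (\<integral>\<^sup>+t\<in>{0..T}. ennreal ((averaging_control x a \<xi> (max 0 (min T t)) \<omega>)\<^sup>2) \<partial>lborel)"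
      by (rule arg_cong[where f = "(*) _"], rule nn_integral_cong) (auto simp: indicator_def)
    also have "\<dots> = (\<integral>\<^sup>+t. ennreal (a\<^sup>2) * (ennreal ((averaging_control x a \<xi> (max 0 (min T t)) \<omega>)\<^sup>2) * indicator {0..T} t) \<partial>lborel)"
      by (subst nn_integral_cmult) auto
    also have "\<dots> \<le> (\<integral>\<^sup>+t. ennreal c * (ennreal ((?\<psi> (max 0 (min T t)) \<omega>)\<^sup>2) * indicator {0..T} t)
        + ennreal (c * (?d \<omega>)\<^sup>2) * indicator {0..a} t \<partial>lborel)"
    proof (rule nn_integral_mono)
      fix t :: real
      show "ennreal (a\<^sup>2) * (ennreal ((averaging_control x a \<xi> (max 0 (min T t)) \<omega>)\<^sup>2) * indicator {0..T} t)
        \<le> ennreal c * (ennreal ((?\<psi> (max 0 (min T t)) \<omega>)\<^sup>2) * indicator {0..T} t)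
          + ennreal (c * (?d \<omega>)\<^sup>2) * indicator {0..a} t"
      proof (cases "t \<in> {0..T}")
        case True
        \<comment> \<open>\<open>a\<close> times the control is the lag difference minus the offset,
          so the initial error enters with weight -1 while it is being removed and 0
          afterwards.\<close>
        define w :: real where "w = (if t \<le> a then -1 else 0)"
        have "a\<^sup>2 * (averaging_control x a \<xi> t \<omega>)\<^sup>2 = (?\<psi> t \<omega> + w * ?d \<omega>)\<^sup>2"
          using a by (simp add: averaging_control_def averaging_rate_def power_divide w_def algebra_simps)
        also have "\<dots> \<le> c * (?\<psi> t \<omega>)\<^sup>2 + c * (w * ?d \<omega>)\<^sup>2" using elim by blast
        also have "(w * ?d \<omega>)\<^sup>2 = (?d \<omega>)\<^sup>2 * indicator {0..a} t"
          unfolding power_mult_distrib using True by (simp add: w_def indicator_def)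
        finally have "ennreal (a\<^sup>2 * (averaging_control x a \<xi> t \<omega>)\<^sup>2)
            \<le> ennreal (c * (?\<psi> t \<omega>)\<^sup>2 + c * ((?d \<omega>)\<^sup>2 * indicator {0..a} t))"
          by (rule ennreal_leI)
        also have "\<dots> = ennreal c * ennreal ((?\<psi> t \<omega>)\<^sup>2) + ennreal (c * (?d \<omega>)\<^sup>2) * indicator {0..a} t"
          using c by (auto simp: indicator_def ennreal_mult)
        finally show ?thesis using True by (simp add: ennreal_mult)
      qed simp
    qed
    also have "\<dots> = ennreal c * (\<integral>\<^sup>+t\<in>{0..T}. ennreal ((?\<psi> (max 0 (min T t)) \<omega>)\<^sup>2) \<partial>lborel) + ennreal (c * (?d \<omega>)\<^sup>2) * ennreal a"
      using a by (subst nn_integral_add) (auto simp: nn_integral_cmult)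
    also have "ennreal (c * (?d \<omega>)\<^sup>2) * ennreal a = ennreal (c * a) * ennreal ((?d \<omega>)\<^sup>2)"
      using c a by (simp add: ennreal_mult[symmetric] mult_ac)
    also have "(\<integral>\<^sup>+t\<in>{0..T}. ennreal ((?\<psi> (max 0 (min T t)) \<omega>)\<^sup>2) \<partial>lborel) = (\<integral>\<^sup>+t\<in>{0..T}. ennreal ((?\<psi> t \<omega>)\<^sup>2) \<partial>lborel)"
      by (intro nn_integral_cong) (auto simp: indicator_def)
    finally show ?case .
  qed
  note [measurable] = path_integral_measurable[OF joint_\<psi>, of 0 T, simplified]
    path_integral_measurable[OF progressive_jointly[OF averaging_control_progressive[OF \<xi> a] T], of 0 T, simplified]
  have "ennreal (a\<^sup>2) * energy M 0 T (averaging_control x a \<xi>)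
      = (\<integral>\<^sup>+\<omega>. ennreal (a\<^sup>2) * (\<integral>\<^sup>+t\<in>{0..T}. ennreal ((averaging_control x a \<xi> t \<omega>)\<^sup>2) \<partial>lborel) \<partial>M)"
    unfolding energy_def by (subst nn_integral_cmult) auto
  also have "\<dots> \<le> (\<integral>\<^sup>+\<omega>. ennreal c * (\<integral>\<^sup>+t\<in>{0..T}. ennreal ((?\<psi> t \<omega>)\<^sup>2) \<partial>lborel)
      + ennreal (c * a) * ennreal ((?d \<omega>)\<^sup>2) \<partial>M)"
    by (rule nn_integral_mono_AE[OF path])
  also have "\<dots> = ennreal c * omega_mod M T \<xi> a + ennreal (c * a) * (\<integral>\<^sup>+\<omega>. ennreal ((?d \<omega>)\<^sup>2) \<partial>M)"
    unfolding omega_mod_def energy_def by (subst nn_integral_add) (auto simp: nn_integral_cmult)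
  finally show ?thesis .
qed

text \<open>The tracking error is minus the average over the lags \<open>h\<close> of the
  differences \<open>\<psi> h t\<close>, plus the decaying initial error. Jensen in
  \<open>h\<close>, followed by exchanging the integrals over lag, time and \<open>\<omega>\<close>,
  turns the first part into the average of \<open>omega_mod\<close> over
  \<open>{0..a}\<close>.\<close>

lemma averaging_control_tracking:
  assumes \<xi>: "progressively_measurable F T \<xi>" and fin: "energy M 0 T \<xi> < \<infinity>"
    and T: "0 \<le> T" and a: "0 < a" and c: "0 \<le> c"
    and split: "AE \<omega> in M. \<forall>p w. (p + w * (x - \<xi> 0 \<omega>))\<^sup>2 \<le> c * p\<^sup>2 + c * (w * (x - \<xi> 0 \<omega>))\<^sup>2"
  shows "energy M 0 T (\<lambda>t \<omega>. state x (averaging_control x a \<xi>) t \<omega> - \<xi> t \<omega>)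
    \<le> ennreal (c / a) * (\<integral>\<^sup>+h\<in>{0..a}. omega_mod M T \<xi> h \<partial>lborel)
      + ennreal (c * a / 2) * (\<integral>\<^sup>+\<omega>. ennreal ((x - \<xi> 0 \<omega>)\<^sup>2) \<partial>M)"
proof -
  note joint = progressive_jointly[OF \<xi> T]
  let ?d = "\<lambda>\<omega>. x - \<xi> 0 \<omega>"
  let ?X = "state x (averaging_control x a \<xi>)"
  define \<xi>' where "\<xi>' s = \<xi> (max 0 (min T s))" for s
  \<comment> \<open>Subtracting \<open>h\<close> first and clamping afterwards makes
    \<open>\<psi>\<close> measurable jointly in lag, time and \<open>\<omega>\<close>. For
    \<open>0 \<le> h\<close> and times in \<open>{0..T}\<close> it is the difference inside
    \<open>omega_mod\<close>.\<close>
  define \<psi> where "\<psi> h t \<omega> = \<xi>' t \<omega> - \<xi>' (t - h) \<omega>" for h t \<omega>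
  have \<psi>: "\<psi> h t \<omega> = \<xi> t \<omega> - \<xi> (max (t - h) 0) \<omega>" if "0 \<le> h" "t \<in> {0..T}" for h t \<omega>
  proof -
    have "max 0 (min T (t - h)) = max (t - h) 0" using that by (auto simp: max_def min_def)
    then show ?thesis using that by (simp add: \<psi>_def \<xi>'_def)
  qed
  have \<xi>0 [measurable]: "\<xi> 0 \<in> borel_measurable M"
    using progressively_measurable_at_0[OF \<xi>, of T] F_measurable_M[of T] T by auto
  have path: "AE \<omega> in M. (\<integral>\<^sup>+t\<in>{0..T}. ennreal ((?X t \<omega> - \<xi> t \<omega>)\<^sup>2) \<partial>lborel)
      \<le> ennreal (c / a) * (\<integral>\<^sup>+h\<in>{0..a}. (\<integral>\<^sup>+t\<in>{0..T}. ennreal ((\<psi> h t \<omega>)\<^sup>2) \<partial>lborel) \<partial>lborel)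
        + ennreal (c * a / 2) * ennreal ((?d \<omega>)\<^sup>2)"
    using split finite_energy_paths[OF joint fin] AE_space
  proof eventually_elim
    case (elim \<omega>)
    have \<xi>'_meas [measurable]: "(\<lambda>t. \<xi>' t \<omega>) \<in> borel_measurable borel"
      using jointly_measurable_compose[OF joint, of "\<lambda>t. t" borel "\<lambda>_. \<omega>"] elim by (simp add: \<xi>'_def)
    have [measurable]: "(\<lambda>p. \<psi> (snd p) (fst p) \<omega>) \<in> borel_measurable (lborel \<Otimes>\<^sub>M lborel)"
      unfolding \<psi>_def by measurable
    have [measurable]: "(\<lambda>h. \<psi> h t \<omega>) \<in> borel_measurable borel" for t
      unfolding \<psi>_def by measurable
    have point: "ennreal ((?X t \<omega> - \<xi> t \<omega>)\<^sup>2)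
        \<le> ennreal (c / a) * (\<integral>\<^sup>+h\<in>{0..a}. ennreal ((\<psi> h t \<omega>)\<^sup>2) \<partial>lborel)
          + ennreal (c * (?d \<omega>)\<^sup>2) * ennreal ((1 - min 1 (t / a))\<^sup>2)"
      if t: "t \<in> {0..T}" for t
    proof -
      \<comment> \<open>Lags beyond \<open>t\<close> reach before time 0, so the lagged path is
        compared with the path extended by its initial value and reflected in
        \<open>h\<close>.\<close>
      have int: "set_integrable lborel {0..a} (\<lambda>h. \<xi> (max (t - h) 0) \<omega>)"
      proof -
        define g where "g s = indicator {-a..<0} s * \<xi> 0 \<omega> + indicator {0..T} s * \<xi> s \<omega>" for s
        have g: "integrable lborel g"
          unfolding g_def
          by (intro Bochner_Integration.integrable_add integrable_mult_left)
             (use a elim in \<open>auto simp: set_integrable_def integrable_indicator_iff\<close>)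
        have "integrable lborel (\<lambda>h. g (t + (-1) * h))"
          by (rule lborel_integrable_real_affine[OF g]) simp
        then have "set_integrable lborel {0..a} (\<lambda>h. g (t + (-1) * h))"
          unfolding set_integrable_def by (intro integrable_mult_indicator) auto
        then show ?thesis
          by (rule set_integrable_cong[THEN iffD1, rotated -1])
             (use t in \<open>auto simp: g_def indicator_def max_def\<close>)
      qed
      have "(LINT h:{0..a}|lborel. \<psi> h t \<omega>) = (LINT h:{0..a}|lborel. \<xi> t \<omega> - \<xi> (max (t - h) 0) \<omega>)"
        by (rule set_lebesgue_integral_cong) (use \<psi> t in auto)
      also have "\<dots> = (LINT h:{0..a}|lborel. \<xi> t \<omega>) - (LINT h:{0..a}|lborel. \<xi> (max (t - h) 0) \<omega>)"
        by (rule set_integral_diff(2)) (use int a in \<open>auto simp: set_integrable_def integrable_indicator_iff\<close>)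
      also have "(LINT h:{0..a}|lborel. \<xi> t \<omega>) = a * \<xi> t \<omega>"
        using a by (simp add: set_lebesgue_integral_def)
      finally have avg: "?X t \<omega> - \<xi> t \<omega> = - ((LINT h:{0..a}|lborel. \<psi> h t \<omega>) / a) + (1 - min 1 (t / a)) * ?d \<omega>"
        using averaging_control_state[OF a, of \<xi> \<omega> t x] elim t a by (simp add: field_simps)
      have "(?X t \<omega> - \<xi> t \<omega>)\<^sup>2 \<le> c * ((LINT h:{0..a}|lborel. \<psi> h t \<omega>) / a)\<^sup>2 + c * ((1 - min 1 (t / a)) * ?d \<omega>)\<^sup>2"
        unfolding avg using elim(1) by (metis power2_minus)
      also have "\<dots> = c * ((LINT h:{0..a}|lborel. \<psi> h t \<omega>) / a)\<^sup>2 + (c * (?d \<omega>)\<^sup>2) * (1 - min 1 (t / a))\<^sup>2"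
        by (simp add: power_mult_distrib mult_ac)
      finally have "ennreal ((?X t \<omega> - \<xi> t \<omega>)\<^sup>2)
          \<le> ennreal (c * ((LINT h:{0..a}|lborel. \<psi> h t \<omega>) / a)\<^sup>2 + (c * (?d \<omega>)\<^sup>2) * (1 - min 1 (t / a))\<^sup>2)"
        by (rule ennreal_leI)
      also have "\<dots> = ennreal c * ennreal (((LINT h:{0..a}|lborel. \<psi> h t \<omega>) / a)\<^sup>2)
          + ennreal (c * (?d \<omega>)\<^sup>2) * ennreal ((1 - min 1 (t / a))\<^sup>2)"
        using c by (simp add: ennreal_plus ennreal_mult)
      also have "ennreal c * ennreal (((LINT h:{0..a}|lborel. \<psi> h t \<omega>) / a)\<^sup>2)
          \<le> ennreal c * (ennreal (1 / a) * (\<integral>\<^sup>+h\<in>{0..a}. ennreal ((\<psi> h t \<omega>)\<^sup>2) \<partial>lborel))"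
        by (intro mult_left_mono jensen_average a) auto
      also have "\<dots> = ennreal (c / a) * (\<integral>\<^sup>+h\<in>{0..a}. ennreal ((\<psi> h t \<omega>)\<^sup>2) \<partial>lborel)"
        using c a by (simp add: mult.assoc[symmetric] ennreal_mult[symmetric])
      finally show ?thesis by (simp add: add_right_mono)
    qed
    have [measurable]: "(\<lambda>t. \<integral>\<^sup>+h\<in>{0..a}. ennreal ((\<psi> h t \<omega>)\<^sup>2) \<partial>lborel) \<in> borel_measurable lborel"
      by (rule lborel.borel_measurable_nn_integral) (simp add: split_beta')
    have "(\<integral>\<^sup>+t\<in>{0..T}. ennreal ((?X t \<omega> - \<xi> t \<omega>)\<^sup>2) \<partial>lborel)
      \<le> (\<integral>\<^sup>+t. ennreal (c / a) * ((\<integral>\<^sup>+h\<in>{0..a}. ennreal ((\<psi> h t \<omega>)\<^sup>2) \<partial>lborel) * indicator {0..T} t)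
          + ennreal (c * (?d \<omega>)\<^sup>2) * (ennreal ((1 - min 1 (t / a))\<^sup>2) * indicator {0..T} t) \<partial>lborel)"
      by (intro nn_integral_mono) (use point in \<open>auto simp: indicator_def\<close>)
    also have "\<dots> = ennreal (c / a) * (\<integral>\<^sup>+t\<in>{0..T}. (\<integral>\<^sup>+h\<in>{0..a}. ennreal ((\<psi> h t \<omega>)\<^sup>2) \<partial>lborel) \<partial>lborel)
        + ennreal (c * (?d \<omega>)\<^sup>2) * (\<integral>\<^sup>+t\<in>{0..T}. ennreal ((1 - min 1 (t / a))\<^sup>2) \<partial>lborel)"
      by (subst nn_integral_add) (auto simp: nn_integral_cmult)
    also have "(\<integral>\<^sup>+t\<in>{0..T}. (\<integral>\<^sup>+h\<in>{0..a}. ennreal ((\<psi> h t \<omega>)\<^sup>2) \<partial>lborel) \<partial>lborel)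
        = (\<integral>\<^sup>+h\<in>{0..a}. (\<integral>\<^sup>+t\<in>{0..T}. ennreal ((\<psi> h t \<omega>)\<^sup>2) \<partial>lborel) \<partial>lborel)"
    proof -
      have "(\<integral>\<^sup>+t\<in>{0..T}. (\<integral>\<^sup>+h\<in>{0..a}. ennreal ((\<psi> h t \<omega>)\<^sup>2) \<partial>lborel) \<partial>lborel)
          = (\<integral>\<^sup>+t. (\<integral>\<^sup>+h. ennreal ((\<psi> h t \<omega>)\<^sup>2) * indicator {0..a} h * indicator {0..T} t \<partial>lborel) \<partial>lborel)"
        by (intro nn_integral_cong nn_integral_multc[symmetric]) auto
      also have "\<dots> = (\<integral>\<^sup>+h. (\<integral>\<^sup>+t. ennreal ((\<psi> h t \<omega>)\<^sup>2) * indicator {0..a} h * indicator {0..T} t \<partial>lborel) \<partial>lborel)"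
        by (rule lborel_pair.Fubini'[symmetric]) (simp add: split_beta')
      also have "\<dots> = (\<integral>\<^sup>+h\<in>{0..a}. (\<integral>\<^sup>+t\<in>{0..T}. ennreal ((\<psi> h t \<omega>)\<^sup>2) \<partial>lborel) \<partial>lborel)"
        by (intro nn_integral_cong) (auto simp: indicator_def)
      finally show ?thesis .
    qed
    also have "ennreal (c * (?d \<omega>)\<^sup>2) * (\<integral>\<^sup>+t\<in>{0..T}. ennreal ((1 - min 1 (t / a))\<^sup>2) \<partial>lborel)
        \<le> ennreal (c * (?d \<omega>)\<^sup>2) * ennreal (a / 2)"
      by (intro mult_left_mono linear_decay_square_integral a) simp
    also have "\<dots> = ennreal (c * a / 2) * ennreal ((?d \<omega>)\<^sup>2)"
      using c a by (simp add: ennreal_mult[symmetric] mult_ac)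
    finally show ?case by (simp add: add_left_mono)
  qed
  have [measurable]: "(\<lambda>p. \<psi> (fst (fst p)) (snd p) (snd (fst p))) \<in> borel_measurable ((borel \<Otimes>\<^sub>M M) \<Otimes>\<^sub>M lborel)"
    unfolding \<psi>_def \<xi>'_def
    by (intro borel_measurable_diff jointly_measurable_compose[OF joint]) measurable
  have \<Psi>: "(\<lambda>(h, \<omega>). \<integral>\<^sup>+t\<in>{0..T}. ennreal ((\<psi> h t \<omega>)\<^sup>2) \<partial>lborel) \<in> borel_measurable (borel \<Otimes>\<^sub>M M)"
    unfolding split_beta'
    by (rule lborel.borel_measurable_nn_integral) (simp add: split_beta')
  have \<Psi>_fixed [measurable]: "(\<lambda>\<omega>. \<integral>\<^sup>+h\<in>{0..a}. (\<integral>\<^sup>+t\<in>{0..T}. ennreal ((\<psi> h t \<omega>)\<^sup>2) \<partial>lborel) \<partial>lborel) \<in> borel_measurable M"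
  proof (rule lborel.borel_measurable_nn_integral)
    have "(\<lambda>p. (snd p, fst p)) \<in> measurable (M \<Otimes>\<^sub>M lborel) (borel \<Otimes>\<^sub>M M)"
      by (auto intro!: measurable_Pair)
    from measurable_compose[OF this \<Psi>]
    show "(\<lambda>(\<omega>, h). (\<integral>\<^sup>+t\<in>{0..T}. ennreal ((\<psi> h t \<omega>)\<^sup>2) \<partial>lborel) * indicator {0..a} h)
        \<in> borel_measurable (M \<Otimes>\<^sub>M lborel)"
      by (simp add: split_beta')
  qed
  have "energy M 0 T (\<lambda>t \<omega>. ?X t \<omega> - \<xi> t \<omega>)
      \<le> (\<integral>\<^sup>+\<omega>. ennreal (c / a) * (\<integral>\<^sup>+h\<in>{0..a}. (\<integral>\<^sup>+t\<in>{0..T}. ennreal ((\<psi> h t \<omega>)\<^sup>2) \<partial>lborel) \<partial>lborel)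
        + ennreal (c * a / 2) * ennreal ((?d \<omega>)\<^sup>2) \<partial>M)"
    unfolding energy_def by (rule nn_integral_mono_AE[OF path])
  also have "\<dots> = ennreal (c / a) * (\<integral>\<^sup>+\<omega>. (\<integral>\<^sup>+h\<in>{0..a}. (\<integral>\<^sup>+t\<in>{0..T}. ennreal ((\<psi> h t \<omega>)\<^sup>2) \<partial>lborel) \<partial>lborel) \<partial>M)
      + ennreal (c * a / 2) * (\<integral>\<^sup>+\<omega>. ennreal ((?d \<omega>)\<^sup>2) \<partial>M)"
    by (subst nn_integral_add) (auto simp: nn_integral_cmult)
  also have "(\<integral>\<^sup>+\<omega>. (\<integral>\<^sup>+h\<in>{0..a}. (\<integral>\<^sup>+t\<in>{0..T}. ennreal ((\<psi> h t \<omega>)\<^sup>2) \<partial>lborel) \<partial>lborel) \<partial>M)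
      = (\<integral>\<^sup>+h\<in>{0..a}. (\<integral>\<^sup>+\<omega>. (\<integral>\<^sup>+t\<in>{0..T}. ennreal ((\<psi> h t \<omega>)\<^sup>2) \<partial>lborel) \<partial>M) \<partial>lborel)"
    by (rule swap_integrals[OF \<Psi>]) simp
  also have "\<dots> = (\<integral>\<^sup>+h\<in>{0..a}. omega_mod M T \<xi> h \<partial>lborel)"
    unfolding omega_mod_def energy_def
    by (intro nn_integral_cong) (auto simp: indicator_def \<psi> intro!: nn_integral_cong)
  finally show ?thesis .
qed

end

section \<open>A jointly measurable modification of the target martingale\<close>

context square_integrable_target
begin

text \<open>\<open>\<Xi>\<close> is measurable time by time, whereas Fubini needs it jointly in time
  and \<open>\<omega>\<close>. A right-continuous path is the limit of its values on grids strictly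
  to the right, and each of these approximations is a countable case distinction in time. Replacing
  the paths by 0 on one null set makes the limit hold everywhere, and the exceptional set does not
  depend on \<open>t\<close>.\<close>

lemma Xi_modification:
  obtains \<Xi>' where "jointly_measurable \<Xi>'" "AE \<omega> in M. \<forall>t. \<Xi>' t \<omega> = \<Xi> t \<omega>"
proof -
  have "AE \<omega> in M. cadlag_on T (\<lambda>t. \<Xi> t \<omega>)"
    using version by (auto simp: cadlag_cond_exp_version_def)
  then obtain N where N: "{\<omega> \<in> space M. \<not> cadlag_on T (\<lambda>t. \<Xi> t \<omega>)} \<subseteq> N" "N \<in> sets M" "emeasure M N = 0"
    by (rule AE_E)
  define \<Xi>' where "\<Xi>' t \<omega> = (if \<omega> \<in> N then 0 else \<Xi> t \<omega>)" for t \<omega>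
  \<comment> \<open>The \<open>+ 1\<close> puts the grid point strictly to the right of
    \<open>s\<close>, where the right limit applies; the clamp keeps it where \<open>\<Xi>\<close>
    is specified.\<close>
  define q where "q n s = max 0 (min T ((real_of_int \<lfloor>real (Suc n) * s\<rfloor> + 1) / real (Suc n)))" for n :: nat and s :: real
  have meas: "\<Xi>' (max 0 (min T s)) \<in> borel_measurable M" for s
    unfolding \<Xi>'_def using N(2) Xi_measurable[of "max 0 (min T s)"] T_pos
    by (intro measurable_If_set) auto
  have approx: "(\<lambda>p. \<Xi>' (q n (fst p)) (snd p)) \<in> borel_measurable (borel \<Otimes>\<^sub>M M)" for n
  proof -
    define f where "f i p = \<Xi>' (max 0 (min T ((real_of_int i + 1) / real (Suc n)))) (snd p)" for i and p :: "real \<times> 'a"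
    have f: "f i \<in> borel_measurable (borel \<Otimes>\<^sub>M M)" for i
      unfolding f_def by (rule measurable_compose[OF measurable_snd meas])
    have "(\<lambda>p. \<lfloor>real (Suc n) * fst p\<rfloor>) \<in> measurable (borel \<Otimes>\<^sub>M M) (count_space UNIV)"
      by measurable
    from measurable_compose_countable[of f, OF f this]
    have "(\<lambda>p. f \<lfloor>real (Suc n) * fst p\<rfloor> p) \<in> borel_measurable (borel \<Otimes>\<^sub>M M)" .
    then show ?thesis unfolding f_def q_def .
  qed
  have lim: "(\<lambda>n. \<Xi>' (q n (max 0 (min T s))) \<omega>) \<longlonglongrightarrow> \<Xi>' (max 0 (min T s)) \<omega>" if \<omega>: "\<omega> \<in> space M" for s \<omega>
  proof -
    define t where "t = max 0 (min T s)"
    have t: "0 \<le> t" "t \<le> T" using T_pos by (auto simp: t_def)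
    have grid: "t < (real_of_int \<lfloor>real (Suc n) * t\<rfloor> + 1) / real (Suc n)"
      "(real_of_int \<lfloor>real (Suc n) * t\<rfloor> + 1) / real (Suc n) \<le> t + 1 / real (Suc n)" for n
    proof -
      have "real (Suc n) * t < real_of_int \<lfloor>real (Suc n) * t\<rfloor> + 1" by linarith
      then show "t < (real_of_int \<lfloor>real (Suc n) * t\<rfloor> + 1) / real (Suc n)"
        by (simp add: pos_less_divide_eq mult.commute del: of_nat_Suc)
      have "real_of_int \<lfloor>real (Suc n) * t\<rfloor> + 1 \<le> real (Suc n) * t + 1" by simp
      then have "(real_of_int \<lfloor>real (Suc n) * t\<rfloor> + 1) / real (Suc n) \<le> (real (Suc n) * t + 1) / real (Suc n)"
        by (rule divide_right_mono) simp
      also have "\<dots> = t + 1 / real (Suc n)" by (simp add: add_divide_distrib del: of_nat_Suc)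
      finally show "(real_of_int \<lfloor>real (Suc n) * t\<rfloor> + 1) / real (Suc n) \<le> t + 1 / real (Suc n)" .
    qed
    have "(\<lambda>n. \<Xi>' (q n t) \<omega>) \<longlonglongrightarrow> \<Xi>' t \<omega>"
    proof (cases "\<omega> \<in> N \<or> t = T")
      case True
      \<comment> \<open>No right limit is available at \<open>T\<close>, but there the clamped grid
        point is \<open>T\<close> itself.\<close>
      moreover have "q n T = T" if "t = T" for n
        using grid(1)[of n] that T_pos by (simp add: q_def del: of_nat_Suc)
      ultimately show ?thesis by (auto simp: \<Xi>'_def)
    next
      case False
      then have "t < T" using t by simp
      have gt: "t < q n t" for n
        using grid(1)[of n] t \<open>t < T\<close> by (simp add: q_def del: of_nat_Suc)
      have le: "q n t \<le> t + 1 / real (Suc n)" for n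
        using grid(2)[of n] t by (auto simp: q_def simp del: of_nat_Suc)
      have "(\<lambda>n. t + 1 / real (Suc n)) \<longlonglongrightarrow> t + 0"
        by (intro tendsto_add tendsto_const LIMSEQ_Suc[OF lim_const_over_n])
      then have "(\<lambda>n. q n t) \<longlonglongrightarrow> t"
        by (intro tendsto_sandwich[of "\<lambda>_. t" "\<lambda>n. q n t" sequentially "\<lambda>n. t + 1 / real (Suc n)"])
           (use gt le in \<open>auto simp: less_imp_le simp del: of_nat_Suc\<close>)
      then have q_lim: "filterlim (\<lambda>n. q n t) (at_right t) sequentially"
        using gt gt[THEN less_imp_neq, THEN not_sym] by (auto simp: filterlim_at)
      have "cadlag_on T (\<lambda>t. \<Xi> t \<omega>)" using N(1) \<omega> False by auto
      then have "((\<lambda>t. \<Xi> t \<omega>) \<longlongrightarrow> \<Xi> t \<omega>) (at_right t)"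
        using t \<open>t < T\<close> by (auto simp: cadlag_on_def)
      from filterlim_compose[OF this q_lim] show ?thesis using False by (simp add: \<Xi>'_def)
    qed
    then show ?thesis by (simp add: t_def)
  qed
  have "(\<lambda>p. \<Xi>' (max 0 (min T (fst p))) (snd p)) \<in> borel_measurable (borel \<Otimes>\<^sub>M M)"
  proof (rule borel_measurable_LIMSEQ_real)
    show "(\<lambda>n. \<Xi>' (q n (max 0 (min T (fst p)))) (snd p)) \<longlonglongrightarrow> \<Xi>' (max 0 (min T (fst p))) (snd p)"
      if "p \<in> space (borel \<Otimes>\<^sub>M M)" for p
      using that by (intro lim) (auto simp: space_pair_measure)
    show "(\<lambda>p. \<Xi>' (q n (max 0 (min T (fst p)))) (snd p)) \<in> borel_measurable (borel \<Otimes>\<^sub>M M)" for n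
    proof -
      have "(\<lambda>p. (max 0 (min T (fst p)), snd p)) \<in> measurable (borel \<Otimes>\<^sub>M M) (borel \<Otimes>\<^sub>M M)" by measurable
      from measurable_compose[OF this approx] show ?thesis by simp
    qed
  qed
  then have "jointly_measurable \<Xi>'" by (simp add: jointly_measurable_def split_beta')
  moreover have "AE \<omega> in M. \<forall>t. \<Xi>' t \<omega> = \<Xi> t \<omega>"
  proof -
    have "AE \<omega> in M. \<omega> \<notin> N" using N by (intro AE_not_in) (auto simp: null_sets_def)
    then show ?thesis by eventually_elim (simp add: \<Xi>'_def)
  qed
  ultimately show ?thesis by (rule that)
qed

end

section \<open>Steering to the target\<close>

text \<open>On \<open>{r<..T}\<close> time is cut at the points \<open>T - (T - r) / 2 ^ k\<close>; on the \<open>k\<close>-th piece the state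
  moves linearly to the value of \<open>\<Xi>\<close> at the beginning of that piece.\<close>

locale dyadic_steering = square_integrable_target M F T \<eta> \<Xi>
  for M :: "'a measure" and F :: "real \<Rightarrow> 'a measure" and T :: real and \<eta> \<Xi> +
  fixes x r :: real and u0 :: "real \<Rightarrow> 'a \<Rightarrow> real"
  assumes r: "0 \<le> r" "r < T"
    and u0: "progressively_measurable F T u0"
    and u0_energy: "energy M 0 T u0 < \<infinity>"
    and gap_finite: "(\<integral>\<^sup>+\<omega>. ennreal ((\<Xi> r \<omega> - state x u0 r \<omega>)\<^sup>2) \<partial>M) < \<infinity>"
begin

definition tm :: "nat \<Rightarrow> real" where "tm k = T - (T - r) / 2 ^ k"

definition len :: "nat \<Rightarrow> real" where "len k = (T - r) / 2 ^ Suc k"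

text \<open>The state at time \<open>tm k\<close>. The index shift is the delay of one piece: during
  piece \<open>j\<close> the state moves to \<open>\<Xi> (tm j)\<close> and arrives at
  \<open>tm (Suc j)\<close>, when the martingale has already moved on.\<close>

definition start :: "nat \<Rightarrow> 'a \<Rightarrow> real" where
  "start k = (case k of 0 \<Rightarrow> state x u0 r | Suc j \<Rightarrow> \<Xi> (tm j))"

definition rate :: "nat \<Rightarrow> 'a \<Rightarrow> real" where
  "rate k \<omega> = (\<Xi> (tm k) \<omega> - start k \<omega>) / len k"

text \<open>The pieces are disjoint, so at most one term of the series is nonzero, and from
  \<open>T\<close> on all of them vanish. In this form the control inherits measurability from the
  single terms.\<close>

definition steer :: "real \<Rightarrow> 'a \<Rightarrow> real" where
  "steer s \<omega> = (if s \<le> r then u0 s \<omega> else (\<Sum>k. indicator {tm k<..tm (Suc k)} s * rate k \<omega>))"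

definition gap :: "nat \<Rightarrow> ennreal" where
  "gap k = (\<integral>\<^sup>+\<omega>. ennreal ((\<Xi> (tm k) \<omega> - start k \<omega>)\<^sup>2) \<partial>M)"

lemma T_nonneg: "0 \<le> T" using T_pos by simp

lemma tm_0 [simp]: "tm 0 = r" by (simp add: tm_def)

lemma len_pos: "0 < len k" using r by (simp add: len_def)

lemma T_minus_tm: "T - tm k = 2 * len k"
proof -
  have half: "A / 2 ^ k = 2 * (A / 2 ^ Suc k)" for A :: real by simp
  have "T - tm k = (T - r) / 2 ^ k" by (simp add: tm_def)
  also have "\<dots> = 2 * len k" unfolding len_def by (rule half)
  finally show ?thesis .
qed

lemma tm_Suc: "tm (Suc k) = tm k + len k"
proof -
  have "T - tm (Suc k) = len k" by (simp add: tm_def len_def)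
  then show ?thesis using T_minus_tm[of k] by linarith
qed

lemma tm_less_T: "tm k < T"
  using T_minus_tm[of k] len_pos[of k] by simp

lemma tm_mono: "j \<le> k \<Longrightarrow> tm j \<le> tm k"
  by (rule lift_Suc_mono_le[of tm]) (simp_all add: tm_Suc less_imp_le len_pos)

lemma r_le_tm: "r \<le> tm k" using tm_mono[of 0 k] by simp

lemma tm_nonneg: "0 \<le> tm k" using r_le_tm[of k] r by simp

lemma tm_in: "tm k \<in> {0..T}" using tm_nonneg tm_less_T[of k] by simp

lemma tm_lim: "tm \<longlonglongrightarrow> T"
proof -
  have "(\<lambda>k. T - (T - r) * (1 / 2) ^ k) \<longlonglongrightarrow> T - (T - r) * 0"
    by (intro tendsto_intros LIMSEQ_power_zero) simp
  moreover have "tm = (\<lambda>k. T - (T - r) * (1 / 2) ^ k)"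
    by (simp add: fun_eq_iff tm_def power_divide)
  ultimately show ?thesis by simp
qed

lemma piece_disjoint:
  assumes "s \<in> {tm j<..tm (Suc j)}" "s \<in> {tm k<..tm (Suc k)}"
  shows "j = k"
proof (rule ccontr)
  assume "j \<noteq> k"
  then consider "Suc j \<le> k" | "Suc k \<le> j" by linarith
  then show False using tm_mono[of "Suc j" k] tm_mono[of "Suc k" j] assms by cases auto
qed

lemma disjoint_pieces: "disjoint_family (\<lambda>k. {tm k<..tm (Suc k)})"
  unfolding disjoint_family_on_def using piece_disjoint by blast

lemma Union_pieces: "(\<Union>k. {tm k<..tm (Suc k)}) = {r<..<T}"
proof (intro equalityI subsetI)
  fix s assume "s \<in> (\<Union>k. {tm k<..tm (Suc k)})"
  then obtain k where "s \<in> {tm k<..tm (Suc k)}" by blast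
  then show "s \<in> {r<..<T}" using r_le_tm[of k] tm_less_T[of "Suc k"] by auto
next
  fix s assume s: "s \<in> {r<..<T}"
  have "eventually (\<lambda>k. s < tm k) sequentially"
    by (rule order_tendstoD(1)[OF tm_lim]) (use s in auto)
  then obtain n where "s \<le> tm n" by (auto simp: eventually_sequentially intro: less_imp_le)
  define k where "k = (LEAST n. s \<le> tm n)"
  have k: "s \<le> tm k" unfolding k_def by (rule LeastI) fact
  have "k \<noteq> 0" using k s by (intro notI) simp
  then obtain j where j: "k = Suc j" using not0_implies_Suc by blast
  have "\<not> s \<le> tm j" using not_less_Least[of j "\<lambda>n. s \<le> tm n"] j by (simp add: k_def)
  then show "s \<in> (\<Union>k. {tm k<..tm (Suc k)})" using k j by (intro UN_I[of j]) auto
qed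

lemma steer_before: "s \<le> r \<Longrightarrow> steer s \<omega> = u0 s \<omega>"
  by (simp add: steer_def)

lemma steer_on_piece:
  assumes "s \<in> {tm k<..tm (Suc k)}"
  shows "steer s \<omega> = rate k \<omega>"
proof -
  have "(\<lambda>j. indicator {tm j<..tm (Suc j)} s * rate j \<omega>) = (\<lambda>j. if j = k then rate j \<omega> else 0)"
  proof (rule ext)
    fix j
    show "indicator {tm j<..tm (Suc j)} s * rate j \<omega> = (if j = k then rate j \<omega> else 0)"
    proof (cases "s \<in> {tm j<..tm (Suc j)}")
      case True
      then have "j = k" by (rule piece_disjoint[OF _ assms])
      with True show ?thesis by simp
    next
      case False
      then have "j \<noteq> k" using assms by auto
      with False show ?thesis by simp
    qed
  qed
  then show ?thesis
    using assms r_le_tm[of k] sums_unique[OF sums_single[of k "\<lambda>j. rate j \<omega>"]]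
    by (simp add: steer_def)
qed

lemma start_0 [simp]: "start 0 = state x u0 r"
  and start_Suc [simp]: "start (Suc k) = \<Xi> (tm k)"
  by (simp_all add: start_def)

lemma start_adapted: "start k \<in> borel_measurable (F (tm k))"
proof (cases k)
  case 0
  then show ?thesis using state_measurable[OF u0, of r x] r by simp
next
  case (Suc j)
  then show ?thesis
    using F_measurable_mono[OF tm_nonneg _ less_imp_le[OF tm_less_T] Xi_adapted[OF tm_in], of j k]
      tm_mono[of j k] by simp
qed

lemma start_measurable: "start k \<in> borel_measurable M"
  using F_measurable_M[OF tm_in start_adapted] .

lemma start_sq_integrable: "integrable M (\<lambda>\<omega>. (start k \<omega>)\<^sup>2)"
proof (cases k)
  case 0
  have r': "r \<in> {0..T}" using r by simp
  note [measurable] = Xi_measurable[OF r'] start_measurable[of 0, simplified]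
  \<comment> \<open>The state at \<open>r\<close> is square integrable as the difference of
    \<open>\<Xi> r\<close> and the gap, and the gap is controlled by
    \<open>gap_finite\<close>.\<close>
  have "integrable M (\<lambda>\<omega>. (\<Xi> r \<omega> - state x u0 r \<omega>)\<^sup>2)"
    by (rule integrableI_nonneg) (use gap_finite in auto)
  then show ?thesis
    using diff_sq_integrable[of "\<Xi> r" "\<lambda>\<omega>. \<Xi> r \<omega> - state x u0 r \<omega>"] Xi_sq_integrable[OF r'] 0
    by simp
next
  case (Suc j)
  then show ?thesis using Xi_sq_integrable[OF tm_in] by simp
qed

lemma rate_adapted: "rate k \<in> borel_measurable (F (tm k))"
  unfolding rate_def using start_adapted Xi_adapted[OF tm_in] by (intro borel_measurable_divide borel_measurable_diff) auto

lemma steer_progressive: "progressively_measurable F T steer"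
proof (rule progressively_measurableI)
  fix t assume t: "t \<in> {0..T}"
  \<comment> \<open>The rate of a piece that begins after \<open>t\<close> is not known at time
    \<open>t\<close>. Setting it to 0 leaves the control unchanged on \<open>{0..t}\<close>, because
    the indicator of that piece vanishes there.\<close>
  define R where "R k \<omega> = (if tm k \<le> t then rate k \<omega> else 0)" for k \<omega>
  have R: "R k \<in> borel_measurable (F t)" for k
    unfolding R_def using F_measurable_mono[OF tm_nonneg _ _ rate_adapted, of k t] t
    by (cases "tm k \<le> t") auto
  have [measurable]: "(\<lambda>p. R k (snd p)) \<in> borel_measurable (borel \<Otimes>\<^sub>M F t)" for k
    by (rule measurable_compose[OF measurable_snd R])
  have [measurable]: "(\<lambda>p. u0 (max 0 (min t (fst p))) (snd p)) \<in> borel_measurable (borel \<Otimes>\<^sub>M F t)"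
    using progressively_measurable_clamp[OF u0 t] by (simp add: split_beta')
  show "(\<lambda>(s, \<omega>). if s \<le> r then u0 (max 0 (min t s)) \<omega> else (\<Sum>k. indicator {tm k<..tm (Suc k)} s * R k \<omega>))
      \<in> borel_measurable (borel \<Otimes>\<^sub>M F t)"
    unfolding split_beta' by measurable
  fix s \<omega> assume s: "s \<in> {0..t}"
  have "(\<Sum>k. indicator {tm k<..tm (Suc k)} s * rate k \<omega>) = (\<Sum>k. indicator {tm k<..tm (Suc k)} s * R k \<omega>)"
    using s by (intro suminf_cong) (auto simp: R_def indicator_def)
  then show "steer s \<omega> = (if s \<le> r then u0 (max 0 (min t s)) \<omega> else (\<Sum>k. indicator {tm k<..tm (Suc k)} s * R k \<omega>))"
    using s by (simp add: steer_def)
qed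

lemma state_before: "t \<le> r \<Longrightarrow> state x steer t \<omega> = state x u0 t \<omega>"
  unfolding state_def
  by (intro arg_cong2[where f = "(+)"] refl set_lebesgue_integral_cong) (auto simp: steer_before)

text \<open>\<open>rate k\<close> is chosen so that piece \<open>k\<close> ends at
  \<open>\<Xi> (tm k)\<close>, which is \<open>start (Suc k)\<close>, so the formula reproduces
  itself. Integrability is carried through the same induction because cutting the integral at
  \<open>tm k\<close> relies on it.\<close>

lemma state_on_piece:
  assumes int: "set_integrable lborel {0..T} (\<lambda>s. u0 s \<omega>)"
  shows "set_integrable lborel {0..tm k} (\<lambda>s. steer s \<omega>)
    \<and> (\<forall>t\<in>{tm k..tm (Suc k)}. state x steer t \<omega> = start k \<omega> + (t - tm k) * rate k \<omega>)"
proof -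
  have extend: "set_integrable lborel {0..t} (\<lambda>s. steer s \<omega>)"
      "state x steer t \<omega> = state x steer (tm k) \<omega> + (t - tm k) * rate k \<omega>"
    if base: "set_integrable lborel {0..tm k} (\<lambda>s. steer s \<omega>)" and t: "t \<in> {tm k..tm (Suc k)}" for k t
  proof -
    have U: "{0..t} = {0..tm k} \<union> {tm k<..t}" using t tm_nonneg[of k] by auto
    have cong: "steer s \<omega> = rate k \<omega>" if "s \<in> {tm k<..t}" for s
      using that t by (intro steer_on_piece) auto
    have "set_integrable lborel {tm k<..t} (\<lambda>s. rate k \<omega>)"
      using t by (simp add: set_integrable_def integrable_indicator_iff)
    then have piece: "set_integrable lborel {tm k<..t} (\<lambda>s. steer s \<omega>)"
      by (rule set_integrable_cong[THEN iffD1, rotated -1]) (use cong in auto)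
    show "set_integrable lborel {0..t} (\<lambda>s. steer s \<omega>)"
      unfolding U by (rule set_integrable_Un[OF base piece]) auto
    have "(LINT s:{tm k<..t}|lborel. steer s \<omega>) = (LINT s:{tm k<..t}|lborel. rate k \<omega>)"
      by (rule set_lebesgue_integral_cong) (use cong in auto)
    also have "\<dots> = (t - tm k) * rate k \<omega>" using t by (simp add: set_lebesgue_integral_def)
    finally show "state x steer t \<omega> = state x steer (tm k) \<omega> + (t - tm k) * rate k \<omega>"
      unfolding state_def U by (subst set_integral_Un[OF _ base piece]) auto
  qed
  show ?thesis
  proof (induction k)
    case 0
    have "set_integrable lborel {0..r} (\<lambda>s. u0 s \<omega>)"
      by (rule set_integrable_subset[OF int]) (use r in auto)
    then have "set_integrable lborel {0..tm 0} (\<lambda>s. steer s \<omega>)"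
      by (subst set_integrable_cong[OF refl refl steer_before]) auto
    then show ?case using extend(2)[of 0] by (auto simp: state_before)
  next
    case (Suc k)
    have end_in: "tm (Suc k) \<in> {tm k..tm (Suc k)}" using tm_mono[of k "Suc k"] by simp
    then have "state x steer (tm (Suc k)) \<omega> = start (Suc k) \<omega>"
      using Suc len_pos[of k] by (simp add: rate_def tm_Suc)
    then show ?case using extend(1)[of k, OF _ end_in] extend(2)[of "Suc k"] Suc by auto
  qed
qed

lemma u0_paths: "AE \<omega> in M. set_integrable lborel {0..T} (\<lambda>s. u0 s \<omega>)"
  using finite_energy_paths[OF progressive_jointly[OF u0 T_nonneg] u0_energy] by auto

lemma gap_nn: "gap k = ennreal (LINT \<omega>|M. (\<Xi> (tm k) \<omega> - start k \<omega>)\<^sup>2)"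
  unfolding gap_def
  by (intro nn_integral_eq_integral diff_sq_integrable Xi_measurable start_measurable
      Xi_sq_integrable start_sq_integrable tm_in) auto

lemma gap_Suc: "gap (Suc k) = ennreal (msq (tm (Suc k)) - msq (tm k))"
  unfolding gap_def start_Suc
  using nn_increment[OF tm_nonneg tm_mono[of k "Suc k"] less_imp_le[OF tm_less_T]] by simp

lemma rate_energy: "(\<integral>\<^sup>+\<omega>. ennreal ((rate k \<omega>)\<^sup>2) \<partial>M) = ennreal (1 / (len k)\<^sup>2) * gap k"
proof -
  have "ennreal ((rate k \<omega>)\<^sup>2) = ennreal (1 / (len k)\<^sup>2) * ennreal ((\<Xi> (tm k) \<omega> - start k \<omega>)\<^sup>2)" for \<omega>
    by (simp add: rate_def power_divide ennreal_mult[symmetric])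
  then show ?thesis
    unfolding gap_def using Xi_measurable[OF tm_in] start_measurable
    by (simp add: nn_integral_cmult)
qed

text \<open>On the piece the state is a convex combination of \<open>start k\<close> and
  \<open>\<Xi> (tm k)\<close>, both known at \<open>tm k\<close>. By \<open>Xi_pythagoras\<close>
  its error is the martingale increment since \<open>tm k\<close>, at most
  \<open>gap (Suc k)\<close>, plus \<open>\<theta>\<^sup>2 \<le> 1\<close> times
  \<open>gap k\<close>.\<close>

lemma tracking_on_piece:
  assumes t: "t \<in> {tm k..tm (Suc k)}"
  shows "(\<integral>\<^sup>+\<omega>. ennreal ((\<Xi> t \<omega> - state x steer t \<omega>)\<^sup>2) \<partial>M) \<le> gap (Suc k) + gap k"
proof -
  define G where "G \<omega> = start k \<omega> + (t - tm k) * rate k \<omega>" for \<omega>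
  define p where "p = (t - tm k) / len k"
  define \<theta> where "\<theta> = 1 - p"
  have \<theta>: "0 \<le> \<theta>" "\<theta> \<le> 1" using t len_pos[of k] by (auto simp: \<theta>_def p_def tm_Suc)
  have t': "t \<in> {0..T}" using t tm_nonneg[of k] tm_less_T[of "Suc k"] by auto
  have G_eq: "G \<omega> = \<Xi> (tm k) \<omega> - \<theta> * (\<Xi> (tm k) \<omega> - start k \<omega>)" for \<omega>
  proof -
    have "(t - tm k) * rate k \<omega> = p * (\<Xi> (tm k) \<omega> - start k \<omega>)" by (simp add: rate_def p_def)
    then show ?thesis by (simp add: G_def \<theta>_def algebra_simps)
  qed
  have G_adapted: "G \<in> borel_measurable (F (tm k))"
    unfolding G_def using start_adapted rate_adapted by measurable
  have G_meas: "G \<in> borel_measurable M" using F_measurable_M[OF tm_in G_adapted] .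
  have gap_int: "integrable M (\<lambda>\<omega>. (\<Xi> (tm k) \<omega> - start k \<omega>)\<^sup>2)"
    by (intro diff_sq_integrable Xi_measurable start_measurable Xi_sq_integrable start_sq_integrable tm_in)
  have G_int: "integrable M (\<lambda>\<omega>. (G \<omega>)\<^sup>2)"
    unfolding G_eq
    by (intro diff_sq_integrable Xi_measurable Xi_sq_integrable tm_in)
       (use gap_int Xi_measurable[OF tm_in] start_measurable in \<open>auto simp: power_mult_distrib\<close>)
  have "(\<integral>\<^sup>+\<omega>. ennreal ((\<Xi> t \<omega> - state x steer t \<omega>)\<^sup>2) \<partial>M) = (\<integral>\<^sup>+\<omega>. ennreal ((\<Xi> t \<omega> - G \<omega>)\<^sup>2) \<partial>M)"
  proof (rule nn_integral_cong_AE)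
    show "AE \<omega> in M. ennreal ((\<Xi> t \<omega> - state x steer t \<omega>)\<^sup>2) = ennreal ((\<Xi> t \<omega> - G \<omega>)\<^sup>2)"
      using u0_paths by eventually_elim (use state_on_piece t in \<open>auto simp: G_def\<close>)
  qed
  also have "\<dots> = ennreal (LINT \<omega>|M. (\<Xi> t \<omega> - G \<omega>)\<^sup>2)"
    by (intro nn_integral_eq_integral diff_sq_integrable Xi_measurable Xi_sq_integrable t' G_meas G_int) auto
  also have "(LINT \<omega>|M. (\<Xi> t \<omega> - G \<omega>)\<^sup>2) = msq t - msq (tm k) + (LINT \<omega>|M. (\<Xi> (tm k) \<omega> - G \<omega>)\<^sup>2)"
    by (rule Xi_pythagoras[OF tm_nonneg _ _ G_adapted G_int]) (use t t' in auto)
  also have "(LINT \<omega>|M. (\<Xi> (tm k) \<omega> - G \<omega>)\<^sup>2) = \<theta>\<^sup>2 * (LINT \<omega>|M. (\<Xi> (tm k) \<omega> - start k \<omega>)\<^sup>2)"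
    by (simp add: G_eq power_mult_distrib)
  also have "\<dots> \<le> 1 * (LINT \<omega>|M. (\<Xi> (tm k) \<omega> - start k \<omega>)\<^sup>2)"
    using \<theta> by (intro mult_right_mono) (auto simp: power_le_one)
  also have "msq t - msq (tm k) + 1 * (LINT \<omega>|M. (\<Xi> (tm k) \<omega> - start k \<omega>)\<^sup>2)
      \<le> (msq (tm (Suc k)) - msq (tm k)) + (LINT \<omega>|M. (\<Xi> (tm k) \<omega> - start k \<omega>)\<^sup>2)"
    using msq_mono[of t "tm (Suc k)"] t t' tm_less_T[of "Suc k"] by simp
  also have "ennreal \<dots> = gap (Suc k) + gap k"
    unfolding gap_Suc gap_nn[of k] using msq_mono[OF tm_nonneg tm_mono[of k "Suc k"]] tm_less_T[of "Suc k"]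
    by (subst ennreal_plus) auto
  finally show ?thesis by (simp add: ennreal_leI add_left_mono)
qed

text \<open>The state at \<open>tm (Suc k)\<close> is \<open>\<Xi> (tm k)\<close>; its \<open>L\<^sup>2\<close> distance to \<open>\<eta>\<close> vanishes
  because the Stieltjes integral is finite.\<close>

lemma msq_tail_vanishes:
  assumes tail: "stieltjes_tail M T \<Xi> r < \<infinity>"
  shows "(\<lambda>k. ennreal (msq T - msq (tm k))) \<longlonglongrightarrow> 0"
proof -
  define \<Lambda> where "\<Lambda> = enn2real (stieltjes_tail M T \<Xi> r)"
  have \<Lambda>: "stieltjes_tail M T \<Xi> r = ennreal \<Lambda>" using tail by (simp add: \<Lambda>_def)
  have bound: "ennreal (msq T - msq (tm k)) \<le> ennreal ((T - tm k) * \<Lambda>)" for k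
  proof -
    have "ennreal (msq T - msq (tm k)) \<le> ennreal (T - tm k) * (\<integral>\<^sup>+s\<in>{tm k<..T}. 1 / ennreal (T - s) \<partial>mu)"
      by (rule msq_diff_le) (use tm_in[of k] in auto)
    also have "(\<integral>\<^sup>+s\<in>{tm k<..T}. 1 / ennreal (T - s) \<partial>mu) \<le> stieltjes_tail M T \<Xi> r"
      unfolding stieltjes_tail_eq using r_le_tm[of k]
      by (intro nn_integral_mono) (auto simp: indicator_def)
    also have "ennreal (T - tm k) * stieltjes_tail M T \<Xi> r = ennreal ((T - tm k) * \<Lambda>)"
      unfolding \<Lambda> using tm_less_T[of k] by (subst ennreal_mult) (auto simp: \<Lambda>_def)
    finally show ?thesis by (simp add: mult_left_mono)
  qed
  have "(\<lambda>k. (T - tm k) * \<Lambda>) \<longlonglongrightarrow> (T - T) * \<Lambda>"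
    by (intro tendsto_mult tendsto_diff tendsto_const tm_lim)
  then have "(\<lambda>k. ennreal ((T - tm k) * \<Lambda>)) \<longlonglongrightarrow> ennreal ((T - T) * \<Lambda>)"
    by (rule tendsto_ennrealI)
  then have upper: "(\<lambda>k. ennreal ((T - tm k) * \<Lambda>)) \<longlonglongrightarrow> 0" by simp
  show ?thesis
    by (rule tendsto_sandwich[OF _ _ tendsto_const upper]) (use bound in auto)
qed

end

lemma ennreal_square_triangle:
  fixes p q z :: real
  shows "ennreal ((p - q)\<^sup>2) \<le> 2 * ennreal ((p - z)\<^sup>2) + 2 * ennreal ((z - q)\<^sup>2)"
proof -
  have "(p - q)\<^sup>2 \<le> 2 * (p - z)\<^sup>2 + 2 * (z - q)\<^sup>2"
    using zero_le_power2[of "(p - z) - (z - q)"] by (simp add: power2_eq_square algebra_simps)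
  then show ?thesis
    by (simp add: ennreal_plus[symmetric] ennreal_mult[symmetric] ennreal_numeral[symmetric]
        del: ennreal_plus ennreal_numeral)
qed

lemma ennreal_suminf_head: "(\<Sum>k. f k) = f 0 + (\<Sum>k. f (Suc k))" for f :: "nat \<Rightarrow> ennreal"
  using sums_unique[OF sums_Suc[OF summable_sums[of "\<lambda>k. f (Suc k)"]]] by (simp add: add.commute)

context usual_filtered_prob_space
begin

lemma second_moment_measurable:
  assumes "jointly_measurable u"
  shows "(\<lambda>t. \<integral>\<^sup>+\<omega>. ennreal ((u (max 0 (min T t)) \<omega>)\<^sup>2) \<partial>M) \<in> borel_measurable borel"
  by (rule borel_measurable_nn_integral)
     (use assms in \<open>simp add: jointly_measurable_def split_beta'\<close>)

lemma cost_eq_energies: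
  assumes u: "progressively_measurable F T u" and \<xi>: "progressively_measurable F T \<xi>" and T: "0 \<le> T"
  shows "cost M T x \<xi> \<kappa> u = ennreal (1/2) * energy M 0 T (\<lambda>t \<omega>. state x u t \<omega> - \<xi> t \<omega>)
    + ennreal (\<kappa>/2) * energy M 0 T u"
proof -
  note [measurable] =
    path_integral_measurable[OF jointly_measurable_diff[OF state_jointly[OF u T] progressive_jointly[OF \<xi> T]], of 0 T x, simplified]
    path_integral_measurable[OF progressive_jointly[OF u T], of 0 T, simplified]
  show ?thesis
    unfolding cost_def energy_def by (subst nn_integral_add) (auto simp: nn_integral_cmult)
qed

end

section \<open>Energy, tracking error and terminal value of the steering control\<close>

context dyadic_steering
begin

lemma steer_jointly: "jointly_measurable steer"
  by (rule progressive_jointly[OF steer_progressive T_nonneg])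

lemma energy_split:
  assumes u: "jointly_measurable u"
  shows "energy M 0 T u = energy M 0 r u
    + (\<Sum>k. \<integral>\<^sup>+t\<in>{tm k<..tm (Suc k)}. (\<integral>\<^sup>+\<omega>. ennreal ((u t \<omega>)\<^sup>2) \<partial>M) \<partial>lborel)"
proof -
  define g where "g t = (\<integral>\<^sup>+\<omega>. ennreal ((u (max 0 (min T t)) \<omega>)\<^sup>2) \<partial>M)" for t
  have [measurable]: "g \<in> borel_measurable borel"
    unfolding g_def by (rule second_moment_measurable[OF u])
  have g: "(\<integral>\<^sup>+\<omega>. ennreal ((u t \<omega>)\<^sup>2) \<partial>M) = g t" if "t \<in> {0..T}" for t using that by (simp add: g_def)
  have "energy M 0 T u = (\<integral>\<^sup>+t\<in>{0..T}. g t \<partial>lborel)"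
    unfolding energy_swap[OF u order_refl order_refl]
    by (intro nn_integral_cong) (auto simp: indicator_def g)
  also have "\<dots> = (\<integral>\<^sup>+t. g t * indicator {0..r} t + g t * indicator {r<..<T} t \<partial>lborel)"
  proof (rule nn_integral_cong_AE)
    have "AE t in lborel. t \<noteq> T" by (rule AE_lborel_singleton)
    then show "AE t in lborel. g t * indicator {0..T} t = g t * indicator {0..r} t + g t * indicator {r<..<T} t"
      by eventually_elim (use r in \<open>auto simp: indicator_def\<close>)
  qed
  also have "\<dots> = (\<integral>\<^sup>+t\<in>{0..r}. g t \<partial>lborel) + (\<integral>\<^sup>+t\<in>{r<..<T}. g t \<partial>lborel)"
    by (rule nn_integral_add) auto
  also have "(\<integral>\<^sup>+t\<in>{0..r}. g t \<partial>lborel) = energy M 0 r u"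
    unfolding energy_swap[OF u order_refl less_imp_le[OF r(2)]] using r
    by (intro nn_integral_cong) (auto simp: indicator_def g)
  also have "(\<integral>\<^sup>+t\<in>{r<..<T}. g t \<partial>lborel) = (\<Sum>k. \<integral>\<^sup>+t\<in>{tm k<..tm (Suc k)}. g t \<partial>lborel)"
    unfolding Union_pieces[symmetric]
    by (rule nn_integral_disjoint_family) (auto simp: disjoint_pieces)
  also have "\<dots> = (\<Sum>k. \<integral>\<^sup>+t\<in>{tm k<..tm (Suc k)}. (\<integral>\<^sup>+\<omega>. ennreal ((u t \<omega>)\<^sup>2) \<partial>M) \<partial>lborel)"
  proof (intro suminf_cong nn_integral_cong)
    fix k t
    show "g t * indicator {tm k<..tm (Suc k)} t = (\<integral>\<^sup>+\<omega>. ennreal ((u t \<omega>)\<^sup>2) \<partial>M) * indicator {tm k<..tm (Suc k)} t"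
      using tm_nonneg[of k] tm_less_T[of "Suc k"] by (auto simp: indicator_def g)
  qed
  finally show ?thesis .
qed

lemma energy_mono_right: "q \<le> q' \<Longrightarrow> energy M p q u \<le> energy M p q' u"
  unfolding energy_def by (intro nn_integral_mono) (auto simp: indicator_def)

lemma steer_energy: "energy M 0 T steer \<le> energy M 0 T u0 + (\<Sum>k. ennreal (1 / len k) * gap k)"
proof -
  have piece: "(\<integral>\<^sup>+t\<in>{tm k<..tm (Suc k)}. (\<integral>\<^sup>+\<omega>. ennreal ((steer t \<omega>)\<^sup>2) \<partial>M) \<partial>lborel) = ennreal (1 / len k) * gap k" for k
  proof -
    have "(\<integral>\<^sup>+t\<in>{tm k<..tm (Suc k)}. (\<integral>\<^sup>+\<omega>. ennreal ((steer t \<omega>)\<^sup>2) \<partial>M) \<partial>lborel)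
        = (\<integral>\<^sup>+t\<in>{tm k<..tm (Suc k)}. ennreal (1 / (len k)\<^sup>2) * gap k \<partial>lborel)"
      unfolding rate_energy[symmetric]
      by (intro nn_integral_cong) (auto simp: indicator_def steer_on_piece)
    also have "\<dots> = (ennreal (1 / (len k)\<^sup>2) * gap k) * ennreal (len k)"
      using len_pos[of k] by (simp add: nn_integral_cmult tm_Suc)
    also have "\<dots> = (ennreal (1 / (len k)\<^sup>2) * ennreal (len k)) * gap k" by (simp add: mult_ac)
    also have "ennreal (1 / (len k)\<^sup>2) * ennreal (len k) = ennreal (1 / len k)"
      using len_pos[of k] by (subst ennreal_mult[symmetric]) (auto simp: power2_eq_square)
    finally show ?thesis .
  qed
  have "energy M 0 r steer = energy M 0 r u0"
    unfolding energy_def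
    by (intro nn_integral_cong) (auto simp: indicator_def steer_before intro!: nn_integral_cong)
  also have "\<dots> \<le> energy M 0 T u0" by (rule energy_mono_right) (use r in simp)
  finally show ?thesis
    unfolding energy_split[OF steer_jointly] piece by (rule add_right_mono)
qed

text \<open>Up to \<open>r\<close> nothing has changed; afterwards the comparison of the state with
  \<open>\<xi>\<close> passes through \<open>\<Xi>\<close>, at the price of the factors 2.
  \<open>p\<close> is meant to be the left end of the window in \<open>Theta\<close>, which lies at
  or before the switch.\<close>

lemma steer_tracking:
  assumes \<xi>: "progressively_measurable F T \<xi>" and p: "0 \<le> p" "p \<le> r"
  shows "energy M 0 T (\<lambda>t \<omega>. state x steer t \<omega> - \<xi> t \<omega>)
    \<le> energy M 0 T (\<lambda>t \<omega>. state x u0 t \<omega> - \<xi> t \<omega>)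
      + 2 * (\<Sum>k. ennreal (len k) * (gap (Suc k) + gap k)) + 2 * energy M p T (\<lambda>t \<omega>. \<xi> t \<omega> - \<Xi> t \<omega>)"
proof -
  obtain \<Xi>' where \<Xi>': "jointly_measurable \<Xi>'" "AE \<omega> in M. \<forall>t. \<Xi>' t \<omega> = \<Xi> t \<omega>"
    using Xi_modification .
  define h where "h t = (\<integral>\<^sup>+\<omega>. ennreal ((\<xi> (max 0 (min T t)) \<omega> - \<Xi>' (max 0 (min T t)) \<omega>)\<^sup>2) \<partial>M)" for t
  have joint_h: "jointly_measurable (\<lambda>t \<omega>. \<xi> t \<omega> - \<Xi>' t \<omega>)"
    by (rule jointly_measurable_diff[OF progressive_jointly[OF \<xi> T_nonneg] \<Xi>'(1)])
  have h_meas [measurable]: "h \<in> borel_measurable borel"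
    unfolding h_def by (rule second_moment_measurable[OF joint_h])
  have point: "(\<integral>\<^sup>+\<omega>. ennreal ((state x steer t \<omega> - \<xi> t \<omega>)\<^sup>2) \<partial>M) \<le> 2 * (gap (Suc k) + gap k) + 2 * h t"
    if t: "t \<in> {tm k<..tm (Suc k)}" for t k
  proof -
    have t': "t \<in> {0..T}" using t tm_nonneg[of k] tm_less_T[of "Suc k"] by auto
    have [measurable]: "\<Xi> t \<in> borel_measurable M" "state x steer t \<in> borel_measurable M"
      using Xi_measurable[OF t'] F_measurable_M[OF t' state_measurable[OF steer_progressive t']] by auto
    have [measurable]: "\<xi> t \<in> borel_measurable M" "\<Xi>' t \<in> borel_measurable M"
      using jointly_measurable_compose[OF progressive_jointly[OF \<xi> T_nonneg], of "\<lambda>_. t" M "\<lambda>\<omega>. \<omega>"]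
        jointly_measurable_compose[OF \<Xi>'(1), of "\<lambda>_. t" M "\<lambda>\<omega>. \<omega>"] t' by auto
    have "(\<integral>\<^sup>+\<omega>. ennreal ((state x steer t \<omega> - \<xi> t \<omega>)\<^sup>2) \<partial>M)
        \<le> (\<integral>\<^sup>+\<omega>. 2 * ennreal ((\<Xi> t \<omega> - state x steer t \<omega>)\<^sup>2) + 2 * ennreal ((\<xi> t \<omega> - \<Xi>' t \<omega>)\<^sup>2) \<partial>M)"
    proof (rule nn_integral_mono_AE)
      show "AE \<omega> in M. ennreal ((state x steer t \<omega> - \<xi> t \<omega>)\<^sup>2)
          \<le> 2 * ennreal ((\<Xi> t \<omega> - state x steer t \<omega>)\<^sup>2) + 2 * ennreal ((\<xi> t \<omega> - \<Xi>' t \<omega>)\<^sup>2)"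
        using \<Xi>'(2) by eventually_elim
          (use ennreal_square_triangle[of "state x steer t _" "\<xi> t _" "\<Xi> t _"] in \<open>simp add: power2_commute[of "\<Xi> t _"]\<close>)
    qed
    also have "\<dots> = 2 * (\<integral>\<^sup>+\<omega>. ennreal ((\<Xi> t \<omega> - state x steer t \<omega>)\<^sup>2) \<partial>M) + 2 * h t"
      using t' by (subst nn_integral_add) (auto simp: nn_integral_cmult h_def)
    also have "\<dots> \<le> 2 * (gap (Suc k) + gap k) + 2 * h t"
      using t by (intro add_right_mono mult_left_mono tracking_on_piece) auto
    finally show ?thesis .
  qed
  have piece: "(\<integral>\<^sup>+t\<in>{tm k<..tm (Suc k)}. (\<integral>\<^sup>+\<omega>. ennreal ((state x steer t \<omega> - \<xi> t \<omega>)\<^sup>2) \<partial>M) \<partial>lborel)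
      \<le> 2 * (ennreal (len k) * (gap (Suc k) + gap k)) + 2 * (\<integral>\<^sup>+t\<in>{tm k<..tm (Suc k)}. h t \<partial>lborel)" for k
  proof -
    have "(\<integral>\<^sup>+t\<in>{tm k<..tm (Suc k)}. (\<integral>\<^sup>+\<omega>. ennreal ((state x steer t \<omega> - \<xi> t \<omega>)\<^sup>2) \<partial>M) \<partial>lborel)
        \<le> (\<integral>\<^sup>+t. 2 * (gap (Suc k) + gap k) * indicator {tm k<..tm (Suc k)} t
            + 2 * (h t * indicator {tm k<..tm (Suc k)} t) \<partial>lborel)"
      by (intro nn_integral_mono) (use point in \<open>auto simp: indicator_def\<close>)
    also have "\<dots> = 2 * (gap (Suc k) + gap k) * ennreal (len k) + 2 * (\<integral>\<^sup>+t\<in>{tm k<..tm (Suc k)}. h t \<partial>lborel)"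
      using len_pos[of k] by (subst nn_integral_add) (auto simp: nn_integral_cmult tm_Suc)
    also have "2 * (gap (Suc k) + gap k) * ennreal (len k) = 2 * (ennreal (len k) * (gap (Suc k) + gap k))"
      by (simp only: mult_ac)
    finally show ?thesis .
  qed
  have "(\<Sum>k. \<integral>\<^sup>+t\<in>{tm k<..tm (Suc k)}. h t \<partial>lborel) = (\<integral>\<^sup>+t\<in>{r<..<T}. h t \<partial>lborel)"
    unfolding Union_pieces[symmetric]
    by (rule nn_integral_disjoint_family[symmetric]) (auto simp: disjoint_pieces)
  also have "\<dots> \<le> (\<integral>\<^sup>+t\<in>{p..T}. (\<integral>\<^sup>+\<omega>. ennreal ((\<xi> t \<omega> - \<Xi>' t \<omega>)\<^sup>2) \<partial>M) \<partial>lborel)"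
    using p r by (intro nn_integral_mono) (auto simp: indicator_def h_def)
  also have "\<dots> = energy M p T (\<lambda>t \<omega>. \<xi> t \<omega> - \<Xi>' t \<omega>)"
    by (rule energy_swap[OF joint_h p(1) order_refl, symmetric])
  also have "\<dots> = energy M p T (\<lambda>t \<omega>. \<xi> t \<omega> - \<Xi> t \<omega>)"
    unfolding energy_def
    by (rule nn_integral_cong_AE) (use \<Xi>'(2) in \<open>auto elim!: eventually_mono\<close>)
  finally have h_sum: "(\<Sum>k. \<integral>\<^sup>+t\<in>{tm k<..tm (Suc k)}. h t \<partial>lborel) \<le> energy M p T (\<lambda>t \<omega>. \<xi> t \<omega> - \<Xi> t \<omega>)" .
  have joint: "jointly_measurable (\<lambda>t \<omega>. state x steer t \<omega> - \<xi> t \<omega>)"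
    by (rule jointly_measurable_diff[OF state_jointly[OF steer_progressive T_nonneg] progressive_jointly[OF \<xi> T_nonneg]])
  have "energy M 0 r (\<lambda>t \<omega>. state x steer t \<omega> - \<xi> t \<omega>) = energy M 0 r (\<lambda>t \<omega>. state x u0 t \<omega> - \<xi> t \<omega>)"
    unfolding energy_def
    by (intro nn_integral_cong) (auto simp: indicator_def state_before intro!: nn_integral_cong)
  also have "\<dots> \<le> energy M 0 T (\<lambda>t \<omega>. state x u0 t \<omega> - \<xi> t \<omega>)"
    by (rule energy_mono_right) (use r in simp)
  finally have before: "energy M 0 r (\<lambda>t \<omega>. state x steer t \<omega> - \<xi> t \<omega>) \<le> \<dots>" .
  have "(\<Sum>k. \<integral>\<^sup>+t\<in>{tm k<..tm (Suc k)}. (\<integral>\<^sup>+\<omega>. ennreal ((state x steer t \<omega> - \<xi> t \<omega>)\<^sup>2) \<partial>M) \<partial>lborel)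
      \<le> (\<Sum>k. 2 * (ennreal (len k) * (gap (Suc k) + gap k)) + 2 * (\<integral>\<^sup>+t\<in>{tm k<..tm (Suc k)}. h t \<partial>lborel))"
    by (intro suminf_le piece) auto
  also have "\<dots> = 2 * (\<Sum>k. ennreal (len k) * (gap (Suc k) + gap k)) + 2 * (\<Sum>k. \<integral>\<^sup>+t\<in>{tm k<..tm (Suc k)}. h t \<partial>lborel)"
    by (simp add: suminf_add[symmetric] ennreal_suminf_cmult)
  also have "\<dots> \<le> 2 * (\<Sum>k. ennreal (len k) * (gap (Suc k) + gap k)) + 2 * energy M p T (\<lambda>t \<omega>. \<xi> t \<omega> - \<Xi> t \<omega>)"
    by (intro add_left_mono mult_left_mono h_sum) simp
  finally show ?thesis
    unfolding energy_split[OF joint] add.assoc by (intro add_mono before)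
qed

definition mass :: "nat \<Rightarrow> ennreal" where
  "mass k = (\<integral>\<^sup>+s\<in>{tm k<..tm (Suc k)}. 1 / ennreal (T - s) \<partial>mu)"

lemma gap_le_mass: "gap (Suc k) \<le> ennreal (2 * len k) * mass k"
  unfolding gap_Suc mass_def T_minus_tm[symmetric]
  using msq_diff_le[OF tm_nonneg tm_mono[of k "Suc k"] less_imp_le[OF tm_less_T]] by simp

text \<open>The point \<open>T\<close> lies in no piece, so the sum sees only the part of the tail
  on \<open>{r<..<T}\<close>.\<close>

lemma suminf_mass_le: "(\<Sum>k. mass k) \<le> stieltjes_tail M T \<Xi> r"
proof -
  have [measurable_cong]: "sets mu = sets borel" by (simp add: mu_def)
  have "(\<Sum>k. mass k) = (\<integral>\<^sup>+s\<in>(\<Union>k. {tm k<..tm (Suc k)}). 1 / ennreal (T - s) \<partial>mu)"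
    unfolding mass_def by (rule nn_integral_disjoint_family[symmetric]) (auto simp: disjoint_pieces)
  also have "\<dots> \<le> stieltjes_tail M T \<Xi> r"
    unfolding Union_pieces stieltjes_tail_eq by (intro nn_integral_mono) (auto simp: indicator_def)
  finally show ?thesis .
qed

lemma len_Suc: "len (Suc k) = len k / 2" by (simp add: len_def)

lemma len_le: "len k \<le> (T - r) / 2"
  using T_minus_tm[of k] r_le_tm[of k] by simp

text \<open>\<open>gap (Suc k)\<close> arises on piece \<open>k\<close> but is closed on piece
  \<open>Suc k\<close>, which is half as long; the ratio \<open>2 * len k / len (Suc k)\<close> is
  the 4. The first gap stems from the switch at \<open>r\<close> and is kept apart, with
  \<open>1 / len 0 = 2 / (T - r)\<close>.\<close>

lemma gap_energy_sum:
  "(\<Sum>k. ennreal (1 / len k) * gap k) \<le> ennreal (2 / (T - r)) * gap 0 + 4 * stieltjes_tail M T \<Xi> r"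
proof -
  have "ennreal (1 / len (Suc k)) * gap (Suc k) \<le> 4 * mass k" for k
  proof -
    have "ennreal (1 / len (Suc k)) * gap (Suc k) \<le> ennreal (1 / len (Suc k)) * (ennreal (2 * len k) * mass k)"
      by (intro mult_left_mono gap_le_mass) simp
    also have "\<dots> = ennreal (1 / len (Suc k) * (2 * len k)) * mass k"
      using len_pos[of k] len_pos[of "Suc k"] by (subst ennreal_mult) (auto simp: mult_ac)
    also have "1 / len (Suc k) * (2 * len k) = 4" using len_pos[of k] by (simp add: len_Suc)
    finally show ?thesis by simp
  qed
  then have "(\<Sum>k. ennreal (1 / len (Suc k)) * gap (Suc k)) \<le> (\<Sum>k. 4 * mass k)"
    by (intro suminf_le) auto
  also have "\<dots> \<le> 4 * stieltjes_tail M T \<Xi> r"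
    unfolding ennreal_suminf_cmult by (intro mult_left_mono suminf_mass_le) simp
  finally show ?thesis
    using ennreal_suminf_head[of "\<lambda>k. ennreal (1 / len k) * gap k"] by (simp add: len_def add_left_mono)
qed

text \<open>Each gap after the first is felt on two pieces, of lengths \<open>len k\<close> and
  \<open>len k / 2\<close>. With \<open>gap_le_mass\<close> this makes 3 / 2 times 2, that is 3
  times \<open>(len k)\<^sup>2\<close>, and \<open>len k \<le> (T - r) / 2\<close> turns the 3 into
  3 / 4 of \<open>(T - r)\<^sup>2\<close>.\<close>

lemma gap_tracking_sum:
  "(\<Sum>k. ennreal (len k) * (gap (Suc k) + gap k))
    \<le> ennreal ((T - r) / 2) * gap 0 + ennreal (3 / 4 * (T - r)\<^sup>2) * stieltjes_tail M T \<Xi> r"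
proof -
  have sq: "(len k)\<^sup>2 \<le> (T - r)\<^sup>2 / 4" for k
    using power_mono[OF len_le[of k], of 2] len_pos[of k] by (simp add: power_divide)
  have "ennreal (len k) * gap (Suc k) + ennreal (len (Suc k)) * gap (Suc k)
      \<le> ennreal (3 / 4 * (T - r)\<^sup>2) * mass k" for k
  proof -
    have "ennreal (len k) * gap (Suc k) + ennreal (len (Suc k)) * gap (Suc k) = ennreal (3 / 2 * len k) * gap (Suc k)"
      using len_pos[of k] by (simp add: distrib_right[symmetric] ennreal_plus[symmetric] len_Suc del: ennreal_plus)
    also have "\<dots> \<le> ennreal (3 / 2 * len k) * (ennreal (2 * len k) * mass k)"
      by (intro mult_left_mono gap_le_mass) simp
    also have "\<dots> = ennreal (3 * (len k)\<^sup>2) * mass k"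
      using len_pos[of k] by (simp add: mult.assoc[symmetric] ennreal_mult[symmetric] power2_eq_square)
    also have "\<dots> \<le> ennreal (3 / 4 * (T - r)\<^sup>2) * mass k"
      using sq[of k] by (intro mult_right_mono ennreal_leI) auto
    finally show ?thesis .
  qed
  then have "(\<Sum>k. ennreal (len k) * gap (Suc k) + ennreal (len (Suc k)) * gap (Suc k))
      \<le> (\<Sum>k. ennreal (3 / 4 * (T - r)\<^sup>2) * mass k)"
    by (intro suminf_le) auto
  also have "\<dots> \<le> ennreal (3 / 4 * (T - r)\<^sup>2) * stieltjes_tail M T \<Xi> r"
    unfolding ennreal_suminf_cmult by (intro mult_left_mono suminf_mass_le) simp
  finally have tail: "(\<Sum>k. ennreal (len k) * gap (Suc k) + ennreal (len (Suc k)) * gap (Suc k)) \<le> \<dots>" .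
  have "(\<Sum>k. ennreal (len k) * (gap (Suc k) + gap k))
      = (\<Sum>k. ennreal (len k) * gap (Suc k)) + (\<Sum>k. ennreal (len k) * gap k)"
    by (subst suminf_add) (auto simp: distrib_left)
  also have "(\<Sum>k. ennreal (len k) * gap k) = ennreal (len 0) * gap 0 + (\<Sum>k. ennreal (len (Suc k)) * gap (Suc k))"
    by (rule ennreal_suminf_head)
  also have "(\<Sum>k. ennreal (len k) * gap (Suc k)) + (ennreal (len 0) * gap 0 + (\<Sum>k. ennreal (len (Suc k)) * gap (Suc k)))
      = ennreal (len 0) * gap 0 + (\<Sum>k. ennreal (len k) * gap (Suc k) + ennreal (len (Suc k)) * gap (Suc k))"
    by (subst suminf_add[symmetric]) (auto simp: add_ac)
  also have "\<dots> \<le> ennreal (len 0) * gap 0 + ennreal (3 / 4 * (T - r)\<^sup>2) * stieltjes_tail M T \<Xi> r"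
    by (rule add_left_mono[OF tail])
  finally show ?thesis by (simp add: len_def)
qed

lemma gap_0_finite: "gap 0 < \<infinity>"
  using gap_finite by (simp add: gap_def)

lemma steer_energy_finite:
  assumes "stieltjes_tail M T \<Xi> r < \<infinity>"
  shows "energy M 0 T steer < \<infinity>"
proof -
  have "energy M 0 T steer \<le> energy M 0 T u0 + (ennreal (2 / (T - r)) * gap 0 + 4 * stieltjes_tail M T \<Xi> r)"
    using steer_energy gap_energy_sum by (meson add_left_mono order_trans)
  also have "\<dots> < \<infinity>"
    using u0_energy gap_0_finite assms by (auto simp: ennreal_mult_less_top)
  finally show ?thesis .
qed

text \<open>The state at a grid point is \<open>\<Xi>\<close> at the previous one, and it converges
  along almost every path because the integral is continuous in its upper limit. Fatou then bounds
  the mean square distance between \<open>\<Xi> T\<close> and the terminal state by the tail of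
  \<open>msq\<close>, which vanishes. The left limit of \<open>\<Xi>\<close> along the grid is thus
  identified in mean square.\<close>

lemma steer_hits:
  assumes tail: "stieltjes_tail M T \<Xi> r < \<infinity>"
  shows "AE \<omega> in M. state x steer T \<omega> = \<eta> \<omega>"
proof -
  have T: "T \<in> {0..T}" using T_pos by simp
  have paths: "AE \<omega> in M. (\<lambda>k. start k \<omega>) \<longlonglongrightarrow> state x steer T \<omega>"
    using u0_paths finite_energy_paths[OF steer_jointly steer_energy_finite[OF tail]]
  proof eventually_elim
    case (elim \<omega>)
    have "state x steer (tm k) \<omega> = start k \<omega>" for k
      using state_on_piece[OF elim(1), of k] tm_mono[of k "Suc k"] by simp
    moreover have "(\<lambda>k. state x steer (tm k) \<omega>) \<longlonglongrightarrow> state x steer T \<omega>"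
    proof -
      \<comment> \<open>A detour through the Henstock-Kurzweil integral, for the continuity of the
        indefinite integral.\<close>
      have int: "(\<lambda>t. steer t \<omega>) integrable_on {0..T}"
        using elim(2) by (auto intro: set_borel_integral_eq_integral(1))
      have cont: "continuous_on {0..T} (\<lambda>s. integral {0..s} (\<lambda>t. steer t \<omega>))"
        by (rule indefinite_integral_continuous_1[OF int])
      have "(\<lambda>k. integral {0..tm k} (\<lambda>t. steer t \<omega>)) \<longlonglongrightarrow> integral {0..T} (\<lambda>t. steer t \<omega>)"
        by (rule continuous_on_tendsto_compose[OF cont tm_lim]) (use T tm_in in auto)
      moreover have "(LINT s:{0..t}|lborel. steer s \<omega>) = integral {0..t} (\<lambda>s. steer s \<omega>)" if "t \<in> {0..T}" for t
        by (rule set_borel_integral_eq_integral(2), rule set_integrable_subset[of _ "{0..T}"])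
           (use elim(2) that in auto)
      ultimately show ?thesis
        unfolding state_def using T tm_in by (intro tendsto_add tendsto_const) simp
    qed
    ultimately show ?case by simp
  qed
  have [measurable]: "\<Xi> T \<in> borel_measurable M" "\<Xi> (tm k) \<in> borel_measurable M" for k
    using Xi_measurable T tm_in by auto
  have [measurable]: "state x steer T \<in> borel_measurable M"
    by (rule F_measurable_M[OF T state_measurable[OF steer_progressive T]])
  have "(\<integral>\<^sup>+\<omega>. ennreal ((\<Xi> T \<omega> - state x steer T \<omega>)\<^sup>2) \<partial>M)
      = (\<integral>\<^sup>+\<omega>. liminf (\<lambda>k. ennreal ((\<Xi> T \<omega> - \<Xi> (tm k) \<omega>)\<^sup>2)) \<partial>M)"
  proof (rule nn_integral_cong_AE)
    show "AE \<omega> in M. ennreal ((\<Xi> T \<omega> - state x steer T \<omega>)\<^sup>2) = liminf (\<lambda>k. ennreal ((\<Xi> T \<omega> - \<Xi> (tm k) \<omega>)\<^sup>2))"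
      using paths
    proof eventually_elim
      case (elim \<omega>)
      from LIMSEQ_Suc[OF elim] have "(\<lambda>k. \<Xi> (tm k) \<omega>) \<longlonglongrightarrow> state x steer T \<omega>" by simp
      then have "(\<lambda>k. ennreal ((\<Xi> T \<omega> - \<Xi> (tm k) \<omega>)\<^sup>2)) \<longlonglongrightarrow> ennreal ((\<Xi> T \<omega> - state x steer T \<omega>)\<^sup>2)"
        by (intro tendsto_ennrealI tendsto_power tendsto_diff tendsto_const)
      from lim_imp_Liminf[OF _ this] show ?case by simp
    qed
  qed
  also have "\<dots> \<le> liminf (\<lambda>k. \<integral>\<^sup>+\<omega>. ennreal ((\<Xi> T \<omega> - \<Xi> (tm k) \<omega>)\<^sup>2) \<partial>M)"
    by (rule nn_integral_liminf) auto
  also have "\<dots> = liminf (\<lambda>k. ennreal (msq T - msq (tm k)))"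
    using nn_increment[OF tm_nonneg less_imp_le[OF tm_less_T] order_refl] by simp
  also have "\<dots> = 0" using lim_imp_Liminf[OF _ msq_tail_vanishes[OF tail]] by simp
  finally have "AE \<omega> in M. ennreal ((\<Xi> T \<omega> - state x steer T \<omega>)\<^sup>2) = 0"
    by (subst nn_integral_0_iff_AE[symmetric]) auto
  with Xi_terminal show ?thesis by eventually_elim auto
qed

text \<open>Tracking charges the switching gap at the rate \<open>(T - r) / 2\<close>, energy at the
  rate \<open>\<kappa> / (T - r)\<close>; they balance when \<open>T - r\<close> is of order
  \<open>sqrt \<kappa>\<close>. The 1/2 in the cost cancels the factors 2 of
  \<open>steer_tracking\<close>.\<close>

lemma constrained_value_le:
  assumes \<xi>: "progressively_measurable F T \<xi>" and p: "0 \<le> p" "p \<le> r" and \<kappa>: "0 \<le> \<kappa>"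
    and tail: "stieltjes_tail M T \<Xi> r < \<infinity>"
  shows "constrained_value M F T x \<xi> \<eta> \<kappa>
    \<le> ennreal (1/2) * energy M 0 T (\<lambda>t \<omega>. state x u0 t \<omega> - \<xi> t \<omega>) + ennreal (\<kappa>/2) * energy M 0 T u0
      + energy M p T (\<lambda>t \<omega>. \<xi> t \<omega> - \<Xi> t \<omega>)
      + (ennreal ((T - r) / 2 + \<kappa> / (T - r)) * gap 0
        + ennreal (3 / 4 * (T - r)\<^sup>2 + 2 * \<kappa>) * stieltjes_tail M T \<Xi> r)"
proof -
  let ?E = "energy M 0 T (\<lambda>t \<omega>. state x u0 t \<omega> - \<xi> t \<omega>)" and ?U = "energy M 0 T u0"
  let ?\<Theta> = "energy M p T (\<lambda>t \<omega>. \<xi> t \<omega> - \<Xi> t \<omega>)" and ?\<Lambda> = "stieltjes_tail M T \<Xi> r"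
  have "steer \<in> constrained_controls M F T x \<eta>"
    unfolding constrained_controls_def controls_def
    using steer_progressive steer_energy_finite[OF tail] steer_hits[OF tail] by simp
  then have "constrained_value M F T x \<xi> \<eta> \<kappa> \<le> cost M T x \<xi> \<kappa> steer"
    unfolding constrained_value_def by (rule INF_lower)
  also have "\<dots> = ennreal (1/2) * energy M 0 T (\<lambda>t \<omega>. state x steer t \<omega> - \<xi> t \<omega>) + ennreal (\<kappa>/2) * energy M 0 T steer"
    by (rule cost_eq_energies[OF steer_progressive \<xi> T_nonneg])
  also have "\<dots> \<le> ennreal (1/2) * (?E + 2 * (ennreal ((T - r) / 2) * gap 0 + ennreal (3 / 4 * (T - r)\<^sup>2) * ?\<Lambda>) + 2 * ?\<Theta>)
      + ennreal (\<kappa>/2) * (?U + (ennreal (2 / (T - r)) * gap 0 + 4 * ?\<Lambda>))"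
  proof (intro add_mono mult_left_mono)
    show "energy M 0 T (\<lambda>t \<omega>. state x steer t \<omega> - \<xi> t \<omega>)
        \<le> ?E + 2 * (ennreal ((T - r) / 2) * gap 0 + ennreal (3 / 4 * (T - r)\<^sup>2) * ?\<Lambda>) + 2 * ?\<Theta>"
      by (rule order_trans[OF steer_tracking[OF \<xi> p]])
         (intro add_right_mono add_left_mono mult_left_mono gap_tracking_sum, simp)
    show "energy M 0 T steer \<le> ?U + (ennreal (2 / (T - r)) * gap 0 + 4 * ?\<Lambda>)"
      by (rule order_trans[OF steer_energy add_left_mono[OF gap_energy_sum]])
  qed auto
  also have "\<dots> = ennreal (1/2) * ?E + ennreal (\<kappa>/2) * ?U + ?\<Theta>
      + ((ennreal ((T - r) / 2) + ennreal (\<kappa>/2) * ennreal (2 / (T - r))) * gap 0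
        + (ennreal (3 / 4 * (T - r)\<^sup>2) + ennreal (\<kappa>/2) * 4) * ?\<Lambda>)"
  proof -
    have "ennreal (1/2) * 2 = ennreal (1/2 * 2)"
      unfolding ennreal_numeral[symmetric] by (rule ennreal_mult[symmetric]) simp_all
    also have "\<dots> = 1" by simp
    finally have half: "ennreal (1/2) * (2 * z) = z" for z
      by (simp only: mult.assoc[symmetric] mult_1)
    show ?thesis by (simp only: distrib_left half) (simp only: distrib_left distrib_right add_ac mult_ac)
  qed
  also have "ennreal ((T - r) / 2) + ennreal (\<kappa>/2) * ennreal (2 / (T - r)) = ennreal ((T - r) / 2 + \<kappa> / (T - r))"
    using \<kappa> r by (simp add: ennreal_mult[symmetric] ennreal_plus)
  also have "ennreal (3 / 4 * (T - r)\<^sup>2) + ennreal (\<kappa>/2) * 4 = ennreal (3 / 4 * (T - r)\<^sup>2 + 2 * \<kappa>)"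
    using \<kappa> by (simp add: ennreal_mult[symmetric] ennreal_plus ennreal_numeral[symmetric] del: ennreal_numeral)
  finally show ?thesis .
qed

end

section \<open>The bound on the value\<close>

lemma Gamma_ge_1:
  fixes y :: real
  assumes "2 \<le> y"
  shows "1 \<le> Gamma y"
  using Gamma_real_strict_mono[of 2 y] Gamma_numeral[of "num.Bit0 num.One", where 'a = real] assms
  by (cases "y = 2") auto

text \<open>The left-hand side is what the flat window yields: 1 from the energy and 9 / (\<alpha> +
  1) from the tracking error averaged over the lags. Since \<open>Gamma (\<alpha> + 2)\<close> is at
  least 1, nine of the twelve copies of \<open>Gamma (\<alpha> + 1)\<close> absorb the second term.
  The other three cover the 1, because each is at least 1 / 3.\<close>

lemma averaging_constant_le_Gamma:
  fixes \<alpha> :: real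
  assumes "0 < \<alpha>"
  shows "1 + 9 / (\<alpha> + 1) \<le> 12 * Gamma (\<alpha> + 1)"
proof -
  have "Gamma (\<alpha> + 1 + 1) = (\<alpha> + 1) * Gamma (\<alpha> + 1)"
    by (rule Gamma_plus1) (use assms in \<open>auto simp: nonpos_Ints_def\<close>)
  then have lower: "1 / (\<alpha> + 1) \<le> Gamma (\<alpha> + 1)"
    using Gamma_ge_1[of "\<alpha> + 1 + 1"] assms by (simp add: pos_divide_le_eq mult.commute)
  have "1 / 3 \<le> Gamma (\<alpha> + 1)"
  proof (cases "\<alpha> \<le> 1")
    case True
    then have "1 / 3 \<le> 1 / (\<alpha> + 1)" using assms by (intro divide_left_mono) auto
    then show ?thesis using lower by linarith
  next
    case False
    then show ?thesis using Gamma_ge_1[of "\<alpha> + 1"] by simp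
  qed
  moreover have "9 / (\<alpha> + 1) = 9 * (1 / (\<alpha> + 1))" by simp
  ultimately show ?thesis using lower by linarith
qed

lemma nn_integral_powr_Icc:
  fixes a \<alpha> :: real
  assumes "0 < a" "0 < \<alpha>"
  shows "(\<integral>\<^sup>+h\<in>{0..a}. ennreal (h powr \<alpha>) \<partial>lborel) = ennreal (a powr (\<alpha> + 1) / (\<alpha> + 1))"
proof -
  have "((\<lambda>h. h powr \<alpha>) has_integral a powr (\<alpha> + 1) / (\<alpha> + 1)) {0..a}"
    by (rule has_integral_powr_from_0) (use assms in auto)
  then have "((\<lambda>h. if h \<in> {0..a} then h powr \<alpha> else 0) has_integral a powr (\<alpha> + 1) / (\<alpha> + 1)) UNIV"
    by (simp only: has_integral_restrict_UNIV)
  from nn_integral_has_integral_lborel[OF _ _ this]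
  have "(\<integral>\<^sup>+h. ennreal (if h \<in> {0..a} then h powr \<alpha> else 0) \<partial>lborel) = ennreal (a powr (\<alpha> + 1) / (\<alpha> + 1))"
    by simp
  also have "(\<integral>\<^sup>+h. ennreal (if h \<in> {0..a} then h powr \<alpha> else 0) \<partial>lborel)
      = (\<integral>\<^sup>+h\<in>{0..a}. ennreal (h powr \<alpha>) \<partial>lborel)"
    by (intro nn_integral_cong) auto
  finally show ?thesis .
qed

section \<open>Orders of powers at 0\<close>

lemma sqrt_powr: "0 \<le> \<kappa> \<Longrightarrow> sqrt \<kappa> powr p = \<kappa> powr (p / 2)" for \<kappa> p :: real
  by (simp add: powr_half_sqrt[symmetric] powr_powr)

lemma powr_bigo_at_right_0:
  fixes p q :: real
  assumes "q \<le> p"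
  shows "(\<lambda>\<kappa>. \<kappa> powr p) \<in> O[at_right 0](\<lambda>\<kappa>. \<kappa> powr q)"
proof (rule bigoI[where c = 1])
  have "eventually (\<lambda>\<kappa>::real. \<kappa> \<in> {0<..<1}) (at_right 0)"
    by (rule eventually_at_right_real) simp
  then show "\<forall>\<^sub>F \<kappa> in at_right 0. norm (\<kappa> powr p) \<le> 1 * norm (\<kappa> powr q)"
    by eventually_elim (use assms in \<open>auto intro!: powr_mono'\<close>)
qed

lemma ident_bigo_at_right_0: "q \<le> 1 \<Longrightarrow> (\<lambda>\<kappa>. \<kappa>) \<in> O[at_right 0](\<lambda>\<kappa>. \<kappa> powr q)" for q :: real
  using powr_bigo_at_right_0[of q 1] by simp

lemma powr_smallo_at_right_0:
  fixes p q :: real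
  assumes "q < p"
  shows "(\<lambda>\<kappa>. \<kappa> powr p) \<in> o[at_right 0](\<lambda>\<kappa>. \<kappa> powr q)"
proof (rule smalloI_tendsto)
  have pos: "eventually (\<lambda>\<kappa>::real. 0 < \<kappa>) (at_right 0)" by (rule eventually_at_right_less)
  have "((\<lambda>\<kappa>::real. \<kappa> powr (p - q)) \<longlongrightarrow> 0) (at_right 0)"
    using assms pos by (intro tendsto_zero_powrI[where b = "p - q"] tendsto_const tendsto_ident_at)
      (auto elim: eventually_mono)
  moreover have "eventually (\<lambda>\<kappa>::real. \<kappa> powr p / \<kappa> powr q = \<kappa> powr (p - q)) (at_right 0)"
    using pos by eventually_elim (simp add: powr_diff)
  ultimately show "((\<lambda>\<kappa>::real. \<kappa> powr p / \<kappa> powr q) \<longlongrightarrow> 0) (at_right 0)"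
    by (simp add: tendsto_cong)
  show "\<forall>\<^sub>F \<kappa>::real in at_right 0. \<kappa> powr q \<noteq> 0"
    using pos by eventually_elim simp
qed

lemma ident_smallo_at_right_0: "q < 1 \<Longrightarrow> (\<lambda>\<kappa>. \<kappa>) \<in> o[at_right 0](\<lambda>\<kappa>. \<kappa> powr q)" for q :: real
  using powr_smallo_at_right_0[of q 1] by simp

lemma sqrt_eq_powr_at_right_0: "\<forall>\<^sub>F \<kappa> in at_right 0. sqrt \<kappa> = \<kappa> powr (1 / 2)"
  using eventually_at_right_less[of 0] by eventually_elim (simp add: powr_half_sqrt)

context usual_filtered_prob_space
begin

lemma energy_triangle:
  assumes "jointly_measurable u" "jointly_measurable v" "jointly_measurable w" "0 \<le> p" "q \<le> T"
  shows "energy M p q (\<lambda>t \<omega>. u t \<omega> - w t \<omega>)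
    \<le> 2 * energy M p q (\<lambda>t \<omega>. u t \<omega> - v t \<omega>) + 2 * energy M p q (\<lambda>t \<omega>. v t \<omega> - w t \<omega>)"
proof -
  define f where "f u t = (\<integral>\<^sup>+\<omega>. ennreal ((u (max 0 (min T t)) \<omega>)\<^sup>2) \<partial>M)" for u t
  have f: "energy M p q u = (\<integral>\<^sup>+t\<in>{p..q}. f u t \<partial>lborel)" if "jointly_measurable u" for u
    unfolding energy_swap[OF that assms(4,5)] using assms(4,5)
    by (intro nn_integral_cong) (auto simp: f_def indicator_def)
  note d = jointly_measurable_diff
  have [measurable]: "f u \<in> borel_measurable borel" if "jointly_measurable u" for u
    unfolding f_def by (rule second_moment_measurable[OF that])
  note [measurable] = this[OF d[OF assms(1,2)]] this[OF d[OF assms(2,3)]]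
  have "f (\<lambda>t \<omega>. u t \<omega> - w t \<omega>) t \<le> 2 * f (\<lambda>t \<omega>. u t \<omega> - v t \<omega>) t + 2 * f (\<lambda>t \<omega>. v t \<omega> - w t \<omega>) t" for t
  proof -
    have [measurable]: "z (max 0 (min T t)) \<in> borel_measurable M" if "jointly_measurable z" for z
      using jointly_measurable_compose[OF that, of "\<lambda>_. t" M "\<lambda>\<omega>. \<omega>"] by simp
    note [measurable] = this[OF assms(1)] this[OF assms(2)] this[OF assms(3)]
    have "f (\<lambda>t \<omega>. u t \<omega> - w t \<omega>) t \<le> (\<integral>\<^sup>+\<omega>. 2 * ennreal ((u (max 0 (min T t)) \<omega> - v (max 0 (min T t)) \<omega>)\<^sup>2)
        + 2 * ennreal ((v (max 0 (min T t)) \<omega> - w (max 0 (min T t)) \<omega>)\<^sup>2) \<partial>M)"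
      unfolding f_def by (intro nn_integral_mono ennreal_square_triangle)
    then show ?thesis
      unfolding f_def by (subst (asm) nn_integral_add) (auto simp: nn_integral_cmult)
  qed
  then have "(\<integral>\<^sup>+t\<in>{p..q}. f (\<lambda>t \<omega>. u t \<omega> - w t \<omega>) t \<partial>lborel)
      \<le> (\<integral>\<^sup>+t. 2 * (f (\<lambda>t \<omega>. u t \<omega> - v t \<omega>) t * indicator {p..q} t)
        + 2 * (f (\<lambda>t \<omega>. v t \<omega> - w t \<omega>) t * indicator {p..q} t) \<partial>lborel)"
    by (intro nn_integral_mono) (auto simp: indicator_def)
  also have "\<dots> = 2 * (\<integral>\<^sup>+t\<in>{p..q}. f (\<lambda>t \<omega>. u t \<omega> - v t \<omega>) t \<partial>lborel)
      + 2 * (\<integral>\<^sup>+t\<in>{p..q}. f (\<lambda>t \<omega>. v t \<omega> - w t \<omega>) t \<partial>lborel)"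
    by (subst nn_integral_add) (auto simp: nn_integral_cmult)
  finally show ?thesis using f d assms(1-3) by simp
qed

end

context square_integrable_target
begin

text \<open>Pointwise in time the gap between \<open>\<Xi>\<close> and \<open>Y\<close> is uncontrolled, so the time at which steering
  towards the target starts is chosen in \<open>{T - 2 * a..T - a}\<close> by averaging.\<close>

lemma good_switching_time:
  assumes Y: "jointly_measurable Y" and \<xi>: "jointly_measurable \<xi>" and a: "0 < a" "a \<le> T / 2"
    and fin: "energy M 0 T (\<lambda>t \<omega>. Y t \<omega> - \<xi> t \<omega>) < \<infinity>"
      "energy M (T - 2 * a) T (\<lambda>t \<omega>. \<xi> t \<omega> - \<Xi> t \<omega>) < \<infinity>"
  obtains r where "T - 2 * a \<le> r" "r \<le> T - a"
    "ennreal a * (\<integral>\<^sup>+\<omega>. ennreal ((\<Xi> r \<omega> - Y r \<omega>)\<^sup>2) \<partial>M)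
      \<le> 2 * energy M 0 T (\<lambda>t \<omega>. Y t \<omega> - \<xi> t \<omega>) + 2 * energy M (T - 2 * a) T (\<lambda>t \<omega>. \<xi> t \<omega> - \<Xi> t \<omega>)"
proof -
  let ?p = "T - 2 * a"
  define C where "C = 2 * energy M 0 T (\<lambda>t \<omega>. Y t \<omega> - \<xi> t \<omega>) + 2 * energy M ?p T (\<lambda>t \<omega>. \<xi> t \<omega> - \<Xi> t \<omega>)"
  have C_fin: "C < \<infinity>" using fin by (auto simp: C_def ennreal_mult_less_top)
  have "\<exists>r\<in>{?p..T - a}. ennreal a * (\<integral>\<^sup>+\<omega>. ennreal ((\<Xi> r \<omega> - Y r \<omega>)\<^sup>2) \<partial>M) \<le> C"
  proof (rule ccontr)
    assume "\<not> ?thesis"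
    then have large: "C < ennreal a * (\<integral>\<^sup>+\<omega>. ennreal ((\<Xi> r \<omega> - Y r \<omega>)\<^sup>2) \<partial>M)" if "r \<in> {?p..T - a}" for r
      using that by (auto simp: not_le)
    obtain \<Xi>' where \<Xi>': "jointly_measurable \<Xi>'" "AE \<omega> in M. \<forall>t. \<Xi>' t \<omega> = \<Xi> t \<omega>"
      using Xi_modification .
    define g where "g t = (\<integral>\<^sup>+\<omega>. ennreal ((Y (max 0 (min T t)) \<omega> - \<Xi>' (max 0 (min T t)) \<omega>)\<^sup>2) \<partial>M)" for t
    have joint: "jointly_measurable (\<lambda>t \<omega>. Y t \<omega> - \<Xi>' t \<omega>)" by (rule jointly_measurable_diff[OF Y \<Xi>'(1)])
    have [measurable]: "g \<in> borel_measurable borel"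
      unfolding g_def by (rule second_moment_measurable[OF joint])
    have g: "g t = (\<integral>\<^sup>+\<omega>. ennreal ((\<Xi> t \<omega> - Y t \<omega>)\<^sup>2) \<partial>M)" if "t \<in> {?p..T}" for t
      unfolding g_def
    proof (rule nn_integral_cong_AE)
      have "max 0 (min T t) = t" using that a by auto
      then show "AE \<omega> in M. ennreal ((Y (max 0 (min T t)) \<omega> - \<Xi>' (max 0 (min T t)) \<omega>)\<^sup>2) = ennreal ((\<Xi> t \<omega> - Y t \<omega>)\<^sup>2)"
        using \<Xi>'(2) by (auto elim!: eventually_mono simp: power2_commute[of "Y t _"])
    qed
    \<comment> \<open>The window has length \<open>a\<close>. If every time in it were bad,
      integrating would put \<open>a * C\<close> strictly below \<open>a\<close> times the energy of
      the difference of \<open>Y\<close> and \<open>\<Xi>'\<close>, which the triangle inequality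
      bounds by \<open>C\<close>. Strictness survives because \<open>C\<close> is finite and the
      window is not a null set.\<close>
    have "(\<integral>\<^sup>+t. C * indicator {?p..T - a} t \<partial>lborel) < (\<integral>\<^sup>+t. ennreal a * g t * indicator {?p..T - a} t \<partial>lborel)"
    proof (rule nn_integral_less)
      show "(\<integral>\<^sup>+t. C * indicator {?p..T - a} t \<partial>lborel) \<noteq> \<infinity>"
        using a C_fin by (auto simp: nn_integral_cmult ennreal_mult_eq_top_iff)
      show "AE t in lborel. C * indicator {?p..T - a} t \<le> ennreal a * g t * indicator {?p..T - a} t"
        using large g a by (auto simp: indicator_def less_imp_le)
      show "\<not> (AE t in lborel. ennreal a * g t * indicator {?p..T - a} t \<le> C * indicator {?p..T - a} t)"
      proof
        assume "AE t in lborel. ennreal a * g t * indicator {?p..T - a} t \<le> C * indicator {?p..T - a} t"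
        then have "AE t in lborel. t \<notin> {?p..T - a}"
        proof eventually_elim
          case (elim t)
          show ?case
          proof
            assume t: "t \<in> {?p..T - a}"
            then have "C < ennreal a * g t" using large[OF t] g[of t] a by simp
            then show False using elim t by (simp add: not_le[symmetric])
          qed
        qed
        then have "emeasure lborel {?p..T - a} = 0"
          by (subst (asm) AE_iff_measurable[of "{?p..T - a}"]) auto
        then show False using a by simp
      qed
    qed measurable
    also have "\<dots> = ennreal a * (\<integral>\<^sup>+t\<in>{?p..T - a}. g t \<partial>lborel)"
      by (simp add: mult.assoc nn_integral_cmult)
    also have "(\<integral>\<^sup>+t\<in>{?p..T - a}. g t \<partial>lborel) \<le> energy M ?p T (\<lambda>t \<omega>. Y t \<omega> - \<Xi>' t \<omega>)"
    proof -
      have "(\<integral>\<^sup>+t\<in>{?p..T - a}. g t \<partial>lborel) \<le> (\<integral>\<^sup>+t\<in>{?p..T}. (\<integral>\<^sup>+\<omega>. ennreal ((Y t \<omega> - \<Xi>' t \<omega>)\<^sup>2) \<partial>M) \<partial>lborel)"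
        using a by (intro nn_integral_mono) (auto simp: indicator_def g_def)
      then show ?thesis using energy_swap[OF joint, of ?p T] a by simp
    qed
    also have "\<dots> \<le> 2 * energy M ?p T (\<lambda>t \<omega>. Y t \<omega> - \<xi> t \<omega>) + 2 * energy M ?p T (\<lambda>t \<omega>. \<xi> t \<omega> - \<Xi>' t \<omega>)"
      by (rule energy_triangle[OF Y \<xi> \<Xi>'(1)]) (use a in auto)
    also have "energy M ?p T (\<lambda>t \<omega>. \<xi> t \<omega> - \<Xi>' t \<omega>) = energy M ?p T (\<lambda>t \<omega>. \<xi> t \<omega> - \<Xi> t \<omega>)"
      unfolding energy_def
      by (rule nn_integral_cong_AE) (use \<Xi>'(2) in \<open>auto elim!: eventually_mono\<close>)
    also have "energy M ?p T (\<lambda>t \<omega>. Y t \<omega> - \<xi> t \<omega>) \<le> energy M 0 T (\<lambda>t \<omega>. Y t \<omega> - \<xi> t \<omega>)"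
      unfolding energy_def using a by (intro nn_integral_mono) (auto simp: indicator_def)
    finally have "(\<integral>\<^sup>+t. C * indicator {?p..T - a} t \<partial>lborel) < ennreal a * C"
      by (simp add: C_def mult_left_mono add_right_mono)
    moreover have "(\<integral>\<^sup>+t. C * indicator {?p..T - a} t \<partial>lborel) = ennreal a * C"
      using a by (simp add: nn_integral_cmult mult.commute)
    ultimately show False by simp
  qed
  then show ?thesis using that by (auto simp: C_def)
qed

lemma stieltjes_tail_antimono: "s \<le> t \<Longrightarrow> stieltjes_tail M T \<Xi> t \<le> stieltjes_tail M T \<Xi> s"
  unfolding stieltjes_tail_def by (intro nn_integral_mono) (auto simp: indicator_def)

text \<open>\<open>e\<close> bounds the tracking error of \<open>u0\<close>, \<open>f\<close> bounds
  \<open>\<kappa>\<close> times its energy, and \<open>\<theta>\<close> bounds \<open>Theta\<close>.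
  The direct cost is \<open>e / 2 + f / 2 + \<theta>\<close>, and the switching gap adds
  \<open>4 * e + 4 * \<theta>\<close>. Keeping \<open>c\<close> free serves both estimates:
  \<open>c = 2\<close> for a general start, \<open>c = 1\<close> for a vanishing initial
  error.\<close>

lemma constrained_value_bound:
  assumes \<xi>: "progressively_measurable F T \<xi>" and \<xi>0: "integrable M (\<lambda>\<omega>. (x - \<xi> 0 \<omega>)\<^sup>2)"
    and fin: "energy M 0 T \<xi> < \<infinity>" and tail: "stieltjes_tail M T \<Xi> 0 < \<infinity>"
    and L: "0 \<le> L1" "0 \<le> L2" and \<alpha>: "0 < \<alpha>"
    and omega: "\<And>h. 0 < h \<Longrightarrow> omega_mod M T \<xi> h \<le> ennreal (L1 * h powr \<alpha>)"
    and Theta: "\<And>a. 0 < a \<Longrightarrow> a \<le> T / 2 \<Longrightarrow> Theta M T \<xi> \<Xi> a \<le> ennreal (L2 * a powr \<beta>)"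
    and \<kappa>: "\<kappa> \<in> {0<..T\<^sup>2 / 4}" and c: "0 \<le> c"
    and split: "AE \<omega> in M. \<forall>p w. (p + w * (x - \<xi> 0 \<omega>))\<^sup>2 \<le> c * p\<^sup>2 + c * (w * (x - \<xi> 0 \<omega>))\<^sup>2"
  shows "constrained_value M F T x \<xi> \<eta> \<kappa>
    \<le> ennreal (c * (3 * sqrt \<kappa> * (LINT \<omega>|M. (x - \<xi> 0 \<omega>)\<^sup>2) + 6 * L1 * Gamma (\<alpha> + 1) * \<kappa> powr (\<alpha> / 2))
        + 6 * L2 * \<kappa> powr (\<beta> / 2))
      + ennreal (6 * \<kappa>) * Lambda M T \<Xi> (sqrt \<kappa>)"
proof -
  have T: "0 \<le> T" using T_pos by simp
  define a where "a = sqrt \<kappa>"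
  define D where "D = (LINT \<omega>|M. (x - \<xi> 0 \<omega>)\<^sup>2)"
  have a: "0 < a" "a \<le> T / 2" and a2: "a\<^sup>2 = \<kappa>"
  proof -
    show "0 < a" "a\<^sup>2 = \<kappa>" using \<kappa> by (auto simp: a_def)
    have "a \<le> sqrt ((T / 2)\<^sup>2)" unfolding a_def using \<kappa> by (intro real_sqrt_le_mono) (simp add: power_divide)
    then show "a \<le> T / 2" using T by simp
  qed
  have D: "0 \<le> D" unfolding D_def by simp
  have D_nn: "(\<integral>\<^sup>+\<omega>. ennreal ((x - \<xi> 0 \<omega>)\<^sup>2) \<partial>M) = ennreal D"
    unfolding D_def by (rule nn_integral_eq_integral[OF \<xi>0]) simp
  define u0 where "u0 = averaging_control x a \<xi>"
  have u0: "progressively_measurable F T u0"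
    unfolding u0_def by (rule averaging_control_progressive[OF \<xi> a(1)])
  define Y where "Y = state x u0"
  have joint: "jointly_measurable Y" "jointly_measurable \<xi>"
    unfolding Y_def using state_jointly[OF u0 T] progressive_jointly[OF \<xi> T] by auto
  define e where "e = c * L1 * a powr \<alpha> / (\<alpha> + 1) + c * a / 2 * D"
  define f where "f = c * L1 * a powr \<alpha> + c * a * D"
  define \<theta> where "\<theta> = L2 * a powr \<beta>"
  have nonneg: "0 \<le> e" "0 \<le> f" "0 \<le> \<theta>"
    using L \<alpha> c a D by (auto simp: e_def f_def \<theta>_def)
  have E: "energy M 0 T (\<lambda>t \<omega>. Y t \<omega> - \<xi> t \<omega>) \<le> ennreal e"
  proof -
    have "energy M 0 T (\<lambda>t \<omega>. Y t \<omega> - \<xi> t \<omega>)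
        \<le> ennreal (c / a) * (\<integral>\<^sup>+h\<in>{0..a}. omega_mod M T \<xi> h \<partial>lborel) + ennreal (c * a / 2) * ennreal D"
      unfolding Y_def u0_def D_nn[symmetric] by (rule averaging_control_tracking[OF \<xi> fin T a(1) c split])
    also have "(\<integral>\<^sup>+h\<in>{0..a}. omega_mod M T \<xi> h \<partial>lborel) \<le> (\<integral>\<^sup>+h. ennreal L1 * (ennreal (h powr \<alpha>) * indicator {0..a} h) \<partial>lborel)"
    proof (rule nn_integral_mono_AE)
      \<comment> \<open>The modulus is bounded for positive lags only, and lag 0 is a null
        set.\<close>
      have "AE h in lborel. h \<noteq> (0::real)" by (rule AE_lborel_singleton)
      then show "AE h in lborel. omega_mod M T \<xi> h * indicator {0..a} h \<le> ennreal L1 * (ennreal (h powr \<alpha>) * indicator {0..a} h)"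
        by eventually_elim (use omega L in \<open>auto simp: indicator_def ennreal_mult[symmetric]\<close>)
    qed
    also have "\<dots> = ennreal L1 * ennreal (a powr (\<alpha> + 1) / (\<alpha> + 1))"
      using nn_integral_powr_Icc[OF a(1) \<alpha>] by (simp add: nn_integral_cmult)
    also have "ennreal (c / a) * (ennreal L1 * ennreal (a powr (\<alpha> + 1) / (\<alpha> + 1))) + ennreal (c * a / 2) * ennreal D
        = ennreal (c / a * (L1 * (a powr (\<alpha> + 1) / (\<alpha> + 1))) + c * a / 2 * D)"
      using c a L \<alpha> D by (simp add: ennreal_mult[symmetric] ennreal_plus)
    also have "c / a * (L1 * (a powr (\<alpha> + 1) / (\<alpha> + 1))) + c * a / 2 * D = e"
      using a by (simp add: e_def powr_add)
    finally show ?thesis by (simp add: mult_left_mono add_right_mono)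
  qed
  have U: "ennreal \<kappa> * energy M 0 T u0 \<le> ennreal f"
  proof -
    have "ennreal \<kappa> * energy M 0 T u0 \<le> ennreal c * omega_mod M T \<xi> a + ennreal (c * a) * ennreal D"
      unfolding u0_def D_nn[symmetric] a2[symmetric] by (rule averaging_control_energy[OF \<xi> T a(1) c split])
    also have "\<dots> \<le> ennreal c * ennreal (L1 * a powr \<alpha>) + ennreal (c * a) * ennreal D"
      by (intro add_right_mono mult_left_mono omega a) simp
    also have "\<dots> = ennreal f"
      using c a L D by (simp add: f_def ennreal_mult[symmetric] ennreal_plus mult.assoc)
    finally show ?thesis .
  qed
  have \<Theta>: "energy M (T - 2 * a) T (\<lambda>t \<omega>. \<xi> t \<omega> - \<Xi> t \<omega>) \<le> ennreal \<theta>"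
    using Theta[OF a] by (simp add: Theta_def \<theta>_def)
  have u0_fin: "energy M 0 T u0 < \<infinity>"
  proof (rule ccontr)
    assume "\<not> ?thesis"
    then have "energy M 0 T u0 = \<top>" by (simp add: not_less top_unique)
    then show False using U \<kappa> by (simp add: ennreal_mult_top top_unique)
  qed
  obtain r where switch: "T - 2 * a \<le> r" "r \<le> T - a"
    and gap: "ennreal a * (\<integral>\<^sup>+\<omega>. ennreal ((\<Xi> r \<omega> - Y r \<omega>)\<^sup>2) \<partial>M)
      \<le> 2 * energy M 0 T (\<lambda>t \<omega>. Y t \<omega> - \<xi> t \<omega>) + 2 * energy M (T - 2 * a) T (\<lambda>t \<omega>. \<xi> t \<omega> - \<Xi> t \<omega>)"
    by (rule good_switching_time[OF joint a le_less_trans[OF E] le_less_trans[OF \<Theta>]]) auto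
  note gap
  also have "2 * energy M 0 T (\<lambda>t \<omega>. Y t \<omega> - \<xi> t \<omega>) + 2 * energy M (T - 2 * a) T (\<lambda>t \<omega>. \<xi> t \<omega> - \<Xi> t \<omega>)
      \<le> 2 * ennreal e + 2 * ennreal \<theta>"
    by (intro add_mono mult_left_mono E \<Theta>) auto
  also have "\<dots> = ennreal (2 * e + 2 * \<theta>)" using nonneg by (simp add: ennreal_mult ennreal_plus)
  finally have gap': "ennreal a * (\<integral>\<^sup>+\<omega>. ennreal ((\<Xi> r \<omega> - Y r \<omega>)\<^sup>2) \<partial>M) \<le> ennreal (2 * e + 2 * \<theta>)" .
  have gap_fin: "(\<integral>\<^sup>+\<omega>. ennreal ((\<Xi> r \<omega> - Y r \<omega>)\<^sup>2) \<partial>M) < \<infinity>"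
  proof (rule ccontr)
    assume "\<not> ?thesis"
    then have "(\<integral>\<^sup>+\<omega>. ennreal ((\<Xi> r \<omega> - Y r \<omega>)\<^sup>2) \<partial>M) = \<top>" by (simp add: not_less top_unique)
    then show False using gap' a by (simp add: ennreal_mult_top top_unique)
  qed
  interpret dyadic_steering M F T \<eta> \<Xi> x r u0
    by unfold_locales (use switch a u0 u0_fin gap_fin in \<open>auto simp: Y_def\<close>)
  have tail_r: "stieltjes_tail M T \<Xi> r \<le> Lambda M T \<Xi> a"
    unfolding Lambda_def by (rule stieltjes_tail_antimono[OF switch(1)])
  have "stieltjes_tail M T \<Xi> r \<le> stieltjes_tail M T \<Xi> 0"
    by (rule stieltjes_tail_antimono) (use switch a in auto)
  then have tail_fin: "stieltjes_tail M T \<Xi> r < \<infinity>" using tail by (rule le_less_trans)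
  have "constrained_value M F T x \<xi> \<eta> \<kappa>
    \<le> ennreal (1/2) * energy M 0 T (\<lambda>t \<omega>. Y t \<omega> - \<xi> t \<omega>) + ennreal (\<kappa>/2) * energy M 0 T u0
      + energy M (T - 2 * a) T (\<lambda>t \<omega>. \<xi> t \<omega> - \<Xi> t \<omega>)
      + (ennreal ((T - r) / 2 + \<kappa> / (T - r)) * gap 0
        + ennreal (3 / 4 * (T - r)\<^sup>2 + 2 * \<kappa>) * stieltjes_tail M T \<Xi> r)"
    unfolding Y_def by (rule constrained_value_le[OF \<xi> _ switch(1) _ tail_fin]) (use a \<kappa> in auto)
  also have "\<dots> \<le> ennreal (1/2) * ennreal e + ennreal (1/2) * ennreal f + ennreal \<theta>
      + (2 * ennreal (2 * e + 2 * \<theta>) + ennreal (6 * \<kappa>) * Lambda M T \<Xi> a)"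
  proof (intro add_mono)
    show "ennreal (\<kappa>/2) * energy M 0 T u0 \<le> ennreal (1/2) * ennreal f"
    proof -
      have "ennreal (\<kappa>/2) * energy M 0 T u0 = ennreal (1/2) * (ennreal \<kappa> * energy M 0 T u0)"
        using \<kappa> by (simp only: mult.assoc[symmetric]) (subst ennreal_mult[symmetric], auto)
      also have "\<dots> \<le> ennreal (1/2) * ennreal f" by (intro mult_left_mono U) simp
      finally show ?thesis .
    qed
    have "(T - r) / 2 + \<kappa> / (T - r) \<le> 2 * a"
    proof -
      \<comment> \<open>The switch leaves between \<open>a\<close> and \<open>2 * a\<close> of time,
        and \<open>\<kappa> = a\<^sup>2\<close>, so each of the two summands is at most
        \<open>a\<close>.\<close>
      have "\<kappa> / (T - r) \<le> \<kappa> / a" using switch a \<kappa> by (intro divide_left_mono) auto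
      also have "\<kappa> / a = a" using a a2 by (simp add: power2_eq_square[symmetric] divide_eq_eq)
      finally have "\<kappa> / (T - r) \<le> a" .
      moreover have "(T - r) / 2 \<le> a" using switch by simp
      ultimately have "(T - r) / 2 + \<kappa> / (T - r) \<le> a + a" by (intro add_mono)
      then show ?thesis by (simp only: mult_2)
    qed
    then have "ennreal ((T - r) / 2 + \<kappa> / (T - r)) * gap 0 \<le> ennreal (2 * a) * gap 0"
      by (intro mult_right_mono ennreal_leI) auto
    also have "\<dots> = 2 * (ennreal a * gap 0)"
      using a by (simp add: ennreal_mult mult.assoc)
    also have "\<dots> \<le> 2 * ennreal (2 * e + 2 * \<theta>)"
      using gap' by (intro mult_left_mono) (auto simp: gap_def Y_def)
    finally show "ennreal ((T - r) / 2 + \<kappa> / (T - r)) * gap 0 \<le> 2 * ennreal (2 * e + 2 * \<theta>)" .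
    \<comment> \<open>This gives \<open>3 * \<kappa> + 2 * \<kappa>\<close>, one
      \<open>\<kappa>\<close> below the claim.\<close>
    have "(T - r)\<^sup>2 \<le> (2 * a)\<^sup>2" using switch a by (intro power_mono) auto
    then have "3 / 4 * (T - r)\<^sup>2 + 2 * \<kappa> \<le> 6 * \<kappa>" using a2 \<kappa> by (simp add: power_mult_distrib)
    then show "ennreal (3 / 4 * (T - r)\<^sup>2 + 2 * \<kappa>) * stieltjes_tail M T \<Xi> r \<le> ennreal (6 * \<kappa>) * Lambda M T \<Xi> a"
      by (intro mult_mono ennreal_leI tail_r) auto
  qed (use E \<Theta> in \<open>auto intro: mult_left_mono\<close>)
  also have "\<dots> = ennreal (9 / 2 * e + f / 2 + 5 * \<theta>) + ennreal (6 * \<kappa>) * Lambda M T \<Xi> a"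
  proof -
    have half: "ennreal (1/2) * ennreal z = ennreal (z / 2)" if "0 \<le> z" for z
      using that by (subst ennreal_mult[symmetric]) auto
    have double: "2 * ennreal z = ennreal (2 * z)" if "0 \<le> z" for z
      using that by (simp add: ennreal_mult)
    have "ennreal (1/2) * ennreal e + ennreal (1/2) * ennreal f + ennreal \<theta> + 2 * ennreal (2 * e + 2 * \<theta>)
        = ennreal (e / 2 + f / 2 + \<theta> + 2 * (2 * e + 2 * \<theta>))"
      unfolding half[OF nonneg(1)] half[OF nonneg(2)]
      using nonneg by (simp add: double ennreal_plus[symmetric] del: ennreal_plus)
    also have "e / 2 + f / 2 + \<theta> + 2 * (2 * e + 2 * \<theta>) = 9 / 2 * e + f / 2 + 5 * \<theta>" by simp
    finally show ?thesis by (simp only: add.assoc[symmetric])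
  qed
  also have "\<dots> \<le> ennreal (c * (3 * a * D + 6 * L1 * Gamma (\<alpha> + 1) * a powr \<alpha>) + 6 * \<theta>)
      + ennreal (6 * \<kappa>) * Lambda M T \<Xi> a"
  proof (intro add_right_mono ennreal_leI)
    \<comment> \<open>The coefficient of \<open>a * D\<close> is 9/4 + 1/2 = 11/4, rounded up to 3.
      That of \<open>L1 * a powr \<alpha>\<close> is half the left-hand side of
      \<open>averaging_constant_le_Gamma\<close>. Both carry the factor \<open>c\<close>.\<close>
    define q where "q = 1 / (\<alpha> + 1)"
    have "e = c * L1 * a powr \<alpha> * q + c * a / 2 * D" by (simp add: e_def q_def)
    then have "9 / 2 * e + f / 2 = c * (11 / 4 * a * D + (1 + 9 * q) / 2 * (L1 * a powr \<alpha>))"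
      by (simp add: f_def algebra_simps add_divide_distrib)
    also have "\<dots> \<le> c * (3 * a * D + 12 * Gamma (\<alpha> + 1) / 2 * (L1 * a powr \<alpha>))"
      using averaging_constant_le_Gamma[OF \<alpha>] L a D c unfolding q_def
      by (intro mult_left_mono add_mono mult_right_mono divide_right_mono) auto
    also have "12 * Gamma (\<alpha> + 1) / 2 * (L1 * a powr \<alpha>) = 6 * L1 * Gamma (\<alpha> + 1) * a powr \<alpha>" by simp
    finally show "9 / 2 * e + f / 2 + 5 * \<theta> \<le> c * (3 * a * D + 6 * L1 * Gamma (\<alpha> + 1) * a powr \<alpha>) + 6 * \<theta>"
      using nonneg by linarith
  qed
  finally show ?thesis
    using \<kappa> by (simp add: a_def D_def \<theta>_def sqrt_powr mult.assoc)
qed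

end

text \<open>A bounded \<open>\<Lambda>\<close> turns the last term into a multiple of
  \<open>\<kappa>\<close>. It also makes the whole bound finite, so near 0 \<open>enn2real\<close>
  does not hide an infinite value behind its default 0.\<close>

lemma enn2real_bigo_of_bound:
  fixes v \<Lambda> :: "real \<Rightarrow> ennreal" and A B C K \<alpha> \<beta> b :: real
  assumes b: "0 < b" and nonneg: "0 \<le> A" "0 \<le> B" "0 \<le> C" "0 \<le> K"
    and bound: "\<And>\<kappa>. \<kappa> \<in> {0<..b} \<Longrightarrow>
      v \<kappa> \<le> ennreal (A * sqrt \<kappa> + B * \<kappa> powr (\<alpha> / 2) + C * \<kappa> powr (\<beta> / 2)) + ennreal (6 * \<kappa>) * \<Lambda> \<kappa>"
    and \<Lambda>: "\<And>\<kappa>. \<kappa> \<in> {0<..b} \<Longrightarrow> \<Lambda> \<kappa> \<le> ennreal K"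
  shows "(\<lambda>\<kappa>. enn2real (v \<kappa>)) \<in> O[at_right 0](\<lambda>\<kappa>. A * \<kappa> powr (1 / 2) + B * \<kappa> powr (\<alpha> / 2)
    + C * \<kappa> powr (\<beta> / 2) + 6 * K * \<kappa>)"
proof (rule bigoI[where c = 1])
  have "eventually (\<lambda>\<kappa>. \<kappa> \<in> {0<..<b}) (at_right 0)"
    by (rule eventually_at_right_real[OF b])
  then show "\<forall>\<^sub>F \<kappa> in at_right 0. norm (enn2real (v \<kappa>))
      \<le> 1 * norm (A * \<kappa> powr (1 / 2) + B * \<kappa> powr (\<alpha> / 2) + C * \<kappa> powr (\<beta> / 2) + 6 * K * \<kappa>)"
  proof eventually_elim
    case (elim \<kappa>)
    let ?R = "A * sqrt \<kappa> + B * \<kappa> powr (\<alpha> / 2) + C * \<kappa> powr (\<beta> / 2)"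
    have "v \<kappa> \<le> ennreal ?R + ennreal (6 * \<kappa>) * \<Lambda> \<kappa>" using bound elim by simp
    also have "\<dots> \<le> ennreal ?R + ennreal (6 * \<kappa>) * ennreal K"
      using \<Lambda>[of \<kappa>] elim by (intro add_left_mono mult_left_mono) auto
    also have "\<dots> = ennreal (?R + 6 * \<kappa> * K)"
      using elim nonneg by (simp add: ennreal_mult[symmetric] ennreal_plus[symmetric] del: ennreal_plus)
    finally have "enn2real (v \<kappa>) \<le> enn2real (ennreal (?R + 6 * \<kappa> * K))"
      by (rule enn2real_mono) simp
    also have "\<dots> = ?R + 6 * \<kappa> * K" using elim nonneg by (intro enn2real_ennreal) auto
    also have "\<dots> = A * \<kappa> powr (1 / 2) + B * \<kappa> powr (\<alpha> / 2) + C * \<kappa> powr (\<beta> / 2) + 6 * K * \<kappa>"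
      using elim by (simp add: powr_half_sqrt)
    finally show ?case by simp
  qed
qed

theorem corollary3p3:
  fixes M :: "'a measure" and F :: "real \<Rightarrow> 'a measure"
    and T x L1 L2 \<alpha> \<beta> :: real
    and \<xi> \<Xi> :: "real \<Rightarrow> 'a \<Rightarrow> real" and \<Xi>T :: "'a \<Rightarrow> real"
    and v :: "real \<Rightarrow> ennreal"
  assumes "0 < T"
    and "usual_filtered_prob_space M F T"
    and "progressively_measurable F T \<xi>"
    and "integrable M (\<lambda>\<omega>. (\<xi> 0 \<omega>)\<^sup>2)"
    and "energy M 0 T \<xi> < \<infinity>"
    and "\<Xi>T \<in> borel_measurable (F T)"
    and "integrable M (\<lambda>\<omega>. (\<Xi>T \<omega>)\<^sup>2)"
    and "cadlag_cond_exp_version M F T \<Xi>T \<Xi>"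
    and "stieltjes_tail M T \<Xi> 0 < \<infinity>"
    and "0 \<le> L1" and "0 \<le> L2" and "0 < \<alpha>" and "0 < \<beta>"
    and "\<And>h. 0 < h \<Longrightarrow> omega_mod M T \<xi> h \<le> ennreal (L1 * h powr \<alpha>)"
    and "\<And>a. 0 < a \<Longrightarrow> a \<le> T / 2 \<Longrightarrow> Theta M T \<xi> \<Xi> a \<le> ennreal (L2 * a powr \<beta>)"
  defines "v \<equiv> constrained_value M F T x \<xi> \<Xi>T"
  shows
    "(\<forall>\<kappa>\<in>{0<..T\<^sup>2 / 4}.
        v \<kappa> \<le> ennreal (6 * sqrt \<kappa> * (LINT \<omega>|M. (x - \<xi> 0 \<omega>)\<^sup>2)
                       + 12 * L1 * Gamma (\<alpha> + 1) * \<kappa> powr (\<alpha> / 2)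
                       + 6 * L2 * \<kappa> powr (\<beta> / 2))
               + ennreal (6 * \<kappa>) * Lambda M T \<Xi> (sqrt \<kappa>)) \<and>
     (\<lambda>\<kappa>. enn2real (v \<kappa>)) \<in> O[at_right 0](\<lambda>\<kappa>. \<kappa> powr (min 1 (min \<alpha> \<beta>) / 2)) \<and>
     (1 \<le> \<alpha> \<and> 1 \<le> \<beta> \<longrightarrow> (\<lambda>\<kappa>. enn2real (v \<kappa>)) \<in> O[at_right 0](\<lambda>\<kappa>. sqrt \<kappa>)) \<and>
     ((AE \<omega> in M. x = \<xi> 0 \<omega>) \<longrightarrow>
        (\<forall>\<kappa>\<in>{0<..T\<^sup>2 / 4}.
           v \<kappa> \<le> ennreal (6 * L1 * Gamma (\<alpha> + 1) * \<kappa> powr (\<alpha> / 2) + 6 * L2 * \<kappa> powr (\<beta> / 2))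
                  + ennreal (6 * \<kappa>) * Lambda M T \<Xi> (sqrt \<kappa>)) \<and>
        (\<lambda>\<kappa>. enn2real (v \<kappa>)) \<in> O[at_right 0](\<lambda>\<kappa>. \<kappa> powr (min \<alpha> (min \<beta> 2) / 2)) \<and>
        (1 < \<alpha> \<and> 1 < \<beta> \<longrightarrow> (\<lambda>\<kappa>. enn2real (v \<kappa>)) \<in> o[at_right 0](\<lambda>\<kappa>. sqrt \<kappa>)))"
proof -
  interpret usual_filtered_prob_space M F T by fact
  interpret square_integrable_target M F T \<Xi>T \<Xi> by unfold_locales fact+
  define D where "D = (LINT \<omega>|M. (x - \<xi> 0 \<omega>)\<^sup>2)"
  define K where "K = enn2real (stieltjes_tail M T \<Xi> 0)"
  have D: "0 \<le> D" unfolding D_def by simp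
  have G: "0 \<le> L1 * Gamma (\<alpha> + 1)"
    using \<open>0 < \<alpha>\<close> \<open>0 \<le> L1\<close> Gamma_real_pos[of "\<alpha> + 1"] by simp
  have T0: "0 \<in> {0..T}" "0 \<le> T" using \<open>0 < T\<close> by auto
  have b: "0 < T\<^sup>2 / 4" using \<open>0 < T\<close> by simp
  have "\<xi> 0 \<in> borel_measurable M"
    using F_measurable_M[OF T0(1) progressively_measurable_at_0[OF assms(3) T0(1)]] .
  then have start_int: "integrable M (\<lambda>\<omega>. (x - \<xi> 0 \<omega>)\<^sup>2)"
    using diff_sq_integrable[of "\<lambda>_. x" "\<xi> 0"] assms(4) by simp
  have bound: "v \<kappa> \<le> ennreal (c * (3 * sqrt \<kappa> * D + 6 * L1 * Gamma (\<alpha> + 1) * \<kappa> powr (\<alpha> / 2))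
      + 6 * L2 * \<kappa> powr (\<beta> / 2)) + ennreal (6 * \<kappa>) * Lambda M T \<Xi> (sqrt \<kappa>)"
    if "\<kappa> \<in> {0<..T\<^sup>2 / 4}" "0 \<le> c"
      "AE \<omega> in M. \<forall>p w. (p + w * (x - \<xi> 0 \<omega>))\<^sup>2 \<le> c * p\<^sup>2 + c * (w * (x - \<xi> 0 \<omega>))\<^sup>2" for \<kappa> c
    unfolding v_def D_def
    by (rule constrained_value_bound[OF assms(3) start_int assms(5,9,10,11,12) assms(14) assms(15) that])
  have tail: "Lambda M T \<Xi> (sqrt \<kappa>) \<le> ennreal K" if \<kappa>: "\<kappa> \<in> {0<..T\<^sup>2 / 4}" for \<kappa>
  proof -
    have "sqrt \<kappa> \<le> sqrt ((T / 2)\<^sup>2)" using \<kappa> by (intro real_sqrt_le_mono) (simp add: power_divide)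
    then have "0 \<le> T - 2 * sqrt \<kappa>" using T0 by simp
    then have "Lambda M T \<Xi> (sqrt \<kappa>) \<le> stieltjes_tail M T \<Xi> 0"
      unfolding Lambda_def by (rule stieltjes_tail_antimono)
    also have "\<dots> = ennreal K" using assms(9) by (simp add: K_def)
    finally show ?thesis .
  qed
  have K: "0 \<le> K" by (simp add: K_def)
  have general: "v \<kappa> \<le> ennreal (6 * D * sqrt \<kappa> + 12 * (L1 * Gamma (\<alpha> + 1)) * \<kappa> powr (\<alpha> / 2)
      + 6 * L2 * \<kappa> powr (\<beta> / 2)) + ennreal (6 * \<kappa>) * Lambda M T \<Xi> (sqrt \<kappa>)"
    if "\<kappa> \<in> {0<..T\<^sup>2 / 4}" for \<kappa>
  proof -
    \<comment> \<open>The splitting with \<open>c = 2\<close> doubles 3 and 6 into the 6 and 12 of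
      the general estimate.\<close>
    have "(p + w)\<^sup>2 \<le> 2 * p\<^sup>2 + 2 * w\<^sup>2" for p w :: real
      using zero_le_power2[of "p - w"] by (simp add: power2_eq_square algebra_simps)
    then have "v \<kappa> \<le> ennreal (2 * (3 * sqrt \<kappa> * D + 6 * L1 * Gamma (\<alpha> + 1) * \<kappa> powr (\<alpha> / 2))
        + 6 * L2 * \<kappa> powr (\<beta> / 2)) + ennreal (6 * \<kappa>) * Lambda M T \<Xi> (sqrt \<kappa>)"
      by (intro bound that) auto
    then show ?thesis by (simp add: distrib_left mult_ac)
  qed
  have sharp: "v \<kappa> \<le> ennreal (6 * (L1 * Gamma (\<alpha> + 1)) * \<kappa> powr (\<alpha> / 2)
      + 6 * L2 * \<kappa> powr (\<beta> / 2)) + ennreal (6 * \<kappa>) * Lambda M T \<Xi> (sqrt \<kappa>)"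
    if "\<kappa> \<in> {0<..T\<^sup>2 / 4}" and eq: "AE \<omega> in M. x = \<xi> 0 \<omega>" for \<kappa>
  proof -
    \<comment> \<open>A vanishing initial error removes the term with \<open>D\<close> and leaves
      nothing to split off in the square, so \<open>c = 1\<close> is admissible and the 12 becomes
      6.\<close>
    have "D = (LINT \<omega>|M. 0)"
      unfolding D_def
      by (rule integral_cong_AE) (use eq \<open>\<xi> 0 \<in> borel_measurable M\<close> in auto)
    then have "D = 0" by simp
    have "AE \<omega> in M. \<forall>p w. (p + w * (x - \<xi> 0 \<omega>))\<^sup>2 \<le> 1 * p\<^sup>2 + 1 * (w * (x - \<xi> 0 \<omega>))\<^sup>2"
      using eq by eventually_elim simp
    from bound[OF that(1) zero_le_one this] show ?thesis using \<open>D = 0\<close> by (simp add: mult_ac)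
  qed
  have order: "(\<lambda>\<kappa>. enn2real (v \<kappa>)) \<in> O[at_right 0](\<lambda>\<kappa>. \<kappa> powr \<gamma>)"
    if "\<gamma> \<le> 1 / 2" "\<gamma> \<le> \<alpha> / 2" "\<gamma> \<le> \<beta> / 2" for \<gamma>
  proof -
    have "(\<lambda>\<kappa>. enn2real (v \<kappa>)) \<in> O[at_right 0](\<lambda>\<kappa>. 6 * D * \<kappa> powr (1 / 2)
        + 12 * (L1 * Gamma (\<alpha> + 1)) * \<kappa> powr (\<alpha> / 2) + 6 * L2 * \<kappa> powr (\<beta> / 2) + 6 * K * \<kappa>)"
      by (rule enn2real_bigo_of_bound[OF b _ _ _ K general tail]) (use D G \<open>0 \<le> L2\<close> in auto)
    also have "(\<lambda>\<kappa>. 6 * D * \<kappa> powr (1 / 2)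
        + 12 * (L1 * Gamma (\<alpha> + 1)) * \<kappa> powr (\<alpha> / 2) + 6 * L2 * \<kappa> powr (\<beta> / 2) + 6 * K * \<kappa>)
        \<in> O[at_right 0](\<lambda>\<kappa>. \<kappa> powr \<gamma>)"
      by (intro sum_in_bigo(1)) (use that in \<open>auto intro!: powr_bigo_at_right_0 ident_bigo_at_right_0\<close>)
    finally show ?thesis .
  qed
  \<comment> \<open>The coefficient 0 brings the sharper bound into the shape of
    \<open>enn2real_bigo_of_bound\<close>. With the square root gone, the term linear in
    \<open>\<kappa>\<close>, of order 2 / 2, caps the rate; hence the 2 in the minimum of the
    exponents.\<close>
  have sharp_bigo: "(\<lambda>\<kappa>. enn2real (v \<kappa>)) \<in> O[at_right 0](\<lambda>\<kappa>. 0 * \<kappa> powr (1 / 2)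
      + 6 * (L1 * Gamma (\<alpha> + 1)) * \<kappa> powr (\<alpha> / 2) + 6 * L2 * \<kappa> powr (\<beta> / 2) + 6 * K * \<kappa>)"
    if "AE \<omega> in M. x = \<xi> 0 \<omega>"
    by (rule enn2real_bigo_of_bound[OF b _ _ _ K _ tail]) (use sharp[OF _ that] G \<open>0 \<le> L2\<close> in auto)
  show ?thesis
  proof (intro conjI impI ballI)
    fix \<kappa> assume "\<kappa> \<in> {0<..T\<^sup>2 / 4}"
    from general[OF this]
    show "v \<kappa> \<le> ennreal (6 * sqrt \<kappa> * (LINT \<omega>|M. (x - \<xi> 0 \<omega>)\<^sup>2)
        + 12 * L1 * Gamma (\<alpha> + 1) * \<kappa> powr (\<alpha> / 2) + 6 * L2 * \<kappa> powr (\<beta> / 2))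
        + ennreal (6 * \<kappa>) * Lambda M T \<Xi> (sqrt \<kappa>)"
      by (simp add: D_def mult_ac)
  next
    show "(\<lambda>\<kappa>. enn2real (v \<kappa>)) \<in> O[at_right 0](\<lambda>\<kappa>. \<kappa> powr (min 1 (min \<alpha> \<beta>) / 2))"
      by (rule order) auto
  next
    assume "1 \<le> \<alpha> \<and> 1 \<le> \<beta>"
    then have "(\<lambda>\<kappa>. enn2real (v \<kappa>)) \<in> O[at_right 0](\<lambda>\<kappa>. \<kappa> powr (1 / 2))"
      by (intro order) auto
    then show "(\<lambda>\<kappa>. enn2real (v \<kappa>)) \<in> O[at_right 0](\<lambda>\<kappa>. sqrt \<kappa>)"
      by (simp only: landau_o.big.cong[OF sqrt_eq_powr_at_right_0])
  next
    fix \<kappa> assume "AE \<omega> in M. x = \<xi> 0 \<omega>" "\<kappa> \<in> {0<..T\<^sup>2 / 4}"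
    from sharp[OF this(2,1)]
    show "v \<kappa> \<le> ennreal (6 * L1 * Gamma (\<alpha> + 1) * \<kappa> powr (\<alpha> / 2) + 6 * L2 * \<kappa> powr (\<beta> / 2))
        + ennreal (6 * \<kappa>) * Lambda M T \<Xi> (sqrt \<kappa>)"
      by (simp add: mult_ac)
  next
    assume eq: "AE \<omega> in M. x = \<xi> 0 \<omega>"
    note sharp_bigo[OF eq]
    also have "(\<lambda>\<kappa>. 0 * \<kappa> powr (1 / 2)
        + 6 * (L1 * Gamma (\<alpha> + 1)) * \<kappa> powr (\<alpha> / 2) + 6 * L2 * \<kappa> powr (\<beta> / 2) + 6 * K * \<kappa>)
        \<in> O[at_right 0](\<lambda>\<kappa>. \<kappa> powr (min \<alpha> (min \<beta> 2) / 2))"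
      by (intro sum_in_bigo(1)) (auto intro!: powr_bigo_at_right_0 ident_bigo_at_right_0)
    finally show "(\<lambda>\<kappa>. enn2real (v \<kappa>)) \<in> O[at_right 0](\<lambda>\<kappa>. \<kappa> powr (min \<alpha> (min \<beta> 2) / 2))" .
  next
    assume eq: "AE \<omega> in M. x = \<xi> 0 \<omega>" and gt: "1 < \<alpha> \<and> 1 < \<beta>"
    note sharp_bigo[OF eq]
    also have "(\<lambda>\<kappa>. 0 * \<kappa> powr (1 / 2)
        + 6 * (L1 * Gamma (\<alpha> + 1)) * \<kappa> powr (\<alpha> / 2) + 6 * L2 * \<kappa> powr (\<beta> / 2) + 6 * K * \<kappa>)
        \<in> o[at_right 0](\<lambda>\<kappa>. \<kappa> powr (1 / 2))"
      by (intro sum_in_smallo(1)) (use gt in \<open>auto intro!: powr_smallo_at_right_0 ident_smallo_at_right_0\<close>)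
    finally show "(\<lambda>\<kappa>. enn2real (v \<kappa>)) \<in> o[at_right 0](\<lambda>\<kappa>. sqrt \<kappa>)"
      by (simp only: landau_o.small.cong[OF sqrt_eq_powr_at_right_0])
  qed
qed

end
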